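(* Let $A\in\mathbb C^{m\times n}$ and $B\in\mathbb C_{\rm H}^{m}$ be given, and let $N=\begin{bmatrix} B & A \\ A^* & 0 \end{bmatrix}$. Then the following hold. (a) The following statements are equivalent: (i) there exists an $X\in\mathbb C_{\rm H}^{n}$ such that $AXA^*\succcurlyeq B$; (ii) $E_ABE_A\preccurlyeq 0$ and $\mathscr R(E_ABE_A)=\mathscr R(E_AB)$; (iii) $i_+(N)=r(A)$ and $i_-(N)=r[\,A,\ B\,]$. In this case, the general Hermitian solution of $AXA^*\succcurlyeq B$ and the corresponding $AXA^*$ can be written in the parametric forms $$X=A^{\dagger}B(A^{\dagger})^*-A^{\dagger}BE_A(E_ABE_A)^{\dagger}E_AB(A^{\dagger})^*+UU^*+W-A^{\dagger}AWA^{\dagger}A,$$ $$AXA^*=B-BE_A(E_ABE_A)^{\dagger}E_AB+AUU^*A^*,$$ where $U\in\mathbb C^{n\times n}$ and $W\in\mathbb C_{\rm H}^{n}$ are arbitrary. (b) There exists an $X\in\mathbb C_{\rm H}^{n}$ such that $AXA^*\succ B$ if and only if $$E_ABE_A\preccurlyeq 0\quad\text{and}\quad r(E_ABE_A)=r(E_A).$$ In this case, the general Hermitian solution of $AXA^*\succ B$ can be written as $$X=A^{\dagger}B(A^{\dagger})^*-A^{\dagger}BE_A(E_ABE_A)^{\dagger}E_AB(A^{\dagger})^*+UU^*+W-A^{\dagger}AWA^{\dagger}A,$$ in which $U$ is any matrix such that $r[\,BE_A,\ AU\,]=m$, say, $U=I_n$, and $W\in\mathbb C_{\rm H}^{n}$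 is arbitrary. (c) The following statements are equivalent: (i) there exists an $X\in\mathbb C_{\rm H}^{n}$ such that $AXA^*\preccurlyeq B$; (ii) $E_ABE_A\succcurlyeq 0$ and $\mathscr R(E_ABE_A)=\mathscr R(E_AB)$; (iii) $i_+(N)=r[\,A,\ B\,]$ and $i_-(N)=r(B)$. In this case, the general Hermitian solution of $AXA^*\preccurlyeq B$ and the corresponding $AXA^*$ can be written in the parametric forms $$X=A^{\dagger}B(A^{\dagger})^*-A^{\dagger}BE_A(E_ABE_A)^{\dagger}E_AB(A^{\dagger})^*-UU^*+W-A^{\dagger}AWA^{\dagger}A,$$ $$AXA^*=B-BE_A(E_ABE_A)^{\dagger}E_AB-AUU^*A^*,$$ where $U\in\mathbb C^{n\times n}$ and $W\in\mathbb C_{\rm H}^{n}$ are arbitrary. (d) There exists an $X\in\mathbb C_{\rm H}^{n}$ such that $AXA^*\prec B$ if and only if $$E_ABE_A\preccurlyeq 0\quad\text{and}\quad r(E_ABE_A)=r(E_A).$$ In this case, the general Hermitian solution of $AXA^*\prec B$ can be written as $$X=A^{\dagger}B(A^{\dagger})^*-A^{\dagger}BE_A(E_ABE_A)^{\dagger}E_AB(A^{\dagger})^*-UU^*+W-A^{\dagger}AWA^{\dagger}A,$$ in which $U$ is any matrix such that $r[\,BE_A,\ AU\,]=m$, say, $U=I_n$, and $W\in\mathbb C_{\rm H}^{n}$ is arbitrary.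
   Context: $\mathbb C_{\rm H}^{m}$ is the set of $m\times m$ complex Hermitian matrices. $r(\cdot)$ is rank, $\mathscr R(\cdot)$ is column space, ${}^*$ is conjugate transpose, ${}^\dagger$ is the Moore–Penrose inverse, $E_A=I_m-AA^{\dagger}$. $i_+(\cdot)$ and $i_-(\cdot)$ are the numbers of positive and negative eigenvalues (with multiplicity) of a Hermitian matrix. $[\,P,\ Q\,]$ is the row block matrix. $P\succcurlyeq Q$ ($P\succ Q$) means that $P$ and $Q$ are Hermitian and $P-Q$ is positive semi-definite (positive definite).
   Formalization: Two misprints are corrected: in (c)(iii) the condition is i_-(N)=r(A) instead of i_-(N)=r(B), and in (d) the condition is E_A B E_A ≽ 0 instead of E_A B E_A ≼ 0; both printed versions fail for m=n=1, A=0, B=1. *)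

theory Defs
  imports
    "Jordan_Normal_Form.Char_Poly"
    "Jordan_Normal_Form.Schur_Decomposition"
    "Jordan_Normal_Form.DL_Rank"
begin

definition hermitian_mats :: "nat \<Rightarrow> complex mat set" where
  "hermitian_mats k = {P \<in> carrier_mat k k. mat_adjoint P = P}"

(* The ordering on complex is that of HOL-Library.Complex_Order: 0 \<le> z says that z is real and
   nonnegative. The vector product (P *\<^sub>v x) \<bullet>c x is x^* P x. *)
definition pos_semidef :: "complex mat \<Rightarrow> bool" where
  "pos_semidef P \<longleftrightarrow> P \<in> hermitian_mats (dim_row P) \<and>
     (\<forall>x \<in> carrier_vec (dim_row P). 0 \<le> (P *\<^sub>v x) \<bullet>c x)"

definition pos_def :: "complex mat \<Rightarrow> bool" where
  "pos_def P \<longleftrightarrow> P \<in> hermitian_mats (dim_row P) \<and>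
     (\<forall>x \<in> carrier_vec (dim_row P). x \<noteq> 0\<^sub>v (dim_row P) \<longrightarrow> 0 < (P *\<^sub>v x) \<bullet>c x)"

(* The order of type class ord on matrices is entrywise, hence the separate symbols. *)
definition loewner_ge :: "complex mat \<Rightarrow> complex mat \<Rightarrow> bool" (infix \<open>\<succeq>\<^sub>L\<close> 50) where
  "P \<succeq>\<^sub>L Q \<longleftrightarrow> (\<exists>k. P \<in> hermitian_mats k \<and> Q \<in> hermitian_mats k) \<and> pos_semidef (P - Q)"

definition loewner_gt :: "complex mat \<Rightarrow> complex mat \<Rightarrow> bool" (infix \<open>\<succ>\<^sub>L\<close> 50) where
  "P \<succ>\<^sub>L Q \<longleftrightarrow> (\<exists>k. P \<in> hermitian_mats k \<and> Q \<in> hermitian_mats k) \<and> pos_def (P - Q)"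

abbreviation loewner_le :: "complex mat \<Rightarrow> complex mat \<Rightarrow> bool" (infix \<open>\<preceq>\<^sub>L\<close> 50) where
  "P \<preceq>\<^sub>L Q \<equiv> Q \<succeq>\<^sub>L P"

abbreviation loewner_lt :: "complex mat \<Rightarrow> complex mat \<Rightarrow> bool" (infix \<open>\<prec>\<^sub>L\<close> 50) where
  "P \<prec>\<^sub>L Q \<equiv> Q \<succ>\<^sub>L P"

abbreviation rk :: "complex mat \<Rightarrow> nat" where
  "rk P \<equiv> vec_space.rank (dim_row P) P"

abbreviation column_space :: "complex mat \<Rightarrow> complex vec set" where
  "column_space P \<equiv> vec_space.col_space (dim_row P) P"

definition row_block :: "complex mat \<Rightarrow> complex mat \<Rightarrow> complex mat" where
  "row_block P Q = four_block_mat P Q (0\<^sub>m 0 (dim_col P)) (0\<^sub>m 0 (dim_col Q))"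

(* The four Penrose equations. *)
definition is_mp_inverse :: "complex mat \<Rightarrow> complex mat \<Rightarrow> bool" where
  "is_mp_inverse P G \<longleftrightarrow> G \<in> carrier_mat (dim_col P) (dim_row P) \<and>
     P * G * P = P \<and> G * P * G = G \<and>
     mat_adjoint (P * G) = P * G \<and> mat_adjoint (G * P) = G * P"

definition mp_inverse :: "complex mat \<Rightarrow> complex mat" where
  "mp_inverse P = (THE G. is_mp_inverse P G)"

(* E_P = I - P P^+ *)
definition E_proj :: "complex mat \<Rightarrow> complex mat" where
  "E_proj P = 1\<^sub>m (dim_row P) - P * mp_inverse P"

(* The eigenvalues of a Hermitian matrix are real; they are counted with their multiplicity as
   roots of the characteristic polynomial. *)
definition pos_inertia :: "complex mat \<Rightarrow> nat" where
  "pos_inertia P =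
     (\<Sum>x \<in> {x :: real. 0 < x \<and> eigenvalue P (complex_of_real x)}.
        order (complex_of_real x) (char_poly P))"

definition neg_inertia :: "complex mat \<Rightarrow> nat" where
  "neg_inertia P =
     (\<Sum>x \<in> {x :: real. x < 0 \<and> eigenvalue P (complex_of_real x)}.
        order (complex_of_real x) (char_poly P))"

end

theory Submission
  imports Defs
begin

text \<open>Every rank is expressed as the trace of the orthogonal projection \<open>M M\<^sup>\<dagger>\<close>, whose existence and
  properties follow from the spectral theorem. Write \<open>E = E\<^sub>A\<close> and \<open>C = E B E\<close>. If \<open>M = A X A\<^sup>H - B\<close> is
  positive semidefinite then \<open>E M = - E B\<close> and \<open>E M E = - C\<close>, so \<open>C \<preceq> 0\<close>, and the kernel of \<open>C\<close> is killed
  by \<open>M E = - B E\<close>, which is the range condition. The Schur complement of \<open>E M E\<close> in \<open>M\<close> equals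
  \<open>A X A\<^sup>H - (B - B E C\<^sup>\<dagger> E B)\<close>; it is positive semidefinite, and its compression by \<open>A\<^sup>\<dagger>\<close> is the term
  \<open>U U\<^sup>H\<close>. For the inertia, \<open>N\<close> is congruent to \<open>[C, A; A\<^sup>H, 0]\<close>, which is a difference of positive
  semidefinite matrices of ranks at most \<open>r(A) + i\<^sub>+(C)\<close> and \<open>r(A) + i\<^sub>-(C)\<close>; since its rank is
  \<open>2 r(A) + r(C)\<close>, these bounds are attained by \<open>i\<^sub>+(N)\<close> and \<open>i\<^sub>-(N)\<close>. The inequalities \<open>A X A\<^sup>H \<preceq> B\<close> are
  those for \<open>- B\<close> and \<open>- X\<close>.\<close>

text \<open>Why trace: nested projections differ by a projection, whose trace is nonnegative and
  vanishes only for the zero matrix. This gives rank inequalities, and in the equality case a matrix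
  identity. The range condition of (a) and the rank condition of (b) thus take one shape: the
  projection \<open>C * G\<close>, with \<open>G\<close> the Moore-Penrose inverse of
  \<open>C\<close>, fixes \<open>E * B\<close>, respectively \<open>E\<close>. The strict
  inequalities reduce to kernels. Positive definite means positive semidefinite with trivial kernel,
  and the kernel of a sum of positive semidefinite matrices is the intersection of the kernels.
  Applied to the residual \<open>(Y0 - B) + (A * U) * (A * U)\<^sup>H\<close>, this produces the
  condition on \<open>[B E, A U]\<close>. The term \<open>W - Ap * A * W * Ap * A\<close> runs
  through the Hermitian matrices annihilated by sandwiching between \<open>A\<close> and
  \<open>A\<^sup>H\<close>. To represent a given solution \<open>X\<close> one can take
  \<open>W = X\<close>, which leaves only \<open>U\<close> to be found.\<close>

notation mat_adjoint (\<open>_\<^sup>H\<close> [1000] 1000)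

subsection \<open>Matrix algebra without explicit carriers\<close>

text \<open>The conditions are equations between dimensions and contain no variable beyond those of
  the conclusion, so the simplifier can discharge them without guessing carriers.\<close>

lemma mult_assoc_dim:
  fixes A B C :: "complex mat"
  shows "dim_col A = dim_row B \<Longrightarrow> dim_col B = dim_row C \<Longrightarrow> A * B * C = A * (B * C)"
  by (rule assoc_mult_mat) auto

text \<open>Once products are associated to the right, \<open>A * B\<close> is no longer a subterm
  of a longer chain. This form applies a known product in the middle of one.\<close>

lemma mult_left_cong_dim:
  fixes A B C X :: "complex mat"
  shows "A * B = C \<Longrightarrow> dim_col A = dim_row B \<Longrightarrow> dim_col B = dim_row X \<Longrightarrow> A * (B * X) = C * X"
  by (metis mult_assoc_dim)

lemma mult_distrib_dim:
  fixes A B C :: "complex mat"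
  shows "dim_row A = dim_row B \<Longrightarrow> dim_col A = dim_col B \<Longrightarrow> dim_col B = dim_row C \<Longrightarrow>
      (A + B) * C = A * C + B * C"
    and "dim_row A = dim_row B \<Longrightarrow> dim_col A = dim_col B \<Longrightarrow> dim_col B = dim_row C \<Longrightarrow>
      (A - B) * C = A * C - B * C"
    and "dim_row A = dim_row B \<Longrightarrow> dim_col A = dim_col B \<Longrightarrow> dim_col C = dim_row A \<Longrightarrow>
      C * (A + B) = C * A + C * B"
    and "dim_row A = dim_row B \<Longrightarrow> dim_col A = dim_col B \<Longrightarrow> dim_col C = dim_row A \<Longrightarrow>
      C * (A - B) = C * A - C * B"
     apply (rule add_mult_distrib_mat; auto)
    apply (rule minus_mult_distrib_mat; auto)
   apply (rule mult_add_distrib_mat; auto)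
  apply (rule mult_minus_distrib_mat; auto)
  done

lemma mult_uminus_dim:
  fixes A B :: "complex mat"
  shows "dim_col A = dim_row B \<Longrightarrow> (- A) * B = - (A * B)"
    and "dim_col A = dim_row B \<Longrightarrow> A * (- B) = - (A * B)"
  by auto

lemma mult_one_zero_dim:
  fixes A :: "complex mat"
  shows "dim_row A = k \<Longrightarrow> 1\<^sub>m k * A = A" and "dim_col A = k \<Longrightarrow> A * 1\<^sub>m k = A"
    and "dim_row A = k \<Longrightarrow> 0\<^sub>m l k * A = 0\<^sub>m l (dim_col A)"
    and "dim_col A = k \<Longrightarrow> A * 0\<^sub>m k l = 0\<^sub>m (dim_row A) l"
  by auto

lemma add_zero_dim:
  fixes A :: "complex mat"
  shows "dim_row A = k \<Longrightarrow> dim_col A = l \<Longrightarrow> 0\<^sub>m k l + A = A"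
    and "dim_row A = k \<Longrightarrow> dim_col A = l \<Longrightarrow> A + 0\<^sub>m k l = A"
    and "dim_row A = k \<Longrightarrow> dim_col A = l \<Longrightarrow> A - 0\<^sub>m k l = A"
    and "dim_row A = k \<Longrightarrow> dim_col A = l \<Longrightarrow> 0\<^sub>m k l - A = - A"
    and "dim_row A = k \<Longrightarrow> dim_col A = l \<Longrightarrow> A - A = 0\<^sub>m k l"
    and "- (- A) = A" and "- (0\<^sub>m k l) = (0\<^sub>m k l :: complex mat)"
  by (rule eq_matI; simp)+

lemma mult_vec_dim:
  fixes A B :: "complex mat"
  shows "dim_col A = dim_row B \<Longrightarrow> dim_col B = dim_vec x \<Longrightarrow> A * B *\<^sub>v x = A *\<^sub>v (B *\<^sub>v x)"
  by (rule assoc_mult_mat_vec) auto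

lemma mat_adjoint_eq:
  "mat_adjoint A = mat (dim_col A) (dim_row A) (\<lambda>(i, j). conjugate (A $$ (j, i)))"
  by (rule eq_matI) (auto simp: mat_adjoint_def mat_of_rows_def)

lemma adjoint_dim [simp]:
  "dim_row (A\<^sup>H) = dim_col A" "dim_col (A\<^sup>H) = dim_row A"
  by (auto simp: mat_adjoint_eq)

lemma adjoint_carrier [simp]: "A \<in> carrier_mat m n \<Longrightarrow> A\<^sup>H \<in> carrier_mat n m"
  by (rule carrier_matI) (simp_all add: carrier_matD)

lemma adjoint_index [simp]:
  "i < dim_col A \<Longrightarrow> j < dim_row A \<Longrightarrow> A\<^sup>H $$ (i, j) = conjugate (A $$ (j, i))"
  by (simp add: mat_adjoint_eq)

lemma adjoint_adjoint [simp]: "(A\<^sup>H)\<^sup>H = A"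
  by (rule eq_matI) auto

lemma adjoint_one [simp]: "(1\<^sub>m n :: complex mat)\<^sup>H = 1\<^sub>m n"
  by (rule eq_matI) auto

lemma adjoint_zero [simp]: "(0\<^sub>m m n :: complex mat)\<^sup>H = 0\<^sub>m n m"
  by (rule eq_matI) auto

lemma adjoint_mult:
  fixes A B :: "complex mat"
  assumes "dim_col A = dim_row B"
  shows "(A * B)\<^sup>H = B\<^sup>H * A\<^sup>H"
  by (rule eq_matI) (use assms in \<open>auto simp: scalar_prod_def mult.commute intro!: sum.cong\<close>)

lemma adjoint_add:
  fixes A B :: "complex mat"
  shows "dim_row A = dim_row B \<Longrightarrow> dim_col A = dim_col B \<Longrightarrow> (A + B)\<^sup>H = A\<^sup>H + B\<^sup>H"
    and "dim_row A = dim_row B \<Longrightarrow> dim_col A = dim_col B \<Longrightarrow> (A - B)\<^sup>H = A\<^sup>H - B\<^sup>H"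
    and "(- A)\<^sup>H = - (A\<^sup>H)"
  by (auto intro!: eq_matI)

lemma adjoint_smult: "(c \<cdot>\<^sub>m A)\<^sup>H = cnj c \<cdot>\<^sub>m A\<^sup>H"
  by (rule eq_matI) auto

lemma mat_diag_dims [simp]: "dim_row (mat_diag n f) = n" "dim_col (mat_diag n f) = n"
  by (simp_all add: mat_diag_def)

lemma adjoint_diag: "(mat_diag n f)\<^sup>H = mat_diag n (\<lambda>i. cnj (f i))"
  by (rule eq_matI) (auto simp: mat_diag_def)

lemmas mat_alg = mult_assoc_dim mult_distrib_dim mult_uminus_dim mult_one_zero_dim add_zero_dim
  adjoint_mult adjoint_add

lemma adjoint_scalar_prod:
  fixes A :: "complex mat"
  assumes "x \<in> carrier_vec (dim_col A)" "y \<in> carrier_vec (dim_row A)"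
  shows "(A *\<^sub>v x) \<bullet>c y = x \<bullet>c (A\<^sup>H *\<^sub>v y)"
proof -
  have "(A *\<^sub>v x) \<bullet>c y = (\<Sum>i<dim_row A. \<Sum>j<dim_col A. A $$ (i, j) * x $ j * cnj (y $ i))"
    using assms by (auto simp: scalar_prod_def sum_distrib_right atLeast0LessThan)
  also have "\<dots> = (\<Sum>j<dim_col A. \<Sum>i<dim_row A. A $$ (i, j) * x $ j * cnj (y $ i))"
    by (rule sum.swap)
  also have "\<dots> = x \<bullet>c (A\<^sup>H *\<^sub>v y)"
    using assms
    by (auto simp: scalar_prod_def sum_distrib_left atLeast0LessThan mult_ac intro!: sum.cong)
  finally show ?thesis .
qed

lemma hermitian_matsD:
  assumes "P \<in> hermitian_mats k"
  shows "P \<in> carrier_mat k k" "P\<^sup>H = P" "dim_row P = k" "dim_col P = k"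
  using assms by (auto simp: hermitian_mats_def)

lemma zero_mat_mult_vec:
  "x \<in> carrier_vec n \<Longrightarrow> 0\<^sub>m m n *\<^sub>v x = (0\<^sub>v m :: complex vec)"
  by (rule eq_vecI) auto

lemma mat_eq_zeroI:
  fixes A :: "complex mat"
  assumes "A \<in> carrier_mat m n" and "\<And>x. x \<in> carrier_vec n \<Longrightarrow> A *\<^sub>v x = 0\<^sub>v m"
  shows "A = 0\<^sub>m m n"
proof (rule eq_matI)
  fix i j assume "i < dim_row (0\<^sub>m m n :: complex mat)" "j < dim_col (0\<^sub>m m n :: complex mat)"
  then have ij: "i < m" "j < n" by auto
  then have "(A *\<^sub>v unit_vec n j) $ i = A $$ (i, j)"
    using assms(1) by (simp add: scalar_prod_right_unit)
  then show "A $$ (i, j) = 0\<^sub>m m n $$ (i, j)"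
    using assms(2)[of "unit_vec n j"] ij by simp
qed (use assms in auto)

lemma minus_zero_eq:
  fixes A B :: "complex mat"
  assumes "A \<in> carrier_mat m n" "B \<in> carrier_mat m n" "A - B = 0\<^sub>m m n"
  shows "A = B"
proof (rule eq_matI)
  fix i j assume "i < dim_row B" "j < dim_col B"
  then have ij: "i < m" "j < n"
    using assms by auto
  have "(A - B) $$ (i, j) = 0"
    unfolding assms(3) using ij by simp
  then show "A $$ (i, j) = B $$ (i, j)"
    using ij assms(1,2) by simp
qed (use assms in auto)

text \<open>The quadratic form of \<open>A\<^sup>H * A\<close> at \<open>x\<close> is the squared
  norm of \<open>A x\<close>.\<close>

lemma gram_eq_zero:
  fixes A :: "complex mat"
  assumes "A \<in> carrier_mat m n" "A\<^sup>H * A = 0\<^sub>m n n"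
  shows "A = 0\<^sub>m m n"
proof (rule mat_eq_zeroI[OF assms(1)])
  fix x :: "complex vec" assume x: "x \<in> carrier_vec n"
  have "(A *\<^sub>v x) \<bullet>c (A *\<^sub>v x) = x \<bullet>c (A\<^sup>H * A *\<^sub>v x)"
    using adjoint_scalar_prod[of x A "A *\<^sub>v x"] assms(1) x by (simp add: mult_vec_dim)
  also have "\<dots> = 0"
    using x zero_mat_mult_vec[OF x, of n] by (simp add: assms(2))
  finally show "A *\<^sub>v x = 0\<^sub>v m"
    using conjugate_square_eq_0_vec[of "A *\<^sub>v x" m] assms(1) x by simp
qed

lemma gram_vec_eq_zero:
  fixes A :: "complex mat"
  assumes "A \<in> carrier_mat m n" "x \<in> carrier_vec m" "(A * A\<^sup>H *\<^sub>v x) \<bullet>c x = 0"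
  shows "A\<^sup>H *\<^sub>v x = 0\<^sub>v n"
proof -
  have "A\<^sup>H *\<^sub>v x \<in> carrier_vec n"
    using assms by (metis adjoint_carrier mult_mat_vec_carrier)
  then have "(A\<^sup>H *\<^sub>v x) \<bullet>c (A\<^sup>H *\<^sub>v x) = 0"
    using adjoint_scalar_prod[of "A\<^sup>H *\<^sub>v x" A x] assms by (simp add: mult_vec_dim)
  then show ?thesis
    using conjugate_square_eq_0_vec[of "A\<^sup>H *\<^sub>v x" n] \<open>A\<^sup>H *\<^sub>v x \<in> carrier_vec n\<close> by blast
qed

subsection \<open>Spectral theorem\<close>

text \<open>Gram-Schmidt on a basis that begins with \<open>v\<close> leaves the first vector
  unchanged, and normalising the columns only rescales it. With \<open>v\<close> an eigenvector this
  is the deflation step of the spectral theorem.\<close>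

lemma ex_unitary_col:
  fixes v :: "complex vec"
  assumes v: "v \<in> carrier_vec n" "v \<noteq> 0\<^sub>v n"
  obtains W c where "W \<in> carrier_mat n n" "W\<^sup>H * W = 1\<^sub>m n" "col W 0 = c \<cdot>\<^sub>v v"
proof -
  interpret cof_vec_space n "TYPE(complex)" .
  define b where "b = basis_completion v"
  define ws where "ws = gram_schmidt n b"
  have n: "n \<noteq> 0" using v by auto
  from basis_completion[OF v, folded b_def]
  have dist_b: "distinct b" and indep: "\<not> lin_dep (set b)" and b: "set b \<subseteq> carrier_vec n"
    and hdb: "hd b = v" and len_b: "length b = n" by auto
  from hdb len_b n obtain vs where bv: "b = v # vs" by (cases b) auto
  from gram_schmidt_result[OF b dist_b indep refl, folded ws_def]
  have ws: "set ws \<subseteq> carrier_vec n" "corthogonal ws" "length ws = n" by (auto simp: len_b)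
  have hdws: "hd ws = v" using gram_schmidt_hd[OF v(1), of vs] by (simp add: ws_def bv)
  define s where "s i = complex_of_real (sqrt (Re ((ws ! i) \<bullet>c (ws ! i))))" for i
  have wsc: "ws ! i \<in> carrier_vec n" if "i < n" for i
    using ws that by auto
  have s: "s i * s i = (ws ! i) \<bullet>c (ws ! i)" "s i \<noteq> 0" "cnj (s i) = s i" if "i < n" for i
  proof -
    have nz: "(ws ! i) \<bullet>c (ws ! i) \<noteq> 0"
      using corthogonalD[OF ws(2), of i i] ws(3) that by auto
    moreover have "0 \<le> (ws ! i) \<bullet>c (ws ! i)"
      by (rule conjugate_square_ge_0_vec)
    ultimately have re: "(ws ! i) \<bullet>c (ws ! i) = complex_of_real (Re ((ws ! i) \<bullet>c (ws ! i)))"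
      "0 \<le> Re ((ws ! i) \<bullet>c (ws ! i))"
      by (auto simp: less_eq_complex_def complex_eq_iff)
    have "s i * s i = complex_of_real (Re ((ws ! i) \<bullet>c (ws ! i)))"
      using re(2) by (simp add: s_def flip: of_real_mult)
    then show "s i * s i = (ws ! i) \<bullet>c (ws ! i)" using re(1) by simp
    then show "s i \<noteq> 0" using nz by auto
    show "cnj (s i) = s i" by (simp add: s_def)
  qed
  define W where "W = mat n n (\<lambda>(i, j). (ws ! j) $ i / s j)"
  have W: "W \<in> carrier_mat n n" by (simp add: W_def)
  moreover have "W\<^sup>H * W = 1\<^sub>m n"
  proof (rule eq_matI)
    fix i j assume "i < dim_row (1\<^sub>m n :: complex mat)" "j < dim_col (1\<^sub>m n :: complex mat)"
    then have ij: "i < n" "j < n" by auto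
    have "(W\<^sup>H * W) $$ (i, j) = (\<Sum>k<n. cnj ((ws ! i) $ k / s i) * ((ws ! j) $ k / s j))"
      using ij by (simp add: W_def scalar_prod_def atLeast0LessThan)
    also have "\<dots> = (\<Sum>k<n. (ws ! j) $ k * cnj ((ws ! i) $ k)) / (s i * s j)"
      using ij by (simp add: s sum_divide_distrib mult.commute)
    also have "(\<Sum>k<n. (ws ! j) $ k * cnj ((ws ! i) $ k)) = (ws ! j) \<bullet>c (ws ! i)"
      using wsc[OF ij(1)] by (simp add: scalar_prod_def atLeast0LessThan)
    also have "\<dots> / (s i * s j) = (if i = j then 1 else 0)"
      using corthogonalD[OF ws(2), of j i] ij ws(3) s[of i] by auto
    finally show "(W\<^sup>H * W) $$ (i, j) = 1\<^sub>m n $$ (i, j)" using ij by simp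
  qed (use W in auto)
  moreover have "col W 0 = (1 / s 0) \<cdot>\<^sub>v v"
  proof (rule eq_vecI)
    fix i assume "i < dim_vec ((1 / s 0) \<cdot>\<^sub>v v)"
    moreover have "ws ! 0 = v" using hdws ws(3) n by (metis hd_conv_nth list.size(3))
    ultimately show "col W 0 $ i = ((1 / s 0) \<cdot>\<^sub>v v) $ i" using v n by (simp add: W_def)
  qed (use v W in auto)
  ultimately show ?thesis by (rule that)
qed

lemma unitary_commute:
  fixes U :: "complex mat"
  assumes "U \<in> carrier_mat n n" "U\<^sup>H * U = 1\<^sub>m n"
  shows "U * U\<^sup>H = 1\<^sub>m n"
  using mat_mult_left_right_inverse[OF adjoint_carrier[OF assms(1)] assms] .

text \<open>Induction by deflation. In a unitary basis beginning with an eigenvector the first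
  column is zero below the diagonal; symmetry then clears the first row and makes the eigenvalue
  real, and the remaining block is again Hermitian.\<close>

theorem hermitian_spectral:
  assumes "H \<in> hermitian_mats n"
  obtains U d where "U \<in> carrier_mat n n" "U\<^sup>H * U = 1\<^sub>m n" "U * U\<^sup>H = 1\<^sub>m n"
    "H = U * mat_diag n (\<lambda>i. complex_of_real (d i)) * U\<^sup>H"
proof -
  have "\<exists>U d. U \<in> carrier_mat n n \<and> U\<^sup>H * U = 1\<^sub>m n \<and>
      H = U * mat_diag n (\<lambda>i. complex_of_real (d i)) * U\<^sup>H"
    using assms
  proof (induction n arbitrary: H)
    case 0
    then show ?case
      by (intro exI[of _ "1\<^sub>m 0"]) (auto simp: hermitian_mats_def intro!: eq_matI)
  next
    case (Suc n)
    note H = hermitian_matsD[OF Suc.prems]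
    have "degree (char_poly H) = Suc n"
      using degree_monic_char_poly[OF H(1)] by simp
    then have "\<not> constant (poly (char_poly H))"
      by (simp add: constant_degree)
    then obtain e where "poly (char_poly H) e = 0"
      using fundamental_theorem_of_algebra by blast
    then have "eigenvalue H e"
      using eigenvalue_root_char_poly[OF H(1)] by simp
    then obtain v where v: "v \<in> carrier_vec (Suc n)" "v \<noteq> 0\<^sub>v (Suc n)" "H *\<^sub>v v = e \<cdot>\<^sub>v v"
      using H(1) by (auto simp: eigenvalue_def eigenvector_def)
    obtain W c where W: "W \<in> carrier_mat (Suc n) (Suc n)" "W\<^sup>H * W = 1\<^sub>m (Suc n)"
      and col0: "col W 0 = c \<cdot>\<^sub>v v"
      using ex_unitary_col[OF v(1,2)] by blast
    note W' = unitary_commute[OF W]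
    have Wd: "dim_row W = Suc n" "dim_col W = Suc n" using W by auto
    define H1 where "H1 = W\<^sup>H * (H * W)"
    have H1: "H1 \<in> carrier_mat (Suc n) (Suc n)" "H1\<^sup>H = H1"
      using H Wd by (auto simp: H1_def mat_alg)
    have HW0: "(H * W) $$ (k, 0) = e * W $$ (k, 0)" if "k < Suc n" for k
    proof -
      have "col (H * W) 0 = H *\<^sub>v col W 0"
        by (rule col_mult2[OF H(1) W(1)]) simp
      also have "\<dots> = e \<cdot>\<^sub>v col W 0"
        unfolding col0 using v H(1)
        by (simp add: mult_mat_vec smult_smult_assoc mult.commute)
      finally have "col (H * W) 0 $ k = (e \<cdot>\<^sub>v col W 0) $ k" by simp
      then show ?thesis using that H Wd by simp
    qed
    have H10: "H1 $$ (i, 0) = (if i = 0 then e else 0)" if "i < Suc n" for i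
    proof -
      have "H1 $$ (i, 0) = (\<Sum>k<Suc n. W\<^sup>H $$ (i, k) * (e * W $$ (k, 0)))"
        using that H Wd HW0
        by (simp add: H1_def scalar_prod_def atLeast0LessThan del: sum.lessThan_Suc)
      also have "\<dots> = e * (W\<^sup>H * W) $$ (i, 0)"
        using that Wd
        by (simp add: scalar_prod_def atLeast0LessThan sum_distrib_left mult_ac del: sum.lessThan_Suc)
      finally show ?thesis using that W(2) by simp
    qed
    have herm1: "H1 $$ (i, j) = cnj (H1 $$ (j, i))" if "i < Suc n" "j < Suc n" for i j
    proof -
      have "H1\<^sup>H $$ (i, j) = cnj (H1 $$ (j, i))" using H1(1) that by simp
      then show ?thesis by (simp add: H1(2))
    qed
    have e: "complex_of_real (Re e) = e"
      using herm1[of 0 0] H10[of 0] by (simp add: complex_eq_iff)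
    define H2 where "H2 = mat n n (\<lambda>(i, j). H1 $$ (Suc i, Suc j))"
    have "H2 \<in> hermitian_mats n"
      unfolding hermitian_mats_def
    proof (intro CollectI conjI)
      show "H2\<^sup>H = H2"
        by (rule eq_matI) (auto simp: H2_def intro: herm1[symmetric])
    qed (simp add: H2_def)
    from Suc.IH[OF this] obtain V d where V: "V \<in> carrier_mat n n" "V\<^sup>H * V = 1\<^sub>m n"
      and H2: "H2 = V * mat_diag n (\<lambda>i. complex_of_real (d i)) * V\<^sup>H" by blast
    define V1 where "V1 = four_block_mat (1\<^sub>m 1) (0\<^sub>m 1 n) (0\<^sub>m n 1) V"
    define D where "D = mat_diag (Suc n) (\<lambda>i. complex_of_real (case_nat (Re e) d i))"
    have Vd: "dim_row V = n" "dim_col V = n" using V by auto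
    have V1: "V1 \<in> carrier_mat (Suc n) (Suc n)" using Vd by (auto simp: V1_def)
    have V1a: "V1\<^sup>H = four_block_mat (1\<^sub>m 1) (0\<^sub>m 1 n) (0\<^sub>m n 1) (V\<^sup>H)"
      by (rule eq_matI) (auto simp: V1_def Vd)
    have D: "D = four_block_mat (mat 1 1 (\<lambda>_. e)) (0\<^sub>m 1 n) (0\<^sub>m n 1)
        (mat_diag n (\<lambda>i. complex_of_real (d i)))"
      using e by (intro eq_matI) (auto simp: D_def mat_diag_def split: nat.splits)
    have H1b: "H1 = four_block_mat (mat 1 1 (\<lambda>_. e)) (0\<^sub>m 1 n) (0\<^sub>m n 1) H2"
    proof (rule eq_matI)
      fix i j assume "i < dim_row (four_block_mat (mat 1 1 (\<lambda>_. e)) (0\<^sub>m 1 n) (0\<^sub>m n 1) H2)"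
        "j < dim_col (four_block_mat (mat 1 1 (\<lambda>_. e)) (0\<^sub>m 1 n) (0\<^sub>m n 1) H2)"
      then have ij: "i < Suc n" "j < Suc n" by (auto simp: H2_def)
      then show "H1 $$ (i, j) = four_block_mat (mat 1 1 (\<lambda>_. e)) (0\<^sub>m 1 n) (0\<^sub>m n 1) H2 $$ (i, j)"
        using H10[of i] H10[of j] herm1[of 0 j] by (auto simp: H2_def)
    qed (use H1 in \<open>auto simp: H2_def\<close>)
    have "V1\<^sup>H * V1 = 1\<^sub>m (Suc n)"
      unfolding V1a unfolding V1_def
      by (subst mult_four_block_mat[of _ 1 1 _ n _ n _ _ 1 _ n])
        (use V in \<open>auto simp: four_block_one_mat[of 1 n, simplified]\<close>)
    moreover have "V1 * D * V1\<^sup>H = H1"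
    proof -
      have VD: "V1 * D = four_block_mat (mat 1 1 (\<lambda>_. e)) (0\<^sub>m 1 n) (0\<^sub>m n 1)
          (V * mat_diag n (\<lambda>i. complex_of_real (d i)))"
        unfolding V1_def D
        by (subst mult_four_block_mat[of _ 1 1 _ n _ n _ _ 1 _ n])
          (use V in \<open>auto simp: left_mult_zero_mat[OF mat_diag_dim]\<close>)
      show ?thesis
        unfolding VD V1a H1b H2
        by (subst mult_four_block_mat[of _ 1 1 _ n _ n _ _ 1 _ n])
          (use V in \<open>auto simp: mult_carrier_mat[OF V(1) mat_diag_dim]\<close>)
    qed
    moreover have "H = W * H1 * W\<^sup>H"
      using H Wd W' mult_left_cong_dim[OF W'] by (simp add: H1_def mat_alg)
    ultimately have V1u: "V1\<^sup>H * V1 = 1\<^sub>m (Suc n)" and "H = W * (V1 * D * V1\<^sup>H) * W\<^sup>H"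
      by auto
    then have "H = (W * V1) * D * (W * V1)\<^sup>H"
      using V1 Wd by (simp add: mat_alg D_def)
    moreover have "(W * V1)\<^sup>H * (W * V1) = 1\<^sub>m (Suc n)"
      using V1 Wd V1u by (simp add: mat_alg mult_left_cong_dim[OF W(2)])
    ultimately show ?case
      using mult_carrier_mat[OF W(1) V1] unfolding D_def by blast
  qed
  then show ?thesis using that unitary_commute by blast
qed

subsection \<open>Trace and Moore--Penrose inverse\<close>

definition mat_trace :: "complex mat \<Rightarrow> complex" where
  "mat_trace A = (\<Sum>i<dim_row A. A $$ (i, i))"

lemma mat_trace_mult_commute:
  assumes "dim_col A = dim_row B" "dim_row A = dim_col B"
  shows "mat_trace (A * B) = mat_trace (B * A)"
proof -
  have "mat_trace (A * B) = (\<Sum>i<dim_row A. \<Sum>j<dim_row B. A $$ (i, j) * B $$ (j, i))"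
    using assms by (simp add: mat_trace_def scalar_prod_def atLeast0LessThan)
  also have "\<dots> = (\<Sum>j<dim_row B. \<Sum>i<dim_row A. A $$ (i, j) * B $$ (j, i))"
    by (rule sum.swap)
  also have "\<dots> = mat_trace (B * A)"
    using assms by (simp add: mat_trace_def scalar_prod_def atLeast0LessThan mult.commute)
  finally show ?thesis .
qed

lemma mat_trace_add:
  assumes "A \<in> carrier_mat n n" "B \<in> carrier_mat n n"
  shows "mat_trace (A + B) = mat_trace A + mat_trace B"
    and "mat_trace (A - B) = mat_trace A - mat_trace B"
  using assms by (auto simp: mat_trace_def sum.distrib sum_subtractf)

lemma mat_trace_one: "mat_trace (1\<^sub>m n) = of_nat n"
  by (simp add: mat_trace_def)

text \<open>This is the squared Frobenius norm; hence the trace of a Gram matrix is nonnegative and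
  detects zero.\<close>

lemma mat_trace_gram:
  "mat_trace (A\<^sup>H * A) = complex_of_real (\<Sum>i<dim_col A. \<Sum>j<dim_row A. (cmod (A $$ (j, i)))\<^sup>2)"
  by (simp add: mat_trace_def scalar_prod_def atLeast0LessThan complex_norm_square mult.commute
      del: of_real_power)

lemma mat_trace_gram_eq_0:
  assumes "mat_trace (A\<^sup>H * A) = 0"
  shows "A = 0\<^sub>m (dim_row A) (dim_col A)"
proof -
  have "(\<Sum>i<dim_col A. \<Sum>j<dim_row A. (cmod (A $$ (j, i)))\<^sup>2) = 0"
    using assms unfolding mat_trace_gram of_real_eq_0_iff .
  then have "A $$ (j, i) = 0" if "i < dim_col A" "j < dim_row A" for i j
    using that by (simp add: sum_nonneg_eq_0_iff sum_nonneg)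
  then show ?thesis by (intro eq_matI) auto
qed

text \<open>\<open>M * G\<close> and \<open>M * K\<close> are self-adjoint and each absorbs the
  other, so taking the adjoint of one product identifies them; likewise \<open>G * M\<close> and
  \<open>K * M\<close>. Then \<open>G = G * M * G\<close> is determined by these two
  projections.\<close>

lemma mp_inverse_unique:
  assumes "is_mp_inverse M G" "is_mp_inverse M K"
  shows "G = K"
proof -
  have dims: "dim_row G = dim_col M" "dim_col G = dim_row M" "dim_row K = dim_col M" "dim_col K = dim_row M"
    using assms by (auto simp: is_mp_inverse_def)
  note G = assms(1)[unfolded is_mp_inverse_def] and K = assms(2)[unfolded is_mp_inverse_def]
  have "M * G = (M * K) * (M * G)"
    using K dims by (metis index_mult_mat(2,3) mult_assoc_dim)
  also have "\<dots> = ((M * G) * (M * K))\<^sup>H"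
    using G K dims by (simp add: adjoint_mult)
  also have "(M * G) * (M * K) = M * K"
    using G dims by (metis index_mult_mat(2,3) mult_assoc_dim)
  finally have MG: "M * G = M * K" using K by simp
  have "G * M = (G * M) * (K * M)"
    using K dims by (metis index_mult_mat(2,3) mult_assoc_dim)
  also have "\<dots> = ((K * M) * (G * M))\<^sup>H"
    using G K dims by (simp add: adjoint_mult)
  also have "(K * M) * (G * M) = K * M"
    using G dims by (metis index_mult_mat(2,3) mult_assoc_dim)
  finally have GM: "G * M = K * M" using K by simp
  have "G = G * M * G" using G by simp
  also have "\<dots> = K * M * K"
    using GM MG dims by (simp add: mult_assoc_dim)
  finally show ?thesis using K by simp
qed

lemma is_mp_inverse_mp_inverse_of:
  assumes "is_mp_inverse M G"
  shows "mp_inverse M = G"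
  unfolding mp_inverse_def using assms by (blast intro: mp_inverse_unique)

lemma is_mp_inverse_adjoint:
  assumes "is_mp_inverse M G"
  shows "is_mp_inverse (M\<^sup>H) (G\<^sup>H)"
proof -
  have d: "dim_row G = dim_col M" "dim_col G = dim_row M"
    using assms by (auto simp: is_mp_inverse_def)
  have "M\<^sup>H * G\<^sup>H * M\<^sup>H = (M * G * M)\<^sup>H" "G\<^sup>H * M\<^sup>H * G\<^sup>H = (G * M * G)\<^sup>H"
    "M\<^sup>H * G\<^sup>H = (G * M)\<^sup>H" "G\<^sup>H * M\<^sup>H = (M * G)\<^sup>H"
    using d by (simp_all add: mat_alg)
  then show ?thesis
    using assms by (simp add: is_mp_inverse_def)
qed

lemma ex_mp_inverse_hermitian:
  assumes "H \<in> hermitian_mats n"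
  shows "\<exists>G. is_mp_inverse H G"
proof -
  obtain U d where U: "U \<in> carrier_mat n n" "U\<^sup>H * U = 1\<^sub>m n"
    and H: "H = U * mat_diag n (\<lambda>i. complex_of_real (d i)) * U\<^sup>H"
    using hermitian_spectral[OF assms] by metis
  define D where "D = mat_diag n (\<lambda>i. complex_of_real (d i))"
  \<comment> \<open>The convention \<open>inverse 0 = 0\<close> leaves zero eigenvalues at zero, as
    the pseudo-inverse requires.\<close>
  define K where "K = mat_diag n (\<lambda>i. complex_of_real (inverse (d i)))"
  have inv: "x * (x * inverse x) = x" "inverse x * (x * inverse x) = inverse x" for x :: complex
    by (cases "x = 0"; simp)+
  have *: "D * (K * D) = D" "K * (D * K) = K" "D * K = K * D" "D\<^sup>H = D" "K\<^sup>H = K"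
    unfolding D_def K_def mat_diag_diag adjoint_diag
    by (simp_all add: inv mult.commute)
  have dims: "dim_row U = n" "dim_col U = n" "dim_row D = n" "dim_col D = n" "dim_row K = n" "dim_col K = n"
    using U by (auto simp: D_def K_def)
  have "is_mp_inverse H (U * K * U\<^sup>H)"
    unfolding is_mp_inverse_def H D_def[symmetric]
    using dims * mult_left_cong_dim[OF *(1)] mult_left_cong_dim[OF *(2)] mult_left_cong_dim[OF *(3)]
    by (auto simp: mat_alg mult_left_cong_dim[OF U(2)])
  then show ?thesis ..
qed

text \<open>The general case reduces to the Hermitian one: the inverse of \<open>M\<close> is
  \<open>L * M\<^sup>H\<close>, where \<open>L\<close> is the inverse of
  \<open>K = M\<^sup>H * M\<close>.\<close>

lemma is_mp_inverse_mp_inverse: "is_mp_inverse M (mp_inverse M)"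
proof -
  define K where "K = M\<^sup>H * M"
  define n where "n = dim_col M"
  have "K \<in> hermitian_mats n"
    by (auto simp: K_def hermitian_mats_def adjoint_mult n_def)
  then obtain L where L: "is_mp_inverse K L"
    using ex_mp_inverse_hermitian by blast
  note K = hermitian_matsD[OF \<open>K \<in> hermitian_mats n\<close>]
  have L': "K * (L * K) = K" "L * (K * L) = L" "L\<^sup>H * K = K * L" "K * L\<^sup>H = L * K"
    and Ld: "dim_row L = n" "dim_col L = n"
    using L K by (auto simp: is_mp_inverse_def adjoint_mult mult_assoc_dim)
  have Md: "dim_col M = n" by (simp add: n_def)
  \<comment> \<open>\<open>M\<close> itself cannot be cancelled from \<open>K * (L * K) = K\<close>,
    but the Gram matrix of the difference involves only \<open>K\<close> and \<open>L\<close>, and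
    it vanishes.\<close>
  have "M - M * (L * K) = 0\<^sub>m (dim_row M) n"
  proof (rule gram_eq_zero)
    have "(M - M * (L * K))\<^sup>H * (M - M * (L * K)) =
        (K - K * (L\<^sup>H * K)) - (K * (L * K) - K * (L\<^sup>H * (K * (L * K))))"
      using K Ld Md
      by (simp add: mat_alg K_def)
    then show "(M - M * (L * K))\<^sup>H * (M - M * (L * K)) = 0\<^sub>m n n"
      using K Ld L' by (simp add: mat_alg)
  qed (use Md K in auto)
  then have MLK: "M * (L * K) = M"
    by (rule minus_zero_eq[symmetric, rotated 2]) (use Md K Ld in \<open>auto intro!: carrier_matI\<close>)
  have LH: "L\<^sup>H = L"
    using mp_inverse_unique[of K "L\<^sup>H" L] is_mp_inverse_adjoint[OF L] L K(2) by simp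
  have LK: "L * (M\<^sup>H * M) = M\<^sup>H * (M * L)"
    using L'(3) LH Md Ld by (simp add: K_def mat_alg)
  have "is_mp_inverse M (L * M\<^sup>H)"
    unfolding is_mp_inverse_def
  proof (intro conjI)
    show "L * M\<^sup>H * M * (L * M\<^sup>H) = L * M\<^sup>H"
      using mult_left_cong_dim[OF L'(2), of "M\<^sup>H"] Md Ld by (simp add: K_def mat_alg)
    show "(L * M\<^sup>H * M)\<^sup>H = L * M\<^sup>H * M"
      using LK LH Md Ld by (simp add: mat_alg)
  qed (use MLK LH Md Ld in \<open>auto simp: K_def mat_alg\<close>)
  then show ?thesis
    using is_mp_inverse_mp_inverse_of by simp
qed


lemma mp_inverse_simps:
  assumes "M \<in> carrier_mat m n"
  shows "mp_inverse M \<in> carrier_mat n m" "dim_row (mp_inverse M) = n" "dim_col (mp_inverse M) = m"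
    "M * (mp_inverse M * M) = M" "mp_inverse M * (M * mp_inverse M) = mp_inverse M"
    "(mp_inverse M)\<^sup>H * M\<^sup>H = M * mp_inverse M" "M\<^sup>H * (mp_inverse M)\<^sup>H = mp_inverse M * M"
  using is_mp_inverse_mp_inverse[of M] assms
  by (auto simp: is_mp_inverse_def adjoint_mult mult_assoc_dim)

lemma mp_inverse_uminus: "mp_inverse (- M) = - mp_inverse M"
proof (rule is_mp_inverse_mp_inverse_of)
  note M = mp_inverse_simps[of M "dim_row M" "dim_col M"]
  show "is_mp_inverse (- M) (- mp_inverse M)"
    unfolding is_mp_inverse_def using M by (auto simp: mat_alg)
qed

lemma mp_inverse_hermitian:
  assumes "P \<in> hermitian_mats k"
  shows "(mp_inverse P)\<^sup>H = mp_inverse P"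
  using mp_inverse_unique[OF is_mp_inverse_adjoint[OF is_mp_inverse_mp_inverse[of P]]
    is_mp_inverse_mp_inverse[of "P\<^sup>H"]] hermitian_matsD(2)[OF assms] by simp

subsection \<open>Rank\<close>

lemma column_space_eq:
  "column_space M = {M *\<^sub>v x | x. x \<in> carrier_vec (dim_col M)}"
  using vec_space.col_space_eq[of M "dim_row M" "dim_col M"]
    mult_mat_vec_carrier[of M "dim_row M" "dim_col M"] by auto

lemma rk_cong_column_space:
  assumes "dim_row M = dim_row K" "column_space M = column_space K"
  shows "rk M = rk K"
  using assms by (simp add: vec_space.rank_def vec_space.col_space_def)

lemma rk_isometry:
  assumes Q: "Q \<in> carrier_mat n k" "Q\<^sup>H * Q = 1\<^sub>m k"
  shows "rk Q = k"
proof -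
  interpret vec_space "TYPE(complex)" n .
  have inj: "v = w" if "v \<in> carrier_vec k" "w \<in> carrier_vec k" "Q *\<^sub>v v = Q *\<^sub>v w" for v w
  proof -
    have "Q\<^sup>H * Q *\<^sub>v v = Q\<^sup>H * Q *\<^sub>v w"
      using that Q(1) by (simp add: mult_vec_dim)
    then show ?thesis using that Q(2) by simp
  qed
  \<comment> \<open>Linear independence is stated for the set of columns, where repetitions would be
    lost, so distinctness is a separate obligation. Injectivity of \<open>Q\<close> yields
    both.\<close>
  have "distinct (cols Q)"
    unfolding distinct_conv_nth
  proof (intro allI impI)
    fix i j assume *: "i < length (cols Q)" "j < length (cols Q)" "i \<noteq> j"
    have "cols Q ! i = Q *\<^sub>v unit_vec k i" "cols Q ! j = Q *\<^sub>v unit_vec k j"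
      using * Q(1) by (auto simp: scalar_prod_right_unit intro!: eq_vecI)
    moreover have "unit_vec k i \<noteq> (unit_vec k j :: complex vec)"
      using * Q(1) by (simp add: unit_vec_eq)
    ultimately show "cols Q ! i \<noteq> cols Q ! j"
      using inj[of "unit_vec k i" "unit_vec k j"] by auto
  qed
  moreover have "\<not> lin_dep (set (cols Q))"
  proof
    assume "lin_dep (set (cols Q))"
    then obtain v where "v \<in> carrier_vec k" "v \<noteq> 0\<^sub>v k" "Q *\<^sub>v v = 0\<^sub>v n"
      using lin_depE[OF Q(1)] \<open>distinct (cols Q)\<close> by blast
    moreover have "Q *\<^sub>v 0\<^sub>v k = 0\<^sub>v n" using Q(1) by (auto intro!: eq_vecI)
    ultimately show False using inj[of v "0\<^sub>v k"] by simp
  qed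
  ultimately show ?thesis
    using lin_indpt_full_rank[OF Q(1)] Q(1) by simp
qed

lemma column_space_mono:
  assumes "M \<in> carrier_mat m n" "Z \<in> carrier_mat n k"
  shows "column_space (M * Z) \<subseteq> column_space M"
proof -
  have "\<exists>y. M * Z *\<^sub>v x = M *\<^sub>v y \<and> y \<in> carrier_vec n" if "x \<in> carrier_vec k" for x
    using assms that by (intro exI[of _ "Z *\<^sub>v x"]) (simp add: mult_vec_dim)
  then show ?thesis unfolding column_space_eq using assms by auto
qed

text \<open>The columns of the isometry are the eigenvectors of nonzero eigenvalue.\<close>

lemma hermitian_spectral_nonzero:
  fixes U :: "complex mat"
  assumes U: "U \<in> carrier_mat n n" "U\<^sup>H * U = 1\<^sub>m n"
  obtains Q f where "Q \<in> carrier_mat n (card {i. i < n \<and> d i \<noteq> 0})"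
    "Q\<^sup>H * Q = 1\<^sub>m (card {i. i < n \<and> d i \<noteq> 0})"
    "U * mat_diag n d * U\<^sup>H = Q * mat_diag (card {i. i < n \<and> d i \<noteq> 0}) f * Q\<^sup>H"
    "\<And>i. i < card {i. i < n \<and> d i \<noteq> 0} \<Longrightarrow> f i \<noteq> 0"
proof -
  define l where "l = filter (\<lambda>i. d i \<noteq> 0) [0..<n]"
  define k where "k = card {i. i < n \<and> d i \<noteq> 0}"
  have set: "set l = {i. i < n \<and> d i \<noteq> 0}" and dist: "distinct l"
    by (auto simp: l_def)
  then have len: "length l = k" using distinct_card[OF dist] by (simp add: k_def)
  have l: "l ! i < n" "d (l ! i) \<noteq> 0" if "i < k" for i
    using nth_mem[of i l] that len set by auto
  define Q where "Q = mat n k (\<lambda>(i, j). U $$ (i, l ! j))"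
  have Q: "Q \<in> carrier_mat n k" by (simp add: Q_def)
  have "Q\<^sup>H * Q = 1\<^sub>m k"
  proof (rule eq_matI)
    fix i j assume "i < dim_row (1\<^sub>m k :: complex mat)" "j < dim_col (1\<^sub>m k :: complex mat)"
    then have ij: "i < k" "j < k" by auto
    then have "(Q\<^sup>H * Q) $$ (i, j) = (U\<^sup>H * U) $$ (l ! i, l ! j)"
      using l[of i] l[of j] U(1) by (simp add: Q_def scalar_prod_def)
    also have "\<dots> = (if l ! i = l ! j then 1 else 0)"
      using ij l[of i] l[of j] U(2) by simp
    also have "l ! i = l ! j \<longleftrightarrow> i = j"
      using ij dist len by (simp add: nth_eq_iff_index_eq)
    finally show "(Q\<^sup>H * Q) $$ (i, j) = 1\<^sub>m k $$ (i, j)" using ij by simp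
  qed (simp_all add: Q_def)
  moreover have "U * mat_diag n d * U\<^sup>H = Q * mat_diag k (\<lambda>i. d (l ! i)) * Q\<^sup>H"
  proof (rule eq_matI)
    fix i j assume "i < dim_row (Q * mat_diag k (\<lambda>i. d (l ! i)) * Q\<^sup>H)"
      "j < dim_col (Q * mat_diag k (\<lambda>i. d (l ! i)) * Q\<^sup>H)"
    then have ij: "i < n" "j < n" by (auto simp: Q_def)
    have "(U * mat_diag n d * U\<^sup>H) $$ (i, j) = (\<Sum>a<n. U $$ (i, a) * d a * cnj (U $$ (j, a)))"
      using ij U(1) by (subst mat_diag_mult_right[of _ n]) (auto simp: scalar_prod_def atLeast0LessThan)
    also have "\<dots> = (\<Sum>a\<in>set l. U $$ (i, a) * d a * cnj (U $$ (j, a)))"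
      unfolding set by (rule sum.mono_neutral_right) auto
    also have "\<dots> = (\<Sum>b<k. U $$ (i, l ! b) * d (l ! b) * cnj (U $$ (j, l ! b)))"
      by (rule sum.reindex_bij_betw[symmetric, OF bij_betw_nth[OF dist]]) (auto simp: len)
    also have "\<dots> = (Q * mat_diag k (\<lambda>i. d (l ! i)) * Q\<^sup>H) $$ (i, j)"
      using ij by (subst mat_diag_mult_right[of _ n])
        (auto simp: Q_def scalar_prod_def atLeast0LessThan)
    finally show "(U * mat_diag n d * U\<^sup>H) $$ (i, j) =
        (Q * mat_diag k (\<lambda>i. d (l ! i)) * Q\<^sup>H) $$ (i, j)" .
  qed (use U in \<open>auto simp: Q_def\<close>)
  ultimately show ?thesis
    using that[of Q "\<lambda>i. d (l ! i)"] Q l unfolding k_def by auto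
qed

text \<open>After the zero eigenvalues are dropped the diagonal factor is invertible, so the product
  has the column space of the isometry \<open>Q\<close>.\<close>

lemma rk_spectral:
  assumes U: "U \<in> carrier_mat n n" "U\<^sup>H * U = 1\<^sub>m n"
  shows "rk (U * mat_diag n d * U\<^sup>H) = card {i. i < n \<and> d i \<noteq> 0}"
proof -
  define k where "k = card {i. i < n \<and> d i \<noteq> 0}"
  obtain Q f where Q: "Q \<in> carrier_mat n k" "Q\<^sup>H * Q = 1\<^sub>m k"
    and eq: "U * mat_diag n d * U\<^sup>H = Q * mat_diag k f * Q\<^sup>H"
    and f: "\<And>i. i < k \<Longrightarrow> f i \<noteq> 0"
    using hermitian_spectral_nonzero[OF U, of d, folded k_def] by blast
  define H where "H = Q * mat_diag k f * Q\<^sup>H"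
  have Qd: "dim_row Q = n" "dim_col Q = k" using Q by auto
  have "mat_diag k f * mat_diag k (\<lambda>i. inverse (f i)) = 1\<^sub>m k"
    unfolding mat_diag_diag using f by (intro eq_matI) (auto simp: mat_diag_def)
  then have "H * (Q * mat_diag k (\<lambda>i. inverse (f i))) = Q"
    using Qd mult_left_cong_dim[OF Q(2)] by (simp add: H_def mat_alg)
  moreover have "H = Q * (mat_diag k f * Q\<^sup>H)"
    using Qd by (simp add: H_def mat_alg)
  moreover have "H \<in> carrier_mat n n" using Q by (auto simp: H_def)
  ultimately have "column_space H = column_space Q"
    using column_space_mono[OF Q(1), of "mat_diag k f * Q\<^sup>H" n]
      column_space_mono[of H n n "Q * mat_diag k (\<lambda>i. inverse (f i))" k] Qd
    by (metis (no_types, lifting) Q(1) adjoint_carrier mat_diag_dim mult_carrier_mat subset_antisym)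
  then have "rk H = rk Q"
    using \<open>H \<in> carrier_mat n n\<close> Q(1) by (intro rk_cong_column_space) auto
  then show ?thesis
    using rk_isometry[OF Q] by (simp add: eq H_def k_def)
qed

definition is_proj :: "nat \<Rightarrow> complex mat \<Rightarrow> bool" where
  "is_proj m F \<longleftrightarrow> F \<in> carrier_mat m m \<and> F\<^sup>H = F \<and> F * F = F"

text \<open>Idempotence forces each eigenvalue to be 0 or 1, so rank and trace both count the
  ones.\<close>

lemma rk_proj:
  assumes "is_proj n F"
  shows "of_nat (rk F) = mat_trace F"
proof -
  have F: "F \<in> hermitian_mats n" "F * F = F"
    using assms by (auto simp: is_proj_def hermitian_mats_def)
  obtain U d where U: "U \<in> carrier_mat n n" "U\<^sup>H * U = 1\<^sub>m n"
    and Fd: "F = U * mat_diag n (\<lambda>i. complex_of_real (d i)) * U\<^sup>H"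
    using hermitian_spectral[OF F(1)] by metis
  define D where "D = mat_diag n (\<lambda>i. complex_of_real (d i))"
  have dims: "dim_row U = n" "dim_col U = n" "dim_row D = n" "dim_col D = n"
    using U by (auto simp: D_def)
  have D: "D = U\<^sup>H * F * U"
    using dims mult_left_cong_dim[OF U(2)] by (simp add: Fd D_def[symmetric] mat_alg U(2))
  have "D * D = D"
    unfolding D
    using dims hermitian_matsD(3,4)[OF F(1)] mult_left_cong_dim[OF F(2)]
      mult_left_cong_dim[OF unitary_commute[OF U]]
    by (simp add: mat_alg)
  have d: "d i * d i = d i" if "i < n" for i
  proof -
    have "(D * D) $$ (i, i) = D $$ (i, i)" by (simp add: \<open>D * D = D\<close>)
    then have "complex_of_real (d i) * complex_of_real (d i) = complex_of_real (d i)"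
      using that by (simp add: D_def mat_diag_diag) (simp add: mat_diag_def)
    then show ?thesis by (simp flip: of_real_mult)
  qed
  have "mat_trace F = mat_trace D"
    unfolding Fd D_def[symmetric]
    using dims mat_trace_mult_commute[of "U * D" "U\<^sup>H"] mult_left_cong_dim[OF U(2)]
    by (simp add: mat_alg)
  also have "\<dots> = (\<Sum>i<n. complex_of_real (d i))"
    by (simp add: mat_trace_def D_def) (simp add: mat_diag_def)
  also have "\<dots> = (\<Sum>i<n. if d i \<noteq> 0 then 1 else 0)"
    using d by (intro sum.cong) auto
  also have "\<dots> = of_nat (card {i. i < n \<and> d i \<noteq> 0})"
    by (simp add: sum.If_cases Int_def)
  finally show ?thesis
    using rk_spectral[OF U, of "\<lambda>i. complex_of_real (d i)"] by (simp add: Fd)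
qed

lemma is_projD:
  assumes "is_proj m F"
  shows "F \<in> carrier_mat m m" "dim_row F = m" "dim_col F = m" "F\<^sup>H = F" "F * F = F"
  using assms by (auto simp: is_proj_def)

text \<open>The equations \<open>F * M = M\<close> and \<open>F = M * Z\<close> together say that
  \<open>F\<close> and \<open>M\<close> have the same column space.\<close>

lemma rk_eq_trace:
  assumes "M \<in> carrier_mat m n" "is_proj m F" "F * M = M" "F = M * Z" "Z \<in> carrier_mat n m"
  shows "of_nat (rk M) = mat_trace F"
proof -
  note F = is_projD[OF assms(2)]
  have "column_space M = column_space F"
    using column_space_mono[OF assms(1,5)] column_space_mono[OF F(1) assms(1)]
    by (simp add: assms(3) flip: assms(4))
  then have "rk M = rk F"
    using F assms(1) by (intro rk_cong_column_space) auto
  then show ?thesis using rk_proj[OF assms(2)] by simp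
qed

lemma is_proj_mp:
  assumes "M \<in> carrier_mat m n"
  shows "is_proj m (M * mp_inverse M)" "is_proj n (mp_inverse M * M)"
  using mp_inverse_simps[OF assms] assms
  by (auto simp: is_proj_def mat_alg intro!: carrier_matI)

lemma rk_eq_trace_mp:
  assumes "M \<in> carrier_mat m n"
  shows "of_nat (rk M) = mat_trace (M * mp_inverse M)"
  by (rule rk_eq_trace[OF assms is_proj_mp(1)[OF assms] _ refl])
    (use mp_inverse_simps[OF assms] assms in \<open>auto simp: mat_alg\<close>)

text \<open>The ranges of \<open>M\<close> and \<open>M\<^sup>H\<close> have the projections
  \<open>M * mp_inverse M\<close> and \<open>mp_inverse M * M\<close>, whose traces agree by
  cyclicity.\<close>

lemma rk_adjoint:
  assumes M: "M \<in> carrier_mat m n"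
  shows "rk (M\<^sup>H) = rk M"
proof -
  note G = mp_inverse_simps[OF M]
  have dims: "dim_row M = m" "dim_col M = n" using M by auto
  have "of_nat (rk (M\<^sup>H)) = mat_trace (mp_inverse M * M)"
  proof (rule rk_eq_trace[OF adjoint_carrier[OF M] is_proj_mp(2)[OF M], where Z = "(mp_inverse M)\<^sup>H"])
    have "M\<^sup>H * (mp_inverse M)\<^sup>H * M\<^sup>H = (M * (mp_inverse M * M))\<^sup>H"
      using G(2,3) dims by (simp add: adjoint_mult)
    then show "mp_inverse M * M * M\<^sup>H = M\<^sup>H"
      unfolding G(4,7) .
  qed (use G in auto)
  also have "\<dots> = mat_trace (M * mp_inverse M)"
    using G dims by (intro mat_trace_mult_commute) auto
  also have "\<dots> = of_nat (rk M)" by (rule rk_eq_trace_mp[OF M, symmetric])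
  finally show ?thesis by (simp only: of_nat_eq_iff)
qed

text \<open>A projection is its own Gram matrix, so its trace is a squared Frobenius norm.\<close>

lemma mat_trace_proj_nonneg:
  assumes "is_proj m F"
  shows "0 \<le> mat_trace F" and "mat_trace F = 0 \<Longrightarrow> F = 0\<^sub>m m m"
proof -
  note F = is_projD[OF assms]
  have eq: "mat_trace F = mat_trace (F\<^sup>H * F)" using F by simp
  show "0 \<le> mat_trace F"
    unfolding eq mat_trace_gram by (simp add: sum_nonneg less_eq_complex_def)
  show "mat_trace F = 0 \<Longrightarrow> F = 0\<^sub>m m m"
    using mat_trace_gram_eq_0[of F] F unfolding eq by simp
qed

lemma is_proj_diff:
  assumes "is_proj m F" "is_proj m K" "K * F = F"
  shows "is_proj m (K - F)"
proof -
  note F = is_projD[OF assms(1)] and K = is_projD[OF assms(2)]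
  have "(K * F)\<^sup>H = F\<^sup>H" using assms(3) by simp
  then have "F * K = F" using F K by (simp add: adjoint_mult)
  then show ?thesis
    using F K assms(3) by (auto simp: is_proj_def mat_alg)
qed

lemma is_proj_one: "is_proj m (1\<^sub>m m)"
  by (auto simp: is_proj_def)

text \<open>The range of \<open>X * Y\<close> lies in that of \<open>X\<close>, so the difference of
  the two range projections is a projection and has nonnegative trace.\<close>

lemma rk_mult_le_left:
  assumes X: "X \<in> carrier_mat m n" and Y: "Y \<in> carrier_mat n k"
  shows "rk (X * Y) \<le> rk X"
proof -
  have XY: "X * Y \<in> carrier_mat m k" using X Y by simp
  note G = mp_inverse_simps[OF X] and K = mp_inverse_simps[OF XY]
  define F where "F = (X * Y) * mp_inverse (X * Y)"
  define P where "P = X * mp_inverse X"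
  have "P * F = F"
    using G K X Y mult_left_cong_dim[OF G(4), of "Y * mp_inverse (X * Y)"] by (simp add: P_def F_def mat_alg)
  then have "is_proj m (P - F)"
    using is_proj_diff is_proj_mp(1)[OF X] is_proj_mp(1)[OF XY] by (simp add: P_def F_def)
  then have "0 \<le> mat_trace (P - F)" by (rule mat_trace_proj_nonneg)
  also have "mat_trace (P - F) = of_nat (rk X) - of_nat (rk (X * Y))"
    unfolding rk_eq_trace_mp[OF X] rk_eq_trace_mp[OF XY] P_def F_def
    by (rule mat_trace_add) (use X Y G K in auto)
  finally show ?thesis by (simp add: less_eq_complex_def)
qed

lemma rk_mult_le_right:
  assumes X: "X \<in> carrier_mat m n" and Y: "Y \<in> carrier_mat n k"
  shows "rk (X * Y) \<le> rk Y"
proof -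
  have "rk (X * Y) = rk (Y\<^sup>H * X\<^sup>H)"
    using rk_adjoint[of "X * Y" m k] X Y by (simp add: adjoint_mult)
  also have "\<dots> \<le> rk (Y\<^sup>H)"
    by (rule rk_mult_le_left[OF adjoint_carrier[OF Y] adjoint_carrier[OF X]])
  finally show ?thesis using rk_adjoint[OF Y] by simp
qed

section \<open>Comparing ranks through kernels\<close>

text \<open>Each of \<open>M * mp_inverse M\<close> and \<open>M\<^sup>H\<close> is a left multiple
  of the other.\<close>

lemma proj_kernel:
  assumes M: "M \<in> carrier_mat m n" and x: "x \<in> carrier_vec m"
  shows "M * mp_inverse M *\<^sub>v x = 0\<^sub>v m \<longleftrightarrow> M\<^sup>H *\<^sub>v x = 0\<^sub>v n"
proof -
  note G = mp_inverse_simps[OF M]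
  have dims: "dim_row M = m" "dim_col M = n" using M by auto
  have "(M * mp_inverse M * M)\<^sup>H = M\<^sup>H * (M * mp_inverse M)"
    using G dims by (simp add: adjoint_mult)
  then have 1: "M\<^sup>H = M\<^sup>H * (M * mp_inverse M)"
    using G dims by (simp add: mat_alg)
  have 2: "M * mp_inverse M = (mp_inverse M)\<^sup>H * M\<^sup>H" using G by simp
  show ?thesis
  proof
    assume *: "M * mp_inverse M *\<^sub>v x = 0\<^sub>v m"
    have "M\<^sup>H *\<^sub>v x = M\<^sup>H * (M * mp_inverse M) *\<^sub>v x"
      by (rule arg_cong[OF 1, of "\<lambda>A. A *\<^sub>v x"])
    also have "\<dots> = M\<^sup>H *\<^sub>v (M * mp_inverse M *\<^sub>v x)"
      using x G(2,3) dims by (intro mult_vec_dim) auto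
    finally show "M\<^sup>H *\<^sub>v x = 0\<^sub>v n"
      using * dims by (auto intro!: eq_vecI)
  next
    assume *: "M\<^sup>H *\<^sub>v x = 0\<^sub>v n"
    have "M * mp_inverse M *\<^sub>v x = (mp_inverse M)\<^sup>H *\<^sub>v (M\<^sup>H *\<^sub>v x)"
      unfolding 2 using x G(2,3) dims by (intro mult_vec_dim) auto
    then show "M * mp_inverse M *\<^sub>v x = 0\<^sub>v m"
      using * G by (auto intro!: eq_vecI)
  qed
qed

lemma mult_zero_vec: "dim_col A = n \<Longrightarrow> dim_row A = m \<Longrightarrow> A *\<^sub>v 0\<^sub>v n = (0\<^sub>v m :: complex vec)"
  by (auto intro!: eq_vecI)

text \<open>\<open>1 - mp_inverse K * K\<close> maps into the kernel of \<open>K\<close>, so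
  \<open>T\<close> annihilates it. Inclusion of kernels thereby becomes a factorisation, which gives
  the rank comparison.\<close>

lemma kernel_factor:
  assumes K: "K \<in> carrier_mat m n" and T: "T \<in> carrier_mat k n"
    and ker: "\<And>x. x \<in> carrier_vec n \<Longrightarrow> K *\<^sub>v x = 0\<^sub>v m \<Longrightarrow> T *\<^sub>v x = 0\<^sub>v k"
  shows "T = T * (mp_inverse K * K)"
proof -
  note G = mp_inverse_simps[OF K]
  have dims: "dim_row K = m" "dim_col K = n" "dim_row T = k" "dim_col T = n" using K T by auto
  have "T * (1\<^sub>m n - mp_inverse K * K) = 0\<^sub>m k n"
  proof (rule mat_eq_zeroI)
    fix x :: "complex vec" assume x: "x \<in> carrier_vec n"
    define y where "y = (1\<^sub>m n - mp_inverse K * K) *\<^sub>v x"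
    have "K *\<^sub>v y = K * (1\<^sub>m n - mp_inverse K * K) *\<^sub>v x"
      unfolding y_def using x G dims by (simp add: mult_vec_dim)
    also have "K * (1\<^sub>m n - mp_inverse K * K) = 0\<^sub>m m n"
      using G dims by (simp add: mat_alg)
    finally have "K *\<^sub>v y = 0\<^sub>v m" using x by (simp add: zero_mat_mult_vec)
    moreover have "y \<in> carrier_vec n" unfolding y_def using G dims x by (intro mult_mat_vec_carrier[of _ n n] carrier_matI) auto
    ultimately have "T *\<^sub>v y = 0\<^sub>v k" by (rule ker[rotated])
    then show "T * (1\<^sub>m n - mp_inverse K * K) *\<^sub>v x = 0\<^sub>v k"
      using x G dims by (simp add: y_def mult_vec_dim)
  qed (use G dims in \<open>auto intro!: carrier_matI\<close>)
  then have "T - T * (mp_inverse K * K) = 0\<^sub>m k n"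
    using G dims by (simp add: mat_alg)
  then show ?thesis
    by (rule minus_zero_eq[rotated 2]) (use G dims in \<open>auto intro!: carrier_matI\<close>)
qed

lemma rk_le_kernel:
  assumes "K \<in> carrier_mat m n" "T \<in> carrier_mat k n"
    and "\<And>x. x \<in> carrier_vec n \<Longrightarrow> K *\<^sub>v x = 0\<^sub>v m \<Longrightarrow> T *\<^sub>v x = 0\<^sub>v k"
  shows "rk T \<le> rk K"
proof -
  note G = mp_inverse_simps[OF assms(1)]
  have "T = T * mp_inverse K * K"
    using kernel_factor[OF assms] assms(1,2) G by (simp add: mat_alg)
  then show ?thesis
    using rk_mult_le_right[of "T * mp_inverse K" k m K n] assms(1,2) G by simp
qed

lemma rk_eq_kernel:
  assumes "K \<in> carrier_mat m n" "T \<in> carrier_mat k n"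
    and "\<And>x. x \<in> carrier_vec n \<Longrightarrow> K *\<^sub>v x = 0\<^sub>v m \<longleftrightarrow> T *\<^sub>v x = 0\<^sub>v k"
  shows "rk T = rk K"
  using rk_le_kernel[OF assms(1,2)] rk_le_kernel[OF assms(2,1)] assms(3) by (simp add: order_antisym)

lemma rk_eq_trace_kernel:
  assumes M: "M \<in> carrier_mat m n" and F: "is_proj m F"
    and ker: "\<And>x. x \<in> carrier_vec m \<Longrightarrow> F *\<^sub>v x = 0\<^sub>v m \<longleftrightarrow> M\<^sup>H *\<^sub>v x = 0\<^sub>v n"
  shows "of_nat (rk M) = mat_trace F"
  using rk_eq_kernel[OF is_projD(1)[OF F] adjoint_carrier[OF M] ker] rk_adjoint[OF M] rk_proj[OF F]
  by simp

lemma gram_kernel: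
  fixes M :: "complex mat"
  assumes M: "M \<in> carrier_mat m n" and x: "x \<in> carrier_vec m"
  shows "M * M\<^sup>H *\<^sub>v x = 0\<^sub>v m \<longleftrightarrow> M\<^sup>H *\<^sub>v x = 0\<^sub>v n"
proof
  assume "M * M\<^sup>H *\<^sub>v x = 0\<^sub>v m"
  then show "M\<^sup>H *\<^sub>v x = 0\<^sub>v n"
    using x by (intro gram_vec_eq_zero[OF M x]) simp
next
  assume "M\<^sup>H *\<^sub>v x = 0\<^sub>v n"
  then show "M * M\<^sup>H *\<^sub>v x = 0\<^sub>v m"
    using M x by (simp add: mult_vec_dim mult_zero_vec)
qed

lemma rk_gram:
  assumes M: "M \<in> carrier_mat m n"
  shows "rk (M * M\<^sup>H) = rk M"
  using rk_eq_kernel[OF adjoint_carrier[OF M], of "M * M\<^sup>H" m] gram_kernel[OF M] M rk_adjoint[OF M]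
  by (auto simp: mult_carrier_mat[OF M adjoint_carrier[OF M]])

lemma rk_le_dim:
  assumes "M \<in> carrier_mat m n"
  shows "rk M \<le> m"
  using rk_mult_le_left[OF one_carrier_mat assms] assms rk_isometry[of "1\<^sub>m m" m m] by simp

text \<open>If the rank is \<open>m\<close>, the complement of the range projection is a projection
  of trace 0, so the range projection is the identity. The converse compares
  \<open>M\<^sup>H\<close> with the identity by kernels.\<close>

lemma rk_full_iff:
  assumes M: "M \<in> carrier_mat m n"
  shows "rk M = m \<longleftrightarrow> (\<forall>x \<in> carrier_vec m. M\<^sup>H *\<^sub>v x = 0\<^sub>v n \<longrightarrow> x = 0\<^sub>v m)"
proof
  define F where "F = M * mp_inverse M"
  note F = is_proj_mp(1)[OF M, folded F_def]
  assume "rk M = m"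
  then have "mat_trace F = of_nat m" using rk_eq_trace_mp[OF M] by (simp add: F_def)
  then have "mat_trace (1\<^sub>m m - F) = 0"
    using mat_trace_add(2)[of "1\<^sub>m m" m F] is_projD[OF F] by (simp add: mat_trace_one)
  moreover have "is_proj m (1\<^sub>m m - F)"
    using is_proj_diff[OF F is_proj_one] is_projD[OF F] by simp
  ultimately have "1\<^sub>m m - F = 0\<^sub>m m m" using mat_trace_proj_nonneg(2) by blast
  then have "F = 1\<^sub>m m"
    using minus_zero_eq[of "1\<^sub>m m" m m F] is_projD[OF F] by simp
  then show "\<forall>x \<in> carrier_vec m. M\<^sup>H *\<^sub>v x = 0\<^sub>v n \<longrightarrow> x = 0\<^sub>v m"
    using proj_kernel[OF M] by (auto simp: F_def)
next
  assume "\<forall>x \<in> carrier_vec m. M\<^sup>H *\<^sub>v x = 0\<^sub>v n \<longrightarrow> x = 0\<^sub>v m"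
  then have "rk (1\<^sub>m m :: complex mat) \<le> rk (M\<^sup>H)"
    by (intro rk_le_kernel[OF adjoint_carrier[OF M]]) auto
  moreover have "rk (1\<^sub>m m :: complex mat) = m" using rk_isometry[of "1\<^sub>m m" m m] by simp
  ultimately show "rk M = m" using rk_adjoint[OF M] rk_le_dim[OF M] by simp
qed

text \<open>One inclusion always holds; the other says that the projection onto the range of
  \<open>X * Y\<close> fixes \<open>X\<close>. Equality of ranks has the same reformulation, which
  lets both kinds of condition be treated alike.\<close>

lemma column_space_mult_eq_iff:
  assumes X: "X \<in> carrier_mat m n" and Y: "Y \<in> carrier_mat n k"
  shows "column_space (X * Y) = column_space X \<longleftrightarrow> X * Y * mp_inverse (X * Y) * X = X"
proof
  have XY: "X * Y \<in> carrier_mat m k" using X Y by simp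
  note G = mp_inverse_simps[OF XY]
  {
    assume eq: "X * Y * mp_inverse (X * Y) * X = X"
    have "column_space (X * Y * (mp_inverse (X * Y) * X)) \<subseteq> column_space (X * Y)"
      by (rule column_space_mono[OF XY mult_carrier_mat[OF G(1) X]])
    moreover have "X * Y * (mp_inverse (X * Y) * X) = X"
      using eq G X Y by (simp add: mat_alg)
    ultimately have "column_space X \<subseteq> column_space (X * Y)" by simp
    then show "column_space (X * Y) = column_space X"
      using column_space_mono[OF X Y] by simp
  }
  assume eq: "column_space (X * Y) = column_space X"
  define F where "F = X * Y * mp_inverse (X * Y)"
  have F: "is_proj m F" unfolding F_def by (rule is_proj_mp(1)[OF XY])
  have "(1\<^sub>m m - F) * X = 0\<^sub>m m n"
  proof (rule mat_eq_zeroI)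
    fix v :: "complex vec" assume v: "v \<in> carrier_vec n"
    have "X *\<^sub>v v \<in> column_space X" unfolding column_space_eq using v X by auto
    then have "X *\<^sub>v v \<in> column_space (X * Y)" unfolding eq .
    then obtain w where w: "w \<in> carrier_vec k" "X *\<^sub>v v = X * Y *\<^sub>v w"
      unfolding column_space_eq using Y by auto
    have "(1\<^sub>m m - F) * X *\<^sub>v v = (1\<^sub>m m - F) *\<^sub>v (X *\<^sub>v v)"
      using v X is_projD[OF F] by (simp add: mult_vec_dim)
    also have "\<dots> = (1\<^sub>m m - F) * (X * Y) *\<^sub>v w"
      unfolding w(2) using w(1) X Y is_projD[OF F] by (simp add: mult_vec_dim)
    also have "(1\<^sub>m m - F) * (X * Y) = 0\<^sub>m m k"
      using G X Y unfolding F_def by (simp add: mat_alg)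
    finally show "(1\<^sub>m m - F) * X *\<^sub>v v = 0\<^sub>v m" using w(1) by (simp add: zero_mat_mult_vec)
  qed (use X is_projD[OF F] in auto)
  then have "X - F * X = 0\<^sub>m m n" using X is_projD[OF F] by (simp add: mat_alg)
  then show "X * Y * mp_inverse (X * Y) * X = X"
    using minus_zero_eq[of X m n "F * X"] X is_projD[OF F] unfolding F_def by simp
qed

subsection \<open>Positive semidefinite matrices\<close>

lemma pos_semidefD:
  assumes "pos_semidef P" "P \<in> carrier_mat m m"
  shows "P \<in> hermitian_mats m" "\<And>x. x \<in> carrier_vec m \<Longrightarrow> 0 \<le> (P *\<^sub>v x) \<bullet>c x"
  using assms by (auto simp: pos_semidef_def)

lemma gram_scalar_prod:
  fixes K :: "complex mat"
  assumes "K \<in> carrier_mat m k" "x \<in> carrier_vec m"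
  shows "(K * K\<^sup>H *\<^sub>v x) \<bullet>c x = (K\<^sup>H *\<^sub>v x) \<bullet>c (K\<^sup>H *\<^sub>v x)"
proof -
  have "K\<^sup>H *\<^sub>v x \<in> carrier_vec k"
    using assms by (intro mult_mat_vec_carrier[OF adjoint_carrier])
  then show ?thesis
    using adjoint_scalar_prod[of "K\<^sup>H *\<^sub>v x" K x] assms by (simp add: mult_vec_dim)
qed

lemma pos_semidef_gram:
  assumes K: "K \<in> carrier_mat m k"
  shows "pos_semidef (K * K\<^sup>H)"
proof -
  have "K * K\<^sup>H \<in> hermitian_mats m"
    using K by (auto simp: hermitian_mats_def adjoint_mult)
  then show ?thesis
    using gram_scalar_prod[OF K] conjugate_square_ge_0_vec K
    by (auto simp: pos_semidef_def simp del: assoc_mult_mat_vec)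
qed

lemma mat_diag_unit_vec:
  "i < n \<Longrightarrow> mat_diag n f *\<^sub>v unit_vec n i = (f i :: complex) \<cdot>\<^sub>v unit_vec n i"
  by (rule eq_vecI) (auto simp: mat_diag_def scalar_prod_right_unit)

lemma spectral_gram:
  assumes U: "U \<in> carrier_mat n n" and f: "\<And>i. i < n \<Longrightarrow> 0 \<le> f i"
  shows "U * mat_diag n (\<lambda>i. complex_of_real (f i)) * U\<^sup>H =
    (U * mat_diag n (\<lambda>i. complex_of_real (sqrt (f i)))) *
      (U * mat_diag n (\<lambda>i. complex_of_real (sqrt (f i))))\<^sup>H"
proof -
  have "mat_diag n (\<lambda>i. complex_of_real (f i)) =
      mat_diag n (\<lambda>i. complex_of_real (sqrt (f i))) * (mat_diag n (\<lambda>i. complex_of_real (sqrt (f i))))\<^sup>H"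
    unfolding adjoint_diag mat_diag_diag
    using f by (intro eq_matI) (auto simp: mat_diag_def simp flip: of_real_mult)
  then show ?thesis using U by (simp add: adjoint_mult mult_assoc_dim)
qed

text \<open>The quadratic form at column \<open>i\<close> of \<open>U\<close> has the value
  \<open>d i\<close>, so the eigenvalues are nonnegative and their square roots are real. The factor
  \<open>R\<close> is \<open>U\<close> times a diagonal matrix and need not be Hermitian.\<close>

lemma pos_semidef_ex_sqrt:
  assumes P: "pos_semidef P" "P \<in> carrier_mat m m"
  obtains R where "R \<in> carrier_mat m m" "P = R * R\<^sup>H"
proof -
  note H = pos_semidefD[OF P]
  obtain U d where U: "U \<in> carrier_mat m m" "U\<^sup>H * U = 1\<^sub>m m"
    and Pd: "P = U * mat_diag m (\<lambda>i. complex_of_real (d i)) * U\<^sup>H"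
    using hermitian_spectral[OF H(1)] by metis
  define D where "D = mat_diag m (\<lambda>i. complex_of_real (d i))"
  have dims: "dim_row U = m" "dim_col U = m" "dim_row D = m" "dim_col D = m"
    using U by (auto simp: D_def)
  have "0 \<le> d i" if i: "i < m" for i
  proof -
    define e where "e = (unit_vec m i :: complex vec)"
    have e: "e \<in> carrier_vec m" by (simp add: e_def)
    have Ue: "U *\<^sub>v e \<in> carrier_vec m" using mult_mat_vec_carrier[OF U(1) e] .
    have "U\<^sup>H *\<^sub>v (U *\<^sub>v e) = e"
      using e dims U(2) by (simp flip: mult_vec_dim)
    have "P *\<^sub>v (U *\<^sub>v e) = U *\<^sub>v (D *\<^sub>v (U\<^sup>H *\<^sub>v (U *\<^sub>v e)))"
      using e dims by (simp add: Pd D_def[symmetric] mult_vec_dim)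
    also have "\<dots> = U *\<^sub>v (D *\<^sub>v e)" by (simp add: \<open>U\<^sup>H *\<^sub>v (U *\<^sub>v e) = e\<close>)
    finally have "(P *\<^sub>v (U *\<^sub>v e)) \<bullet>c (U *\<^sub>v e) = (D *\<^sub>v e) \<bullet>c (U\<^sup>H *\<^sub>v (U *\<^sub>v e))"
      using adjoint_scalar_prod[of "D *\<^sub>v e" U "U *\<^sub>v e"] dims Ue
        mult_mat_vec_carrier[OF mat_diag_dim e] by (simp add: D_def)
    also have "\<dots> = (D *\<^sub>v e) \<bullet>c e" by (simp add: \<open>U\<^sup>H *\<^sub>v (U *\<^sub>v e) = e\<close>)
    also have "\<dots> = complex_of_real (d i)"
      using i by (simp add: D_def e_def mat_diag_unit_vec)
    finally show ?thesis using H(2)[OF Ue] by (simp add: less_eq_complex_def)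
  qed
  from spectral_gram[OF U(1) this] show ?thesis
    using that[of "U * mat_diag m (\<lambda>i. complex_of_real (sqrt (d i)))"] U Pd by simp
qed

lemma pos_semidef_sandwich:
  assumes P: "pos_semidef P" "P \<in> carrier_mat m m" and S: "S \<in> carrier_mat k m"
  shows "pos_semidef (S * P * S\<^sup>H)"
proof -
  obtain R where R: "R \<in> carrier_mat m m" "P = R * R\<^sup>H"
    using pos_semidef_ex_sqrt[OF P] .
  have "S * P * S\<^sup>H = (S * R) * (S * R)\<^sup>H"
    using R S by (simp add: mat_alg)
  then show ?thesis using pos_semidef_gram[of "S * R" k m] R S by simp
qed

lemma pos_semidef_add:
  assumes P: "pos_semidef P" "P \<in> carrier_mat m m" and Q: "pos_semidef Q" "Q \<in> carrier_mat m m"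
  shows "pos_semidef (P + Q)"
proof -
  have "P + Q \<in> hermitian_mats m"
    using hermitian_matsD[OF pos_semidefD(1)[OF P]] hermitian_matsD[OF pos_semidefD(1)[OF Q]]
    by (auto simp: hermitian_mats_def adjoint_add)
  moreover have "0 \<le> ((P + Q) *\<^sub>v x) \<bullet>c x" if x: "x \<in> carrier_vec m" for x
  proof -
    have "((P + Q) *\<^sub>v x) \<bullet>c x = (P *\<^sub>v x) \<bullet>c x + (Q *\<^sub>v x) \<bullet>c x"
      using P(2) Q(2) x mult_mat_vec_carrier[OF P(2) x] mult_mat_vec_carrier[OF Q(2) x]
      by (simp add: add_mult_distrib_mat_vec[of _ m m] add_scalar_prod_distrib[of _ m])
    then show ?thesis
      using pos_semidefD(2)[OF P x] pos_semidefD(2)[OF Q x] by (simp add: add_nonneg_nonneg)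
  qed
  ultimately show ?thesis using P(2) Q(2) by (simp add: pos_semidef_def)
qed

text \<open>With \<open>P = R * R\<^sup>H\<close> the form at \<open>x\<close> is the squared norm
  of \<open>R\<^sup>H x\<close>.\<close>

lemma pos_semidef_kernel_vec:
  assumes P: "pos_semidef P" "P \<in> carrier_mat m m" and x: "x \<in> carrier_vec m" "(P *\<^sub>v x) \<bullet>c x = 0"
  shows "P *\<^sub>v x = 0\<^sub>v m"
proof -
  obtain R where R: "R \<in> carrier_mat m m" "P = R * R\<^sup>H"
    using pos_semidef_ex_sqrt[OF P] .
  have "R\<^sup>H *\<^sub>v x = 0\<^sub>v m" using gram_vec_eq_zero[OF R(1) x(1)] x(2) R(2) by simp
  then show ?thesis using gram_kernel[OF R(1) x(1)] R(2) by simp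
qed

text \<open>The matrix \<open>Y\<^sup>H * P * Y\<close> is the Gram matrix of
  \<open>R\<^sup>H * Y\<close>.\<close>

lemma pos_semidef_kernel_mat:
  assumes P: "pos_semidef P" "P \<in> carrier_mat m m" and Y: "Y \<in> carrier_mat m k"
    and eq: "Y\<^sup>H * P * Y = 0\<^sub>m k k"
  shows "P * Y = 0\<^sub>m m k"
proof -
  obtain R where R: "R \<in> carrier_mat m m" "P = R * R\<^sup>H"
    using pos_semidef_ex_sqrt[OF P] .
  have "(R\<^sup>H * Y)\<^sup>H * (R\<^sup>H * Y) = 0\<^sub>m k k"
    using eq R Y by (simp add: mat_alg)
  then have "R\<^sup>H * Y = 0\<^sub>m m k"
    by (rule gram_eq_zero[rotated]) (use R Y in auto)
  then show ?thesis using R Y by (simp add: mat_alg)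
qed

text \<open>A positive semidefinite form vanishes only on the kernel of its matrix, so strictness is
  purely a question about kernels.\<close>

lemma pos_def_iff:
  assumes "P \<in> carrier_mat m m"
  shows "pos_def P \<longleftrightarrow> pos_semidef P \<and> (\<forall>x \<in> carrier_vec m. P *\<^sub>v x = 0\<^sub>v m \<longrightarrow> x = 0\<^sub>v m)"
proof
  assume P: "pos_def P"
  have "0 \<le> (P *\<^sub>v x) \<bullet>c x" if "x \<in> carrier_vec m" for x
    using P assms that by (cases "x = 0\<^sub>v m") (auto simp: pos_def_def mult_zero_vec)
  moreover have "x = 0\<^sub>v m" if "x \<in> carrier_vec m" "P *\<^sub>v x = 0\<^sub>v m" for x
    using P assms that by (auto simp: pos_def_def)
  ultimately show "pos_semidef P \<and> (\<forall>x \<in> carrier_vec m. P *\<^sub>v x = 0\<^sub>v m \<longrightarrow> x = 0\<^sub>v m)"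
    using P assms by (auto simp: pos_def_def pos_semidef_def)
next
  assume P: "pos_semidef P \<and> (\<forall>x \<in> carrier_vec m. P *\<^sub>v x = 0\<^sub>v m \<longrightarrow> x = 0\<^sub>v m)"
  have "0 < (P *\<^sub>v x) \<bullet>c x" if "x \<in> carrier_vec m" "x \<noteq> 0\<^sub>v m" for x
  proof -
    have "(P *\<^sub>v x) \<bullet>c x \<noteq> 0"
      using pos_semidef_kernel_vec[of P m x] P assms that by blast
    moreover have "0 \<le> (P *\<^sub>v x) \<bullet>c x"
      using pos_semidefD(2)[of P m x] P assms that by blast
    ultimately show ?thesis by (simp only: order_less_le) simp
  qed
  then show "pos_def P"
    using P assms unfolding pos_def_def pos_semidef_def by auto
qed

subsection \<open>Inertia\<close>

lemma order_linear_factor: "order x [:- a, 1:] = (if a = (x :: complex) then 1 else 0)"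
  using order_power_n_n[of a 1] by (auto intro: order_0I)

lemma order_prod_linear:
  assumes "finite I"
  shows "order x (\<Prod>i\<in>I. [:- f i, 1:]) = card {i \<in> I. f i = (x :: complex)}"
  using assms
proof induction
  case (insert i I)
  have "[:- f i, 1:] * (\<Prod>i\<in>I. [:- f i, 1:]) \<noteq> 0"
    using insert.hyps(1) by (simp only: mult_eq_0_iff prod_zero_iff) simp
  from order_mult[OF this] have "order x (\<Prod>i\<in>insert i I. [:- f i, 1:]) =
      (if f i = x then 1 else 0) + card {i \<in> I. f i = x}"
    by (simp only: prod.insert[OF insert.hyps] order_linear_factor insert.IH)
  moreover have "{j \<in> insert i I. f j = x} =
      (if f i = x then insert i {j \<in> I. f j = x} else {j \<in> I. f j = x})" by auto
  ultimately show ?case using insert.hyps by simp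
qed simp

lemma char_poly_spectral:
  assumes U: "U \<in> carrier_mat n n" "U\<^sup>H * U = 1\<^sub>m n"
  shows "char_poly (U * mat_diag n f * U\<^sup>H) = (\<Prod>i<n. [:- f i, 1 :: complex:])"
proof -
  have "similar_mat_wit (U * mat_diag n f * U\<^sup>H) (mat_diag n f) U (U\<^sup>H)"
    by (rule similar_mat_witI[OF unitary_commute[OF U] U(2) refl]) (use U in auto)
  then have "char_poly (U * mat_diag n f * U\<^sup>H) = char_poly (mat_diag n f)"
    by (intro char_poly_similar) (auto simp: similar_mat_def)
  also have "\<dots> = (\<Prod>a\<leftarrow>diag_mat (mat_diag n f). [:- a, 1:])"
    by (rule char_poly_upper_triangular[of _ n]) (auto simp: mat_diag_def)
  also have "diag_mat (mat_diag n f) = map f [0..<n]"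
    by (auto simp: diag_mat_def mat_diag_def)
  also have "(\<Prod>a\<leftarrow>map f [0..<n]. [:- a, 1:]) = (\<Prod>i<n. [:- f i, 1:])"
    by (simp add: prod.list_conv_set_nth comp_def atLeast0LessThan)
  finally show ?thesis .
qed

text \<open>By unitary similarity the characteristic polynomial splits with roots
  \<open>d i\<close>, so its order at \<open>x\<close> counts the indices with
  \<open>d i = x\<close>. These index sets are disjoint for distinct \<open>x\<close>, and summing
  over the values of one sign counts the indices of that sign.\<close>

lemma inertia_spectral:
  assumes U: "U \<in> carrier_mat n n" "U\<^sup>H * U = 1\<^sub>m n"
  defines "H \<equiv> \<lambda>d. U * mat_diag n (\<lambda>i. complex_of_real (d i)) * U\<^sup>H"
  shows "pos_inertia (H d) = card {i. i < n \<and> 0 < d i}"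
    and "neg_inertia (H d) = card {i. i < n \<and> d i < 0}"
proof -
  have cp: "char_poly (H d) = (\<Prod>i<n. [:- complex_of_real (d i), 1:])"
    unfolding H_def by (rule char_poly_spectral[OF U])
  have ev: "eigenvalue (H d) (complex_of_real x) \<longleftrightarrow> x \<in> d ` {..<n}" for x
  proof -
    have "H d \<in> carrier_mat n n"
      unfolding H_def using U(1) by (intro mult_carrier_mat[of _ n n] mat_diag_dim adjoint_carrier)
    from eigenvalue_root_char_poly[OF this] show ?thesis
      by (auto simp: cp poly_prod prod_zero_iff)
  qed
  have ord: "order (complex_of_real x) (char_poly (H d)) = card {i \<in> {..<n}. d i = x}" for x
    unfolding cp by (simp add: order_prod_linear)
  have sum: "(\<Sum>x\<in>{x. P x \<and> x \<in> d ` {..<n}}. card {i \<in> {..<n}. d i = x}) = card {i. i < n \<and> P (d i)}" for P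
  proof -
    have "(\<Sum>x\<in>{x. P x \<and> x \<in> d ` {..<n}}. card {i \<in> {..<n}. d i = x}) =
        card (\<Union>x\<in>{x. P x \<and> x \<in> d ` {..<n}}. {i \<in> {..<n}. d i = x})"
      by (rule card_UN_disjoint[symmetric]) auto
    also have "(\<Union>x\<in>{x. P x \<and> x \<in> d ` {..<n}}. {i \<in> {..<n}. d i = x}) = {i. i < n \<and> P (d i)}"
      by auto
    finally show ?thesis .
  qed
  show "pos_inertia (H d) = card {i. i < n \<and> 0 < d i}"
    unfolding pos_inertia_def ev ord by (rule sum)
  show "neg_inertia (H d) = card {i. i < n \<and> d i < 0}"
    unfolding neg_inertia_def ev ord by (rule sum)
qed

lemma spectral_uminus:
  assumes "U \<in> carrier_mat n n"
  shows "- (U * mat_diag n (\<lambda>i. complex_of_real (d i)) * U\<^sup>H) =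
    U * mat_diag n (\<lambda>i. complex_of_real (- d i)) * U\<^sup>H"
proof -
  have "mat_diag n (\<lambda>i. complex_of_real (- d i)) = - mat_diag n (\<lambda>i. complex_of_real (d i))"
    by (auto simp: mat_diag_def intro!: eq_matI)
  then show ?thesis using assms by (simp add: mat_alg)
qed

lemma hermitian_uminus: "H \<in> hermitian_mats n \<Longrightarrow> - H \<in> hermitian_mats n"
  by (auto simp: hermitian_mats_def adjoint_add)

lemma inertia_uminus:
  assumes "H \<in> hermitian_mats n"
  shows "pos_inertia (- H) = neg_inertia H" "neg_inertia (- H) = pos_inertia H"
proof -
  obtain U d where U: "U \<in> carrier_mat n n" "U\<^sup>H * U = 1\<^sub>m n"
    and H: "H = U * mat_diag n (\<lambda>i. complex_of_real (d i)) * U\<^sup>H"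
    using hermitian_spectral[OF assms] by metis
  show "pos_inertia (- H) = neg_inertia H" "neg_inertia (- H) = pos_inertia H"
    unfolding H spectral_uminus[OF U(1)] inertia_spectral[OF U] by simp_all
qed

lemma pos_plus_neg_inertia:
  assumes "H \<in> hermitian_mats n"
  shows "pos_inertia H + neg_inertia H = rk H"
proof -
  obtain U d where U: "U \<in> carrier_mat n n" "U\<^sup>H * U = 1\<^sub>m n"
    and H: "H = U * mat_diag n (\<lambda>i. complex_of_real (d i)) * U\<^sup>H"
    using hermitian_spectral[OF assms] by metis
  have "card {i. i < n \<and> 0 < d i} + card {i. i < n \<and> d i < 0} =
      card ({i. i < n \<and> 0 < d i} \<union> {i. i < n \<and> d i < 0})"
    by (rule card_Un_disjoint[symmetric]) auto
  also have "{i. i < n \<and> 0 < d i} \<union> {i. i < n \<and> d i < 0} = {i. i < n \<and> complex_of_real (d i) \<noteq> 0}"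
    by auto
  finally show ?thesis
    unfolding H inertia_spectral[OF U] rk_spectral[OF U] .
qed

text \<open>The positive and negative parts of the spectrum, \<open>max (d i) 0\<close> and
  \<open>max (- d i) 0\<close>, on the same eigenbasis.\<close>

lemma hermitian_jordan_decomposition:
  assumes "H \<in> hermitian_mats n"
  obtains P N where "P \<in> carrier_mat n n" "N \<in> carrier_mat n n" "pos_semidef P" "pos_semidef N"
    "H = P - N" "rk P = pos_inertia H" "rk N = neg_inertia H"
proof -
  obtain U d where U: "U \<in> carrier_mat n n" "U\<^sup>H * U = 1\<^sub>m n"
    and H: "H = U * mat_diag n (\<lambda>i. complex_of_real (d i)) * U\<^sup>H"
    using hermitian_spectral[OF assms] by metis
  define S where "S f = U * mat_diag n (\<lambda>i. complex_of_real (f i)) * U\<^sup>H" for f :: "nat \<Rightarrow> real"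
  have S: "S f \<in> carrier_mat n n" for f
    using U by (auto simp: S_def)
  have psd: "pos_semidef (S f)" if "\<And>i. 0 \<le> f i" for f
    using spectral_gram[OF U(1) that] U(1)
      pos_semidef_gram[of "U * mat_diag n (\<lambda>i. complex_of_real (sqrt (f i)))" n n]
    by (simp add: S_def)
  have "mat_diag n (\<lambda>i. complex_of_real (d i)) =
      mat_diag n (\<lambda>i. complex_of_real (max (d i) 0)) - mat_diag n (\<lambda>i. complex_of_real (max (- d i) 0))"
    by (rule eq_matI) (auto simp: mat_diag_def max_def)
  then have "H = S (\<lambda>i. max (d i) 0) - S (\<lambda>i. max (- d i) 0)"
    using U by (simp add: H S_def mat_alg)
  moreover have "rk (S (\<lambda>i. max (d i) 0)) = pos_inertia H" "rk (S (\<lambda>i. max (- d i) 0)) = neg_inertia H"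
    unfolding S_def H rk_spectral[OF U] inertia_spectral[OF U]
    by (auto intro!: arg_cong[of _ _ card])
  ultimately show ?thesis
    using that[of "S (\<lambda>i. max (d i) 0)" "S (\<lambda>i. max (- d i) 0)"] S psd by simp
qed

text \<open>On the range of the spectral projection \<open>T\<close> to the positive eigenvalues \<open>H\<close> is positive definite,
  so \<open>M\<^sub>1\<close> must be injective there.\<close>

lemma pos_inertia_le:
  assumes H: "H \<in> hermitian_mats n" "H = M\<^sub>1 - M\<^sub>2"
    and M: "M\<^sub>1 \<in> carrier_mat n n" "pos_semidef M\<^sub>2" "M\<^sub>2 \<in> carrier_mat n n"
  shows "pos_inertia H \<le> rk M\<^sub>1"
proof -
  obtain U d where U: "U \<in> carrier_mat n n" "U\<^sup>H * U = 1\<^sub>m n"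
    and Hd: "H = U * mat_diag n (\<lambda>i. complex_of_real (d i)) * U\<^sup>H"
    using hermitian_spectral[OF H(1)] by metis
  define chi where "chi i = (if 0 < d i then 1 else 0 :: complex)" for i
  have chi0: "chi i \<noteq> 0 \<longleftrightarrow> 0 < d i" for i by (simp add: chi_def)
  \<comment> \<open>\<open>s\<close> takes square roots of the positive eigenvalues and is 0
    elsewhere, so that \<open>T * H * T = L * L\<^sup>H\<close>. Since \<open>inverse 0 = 0\<close>,
    the product of \<open>Ri\<close> and \<open>R\<^sup>H\<close> is the cut-off \<open>C\<close>,
    which recovers \<open>T\<close> from \<open>L\<^sup>H\<close>.\<close>
  define s where "s i = complex_of_real (sqrt (max (d i) 0))" for i
  define C where "C = mat_diag n chi"
  define D where "D = mat_diag n (\<lambda>i. complex_of_real (d i))"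
  define R where "R = mat_diag n s"
  define Ri where "Ri = mat_diag n (\<lambda>i. inverse (s i))"
  define T where "T = U * C * U\<^sup>H"
  define L where "L = U * R"
  have dims: "dim_row U = n" "dim_col U = n" "dim_row C = n" "dim_col C = n" "dim_row D = n"
    "dim_col D = n" "dim_row R = n" "dim_col R = n" "dim_row Ri = n" "dim_col Ri = n"
    using U by (auto simp: C_def D_def R_def Ri_def)
  have T: "T \<in> carrier_mat n n" and L: "L \<in> carrier_mat n n" using dims by (auto simp: T_def L_def)
  have C: "C\<^sup>H = C" "C * (D * C) = R * R\<^sup>H" "Ri * R\<^sup>H = C"
    unfolding C_def D_def R_def Ri_def adjoint_diag mat_diag_diag
    by (auto simp: mat_diag_def chi_def s_def max_def intro!: eq_matI simp flip: of_real_mult)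
  have TH: "T\<^sup>H = T" using dims C by (simp add: T_def mat_alg)
  have "H * T = U * (D * C * U\<^sup>H)"
    using dims mult_left_cong_dim[OF U(2)] by (simp add: T_def Hd D_def[symmetric] mat_alg)
  then have THT: "T * (H * T) = L * L\<^sup>H"
    using dims mult_left_cong_dim[OF U(2)] mult_left_cong_dim[OF C(2)]
    by (simp add: T_def L_def mat_alg)
  have TL: "T = U * Ri * L\<^sup>H"
    using dims mult_left_cong_dim[OF C(3)] by (simp add: T_def L_def mat_alg)
  \<comment> \<open>If \<open>M\<^sub>1\<close> kills \<open>y = T x\<close>, the form of
    \<open>H\<close> at \<open>y\<close> is minus that of \<open>M\<^sub>2\<close>, hence at most 0.
    It also equals the squared norm of \<open>L\<^sup>H x\<close>, so both vanish and
    \<open>T x = 0\<close>.\<close>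
  have "rk T \<le> rk (M\<^sub>1 * T)"
  proof (rule rk_le_kernel[OF mult_carrier_mat[OF M(1) T] T])
    fix x :: "complex vec" assume x: "x \<in> carrier_vec n" "M\<^sub>1 * T *\<^sub>v x = 0\<^sub>v n"
    define y where "y = T *\<^sub>v x"
    have y: "y \<in> carrier_vec n" using mult_mat_vec_carrier[OF T x(1)] by (simp add: y_def)
    have M1y: "M\<^sub>1 *\<^sub>v y = 0\<^sub>v n" using x T M by (simp add: y_def mult_vec_dim)
    have "(H *\<^sub>v y) \<bullet>c y = - ((M\<^sub>2 *\<^sub>v y) \<bullet>c y)"
      unfolding H(2)
      using M1y y M mult_mat_vec_carrier[OF M(3) y]
      by (simp add: minus_mult_distrib_mat_vec[of _ n n] minus_scalar_prod_distrib[of _ n])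
    then have "(H *\<^sub>v y) \<bullet>c y \<le> 0"
      using pos_semidefD(2)[OF M(2,3) y] by simp
    moreover have "(H *\<^sub>v y) \<bullet>c y = (L * L\<^sup>H *\<^sub>v x) \<bullet>c x"
    proof -
      have Hy: "H *\<^sub>v y \<in> carrier_vec n" using mult_mat_vec_carrier[OF hermitian_matsD(1)[OF H(1)] y] .
      have "(L * L\<^sup>H *\<^sub>v x) \<bullet>c x = (T *\<^sub>v (H *\<^sub>v y)) \<bullet>c x"
        unfolding THT[symmetric] y_def using x T hermitian_matsD[OF H(1)] by (simp add: mult_vec_dim)
      also have "\<dots> = (H *\<^sub>v y) \<bullet>c (T\<^sup>H *\<^sub>v x)"
        using Hy x T by (intro adjoint_scalar_prod) auto
      finally show ?thesis by (simp add: TH y_def)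
    qed
    moreover have "0 \<le> (L * L\<^sup>H *\<^sub>v x) \<bullet>c x"
      using pos_semidefD(2)[OF pos_semidef_gram[OF L], of n x] L x by simp
    ultimately have "(L * L\<^sup>H *\<^sub>v x) \<bullet>c x = 0" by simp
    then have "L\<^sup>H *\<^sub>v x = 0\<^sub>v n" by (rule gram_vec_eq_zero[OF L x(1)])
    then show "T *\<^sub>v x = 0\<^sub>v n"
      unfolding TL using x L dims by (simp add: mult_vec_dim mult_zero_vec)
  qed
  also have "\<dots> \<le> rk M\<^sub>1" by (rule rk_mult_le_left[OF M(1) T])
  finally show ?thesis
    unfolding T_def C_def rk_spectral[OF U] Hd inertia_spectral[OF U] unfolding chi0 .
qed

lemma neg_inertia_le:
  assumes H: "H \<in> hermitian_mats n" "H = M\<^sub>1 - M\<^sub>2"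
    and M: "pos_semidef M\<^sub>1" "M\<^sub>1 \<in> carrier_mat n n" "M\<^sub>2 \<in> carrier_mat n n"
  shows "neg_inertia H \<le> rk M\<^sub>2"
proof -
  have "- H = M\<^sub>2 - M\<^sub>1" unfolding H(2) using M by (intro eq_matI) auto
  then show ?thesis
    using pos_inertia_le[OF hermitian_uminus[OF H(1)] _ M(3,1,2)] inertia_uminus[OF H(1)] by simp
qed

text \<open>If the index is 0, the positive part has rank 0 and hence vanishes. The converse is the
  bound \<open>pos_inertia_le\<close> with zero as the first matrix of the difference.\<close>

lemma pos_inertia_eq_0_iff:
  assumes H: "H \<in> hermitian_mats n"
  shows "pos_inertia H = 0 \<longleftrightarrow> pos_semidef (- H)"
proof
  assume "pos_inertia H = 0"
  obtain P N where PN: "P \<in> carrier_mat n n" "N \<in> carrier_mat n n" "pos_semidef N"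
    "H = P - N" "rk P = 0"
    using hermitian_jordan_decomposition[OF H] \<open>pos_inertia H = 0\<close> by metis
  have "P * mp_inverse P = 0\<^sub>m n n"
    using mat_trace_proj_nonneg(2)[OF is_proj_mp(1)[OF PN(1)]] rk_eq_trace_mp[OF PN(1)] PN(5) by simp
  then have "P * mp_inverse P * P = 0\<^sub>m n n" using PN(1) by simp
  then have "P = 0\<^sub>m n n"
    using mp_inverse_simps[OF PN(1)] PN(1) by (simp add: mult_assoc_dim)
  then have "- H = N" using PN(2,4) by (intro eq_matI) auto
  then show "pos_semidef (- H)" using PN(3) by simp
next
  assume "pos_semidef (- H)"
  moreover have "H = 0\<^sub>m n n - (- H)" using hermitian_matsD[OF H] by (intro eq_matI) auto
  moreover have "rk (0\<^sub>m n n) = 0" using vec_space.rank_0I[of n n] by simp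
  ultimately show "pos_inertia H = 0"
    using pos_inertia_le[OF H, of "0\<^sub>m n n" "- H"] hermitian_matsD[OF hermitian_uminus[OF H]] by simp
qed

subsection \<open>Block matrices\<close>

lemma adjoint_four_block:
  assumes "A \<in> carrier_mat nr1 nc1" "B \<in> carrier_mat nr1 nc2" "C \<in> carrier_mat nr2 nc1" "D \<in> carrier_mat nr2 nc2"
  shows "(four_block_mat A B C D)\<^sup>H = four_block_mat (A\<^sup>H) (C\<^sup>H) (B\<^sup>H) (D\<^sup>H)"
  by (rule eq_matI) (use assms in auto)

lemma minus_four_block:
  fixes A1 :: "complex mat"
  assumes "A1 \<in> carrier_mat nr1 nc1" "B1 \<in> carrier_mat nr1 nc2" "C1 \<in> carrier_mat nr2 nc1" "D1 \<in> carrier_mat nr2 nc2"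
    and "A2 \<in> carrier_mat nr1 nc1" "B2 \<in> carrier_mat nr1 nc2" "C2 \<in> carrier_mat nr2 nc1" "D2 \<in> carrier_mat nr2 nc2"
  shows "four_block_mat A1 B1 C1 D1 - four_block_mat A2 B2 C2 D2 =
    four_block_mat (A1 - A2) (B1 - B2) (C1 - C2) (D1 - D2)"
  by (rule eq_matI) (use assms in auto)

lemma four_block_empty:
  "A \<in> carrier_mat m n \<Longrightarrow> four_block_mat A (0\<^sub>m m 0) (0\<^sub>m 0 n) (0\<^sub>m 0 0) = A"
  by (rule eq_matI) auto

lemma row_block_carrier:
  "P \<in> carrier_mat m n \<Longrightarrow> Q \<in> carrier_mat m k \<Longrightarrow> row_block P Q \<in> carrier_mat m (n + k)"
  by (auto simp: row_block_def intro!: carrier_matI)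

lemma row_block_gram:
  assumes P: "P \<in> carrier_mat m n" and Q: "Q \<in> carrier_mat m k"
  shows "row_block P Q * (row_block P Q)\<^sup>H = P * P\<^sup>H + Q * Q\<^sup>H"
proof -
  have rb: "row_block P Q = four_block_mat P Q (0\<^sub>m 0 n) (0\<^sub>m 0 k)"
    using P Q by (simp add: row_block_def)
  have "(row_block P Q)\<^sup>H = four_block_mat (P\<^sup>H) (0\<^sub>m n 0) (Q\<^sup>H) (0\<^sub>m k 0)"
    unfolding rb using P Q by (subst adjoint_four_block[of _ m n _ k _ 0]) auto
  moreover have "four_block_mat P Q (0\<^sub>m 0 n) (0\<^sub>m 0 k) * four_block_mat (P\<^sup>H) (0\<^sub>m n 0) (Q\<^sup>H) (0\<^sub>m k 0) =
      four_block_mat (P * P\<^sup>H + Q * Q\<^sup>H) (0\<^sub>m m 0) (0\<^sub>m 0 m) (0\<^sub>m 0 0)"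
    using P Q by (subst mult_four_block_mat[of _ m n _ k _ 0 _ _ m _ 0]) auto
  ultimately show ?thesis
    unfolding rb using P Q by (simp add: four_block_empty[of _ m m])
qed

text \<open>Two nonnegative quadratic forms with sum 0 both vanish, so no cancellation between
  \<open>P x\<close> and \<open>Q x\<close> is possible.\<close>

lemma psd_sum_kernel:
  assumes P: "pos_semidef P" "P \<in> carrier_mat m m" and Q: "pos_semidef Q" "Q \<in> carrier_mat m m"
    and x: "x \<in> carrier_vec m"
  shows "(P + Q) *\<^sub>v x = 0\<^sub>v m \<longleftrightarrow> P *\<^sub>v x = 0\<^sub>v m \<and> Q *\<^sub>v x = 0\<^sub>v m"
proof -
  have Px: "P *\<^sub>v x \<in> carrier_vec m" and Qx: "Q *\<^sub>v x \<in> carrier_vec m"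
    using mult_mat_vec_carrier P(2) Q(2) x by auto
  have sum: "(P + Q) *\<^sub>v x = P *\<^sub>v x + Q *\<^sub>v x"
    using P(2) Q(2) x by (rule add_mult_distrib_mat_vec)
  show ?thesis
  proof
    assume "(P + Q) *\<^sub>v x = 0\<^sub>v m"
    then have "(P *\<^sub>v x) \<bullet>c x + (Q *\<^sub>v x) \<bullet>c x = 0"
      using sum x add_scalar_prod_distrib[OF Px Qx carrier_vec_conjugate[OF x]] by simp
    then have "(P *\<^sub>v x) \<bullet>c x = 0" "(Q *\<^sub>v x) \<bullet>c x = 0"
      using pos_semidefD(2)[OF P x] pos_semidefD(2)[OF Q x] by (auto simp: add_nonneg_eq_0_iff)
    then show "P *\<^sub>v x = 0\<^sub>v m \<and> Q *\<^sub>v x = 0\<^sub>v m"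
      using pos_semidef_kernel_vec[OF P x] pos_semidef_kernel_vec[OF Q x] by simp
  qed (use sum in simp)
qed

lemma gram_sum_kernel:
  fixes P Q :: "complex mat"
  assumes P: "P \<in> carrier_mat m n" and Q: "Q \<in> carrier_mat m k" and x: "x \<in> carrier_vec m"
  shows "(P * P\<^sup>H + Q * Q\<^sup>H) *\<^sub>v x = 0\<^sub>v m \<longleftrightarrow> P\<^sup>H *\<^sub>v x = 0\<^sub>v n \<and> Q\<^sup>H *\<^sub>v x = 0\<^sub>v k"
  using psd_sum_kernel[OF pos_semidef_gram[OF P] _ pos_semidef_gram[OF Q] _ x]
    gram_kernel[OF P x] gram_kernel[OF Q x]
    mult_carrier_mat[OF P adjoint_carrier[OF P]] mult_carrier_mat[OF Q adjoint_carrier[OF Q]] by simp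

text \<open>Passing through the Gram matrix \<open>P * P\<^sup>H + Q * Q\<^sup>H\<close> avoids
  splitting a vector of length \<open>n + k\<close>.\<close>

lemma row_block_kernel:
  assumes "P \<in> carrier_mat m n" "Q \<in> carrier_mat m k" "x \<in> carrier_vec m"
  shows "(row_block P Q)\<^sup>H *\<^sub>v x = 0\<^sub>v (n + k) \<longleftrightarrow> P\<^sup>H *\<^sub>v x = 0\<^sub>v n \<and> Q\<^sup>H *\<^sub>v x = 0\<^sub>v k"
  using gram_kernel[OF row_block_carrier[OF assms(1,2)] assms(3)] gram_sum_kernel[OF assms]
    row_block_gram[OF assms(1,2)] by simp

lemma E_proj_simps:
  assumes A: "A \<in> carrier_mat m n"
  shows "E_proj A \<in> carrier_mat m m" "dim_row (E_proj A) = m" "dim_col (E_proj A) = m"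
    "(E_proj A)\<^sup>H = E_proj A" "E_proj A * E_proj A = E_proj A" "E_proj A * A = 0\<^sub>m m n"
    "A\<^sup>H * E_proj A = 0\<^sub>m n m" "mp_inverse A * E_proj A = 0\<^sub>m n m"
    "E_proj A * (mp_inverse A)\<^sup>H = 0\<^sub>m m n"
proof -
  note G = mp_inverse_simps[OF A]
  have dims: "dim_row A = m" "dim_col A = n" using A by auto
  note P = is_projD[OF is_proj_mp(1)[OF A]]
  have "is_proj m (E_proj A)"
    unfolding E_proj_def dims using is_proj_diff[OF is_proj_mp(1)[OF A] is_proj_one] P by simp
  note E = is_projD[OF this]
  then show "E_proj A \<in> carrier_mat m m" "dim_row (E_proj A) = m" "dim_col (E_proj A) = m"
    and EH: "(E_proj A)\<^sup>H = E_proj A" and "E_proj A * E_proj A = E_proj A" by auto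
  show EA: "E_proj A * A = 0\<^sub>m m n" and GE: "mp_inverse A * E_proj A = 0\<^sub>m n m"
    unfolding E_proj_def using G dims by (simp_all add: mat_alg)
  have "(E_proj A * A)\<^sup>H = 0\<^sub>m n m" "(mp_inverse A * E_proj A)\<^sup>H = 0\<^sub>m m n"
    by (simp_all add: EA GE)
  then show "A\<^sup>H * E_proj A = 0\<^sub>m n m" "E_proj A * (mp_inverse A)\<^sup>H = 0\<^sub>m m n"
    using E G dims EH by (simp_all add: adjoint_mult)
qed

lemma E_proj_fix:
  assumes A: "A \<in> carrier_mat m n" and x: "x \<in> carrier_vec m" "A\<^sup>H *\<^sub>v x = 0\<^sub>v n"
  shows "E_proj A *\<^sub>v x = x"
proof -
  note P = is_projD[OF is_proj_mp(1)[OF A]]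
  have "E_proj A *\<^sub>v x = 1\<^sub>m m *\<^sub>v x - A * mp_inverse A *\<^sub>v x"
    unfolding E_proj_def using A P(1) x(1) by (simp add: minus_mult_distrib_mat_vec[of _ m m] del: assoc_mult_mat_vec)
  then show ?thesis using proj_kernel[OF A x(1)] x by simp
qed

text \<open>The ranges of \<open>A\<close> and \<open>E * B\<close> are orthogonal, so their
  projections add up to a projection. Its kernel is that of the adjoint row block: on the kernel of
  \<open>A\<^sup>H\<close> the matrix \<open>E\<close> acts as the identity, and
  \<open>(E * B)\<^sup>H\<close> agrees with \<open>B\<^sup>H\<close> there.\<close>

lemma rk_row_block:
  assumes A: "A \<in> carrier_mat m n" and B: "B \<in> carrier_mat m k"
  shows "rk (row_block A B) = rk A + rk (E_proj A * B)"
proof -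
  define E where "E = E_proj A"
  define W where "W = E * B"
  define P where "P = A * mp_inverse A"
  define Q where "Q = W * mp_inverse W"
  note E = E_proj_simps[OF A, folded E_def]
  have W: "W \<in> carrier_mat m k" using E B by (auto simp: W_def intro!: carrier_matI)
  have dims: "dim_row A = m" "dim_col A = n" "dim_row B = m" "dim_col B = k" using A B by auto
  note G = mp_inverse_simps[OF A] and K = mp_inverse_simps[OF W]
  have pP: "is_proj m P" and pQ: "is_proj m Q"
    unfolding P_def Q_def by (rule is_proj_mp[OF A] is_proj_mp[OF W])+
  note P = is_projD[OF pP] and Q = is_projD[OF pQ]
  have PQ: "P * Q = 0\<^sub>m m m"
    unfolding P_def Q_def W_def using G K E dims mult_left_cong_dim[OF E(8)]
    by (simp add: mat_alg W_def)
  have "(P * Q)\<^sup>H = 0\<^sub>m m m" using PQ by simp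
  then have QP: "Q * P = 0\<^sub>m m m" using P Q by (simp add: adjoint_mult)
  have pF: "is_proj m (P + Q)"
    using P Q PQ QP by (auto simp: is_proj_def mat_alg)
  have "of_nat (rk (row_block A B)) = mat_trace (P + Q)"
  proof (rule rk_eq_trace_kernel[OF row_block_carrier[OF A B] pF])
    fix x :: "complex vec" assume x: "x \<in> carrier_vec m"
    have "(P + Q) *\<^sub>v x = 0\<^sub>v m \<longleftrightarrow> P *\<^sub>v x = 0\<^sub>v m \<and> Q *\<^sub>v x = 0\<^sub>v m"
      using psd_sum_kernel[of P m Q x] pos_semidef_gram[OF P(1)] pos_semidef_gram[OF Q(1)] P Q x by simp
    also have "\<dots> \<longleftrightarrow> A\<^sup>H *\<^sub>v x = 0\<^sub>v n \<and> W\<^sup>H *\<^sub>v x = 0\<^sub>v k"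
      unfolding P_def Q_def proj_kernel[OF A x] proj_kernel[OF W x] ..
    also have "\<dots> \<longleftrightarrow> A\<^sup>H *\<^sub>v x = 0\<^sub>v n \<and> B\<^sup>H *\<^sub>v x = 0\<^sub>v k"
      using E_proj_fix[OF A x, folded E_def] E dims x
      by (auto simp: W_def adjoint_mult mult_vec_dim)
    also have "\<dots> \<longleftrightarrow> (row_block A B)\<^sup>H *\<^sub>v x = 0\<^sub>v (n + k)"
      by (rule row_block_kernel[OF A B x, symmetric])
    finally show "(P + Q) *\<^sub>v x = 0\<^sub>v m \<longleftrightarrow> (row_block A B)\<^sup>H *\<^sub>v x = 0\<^sub>v (n + k)" .
  qed
  also have "\<dots> = mat_trace P + mat_trace Q" by (rule mat_trace_add[OF P(1) Q(1)])
  also have "\<dots> = of_nat (rk A + rk W)"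
    unfolding P_def Q_def using rk_eq_trace_mp[OF A] rk_eq_trace_mp[OF W] by simp
  finally show ?thesis unfolding W_def E_def by (simp only: of_nat_eq_iff)
qed

lemma rk_block_diag:
  assumes X: "X \<in> carrier_mat m k" and Y: "Y \<in> carrier_mat n l"
  shows "rk (four_block_mat X (0\<^sub>m m l) (0\<^sub>m n k) Y) = rk X + rk Y"
proof -
  note G = mp_inverse_simps[OF X] and K = mp_inverse_simps[OF Y]
  note P = is_projD[OF is_proj_mp(1)[OF X]] and Q = is_projD[OF is_proj_mp(1)[OF Y]]
  define F where "F = four_block_mat (X * mp_inverse X) (0\<^sub>m m n) (0\<^sub>m n m) (Y * mp_inverse Y)"
  have "of_nat (rk (four_block_mat X (0\<^sub>m m l) (0\<^sub>m n k) Y)) = mat_trace F"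
  proof (rule rk_eq_trace)
    show "four_block_mat X (0\<^sub>m m l) (0\<^sub>m n k) Y \<in> carrier_mat (m + n) (k + l)"
      by (rule four_block_carrier_mat[OF X Y])
    show "is_proj (m + n) F"
      unfolding is_proj_def F_def
    proof (intro conjI)
      show "(four_block_mat (X * mp_inverse X) (0\<^sub>m m n) (0\<^sub>m n m) (Y * mp_inverse Y))\<^sup>H =
          four_block_mat (X * mp_inverse X) (0\<^sub>m m n) (0\<^sub>m n m) (Y * mp_inverse Y)"
        by (subst adjoint_four_block[of _ m m _ n _ n]) (use P Q in auto)
      show "four_block_mat (X * mp_inverse X) (0\<^sub>m m n) (0\<^sub>m n m) (Y * mp_inverse Y) *
          four_block_mat (X * mp_inverse X) (0\<^sub>m m n) (0\<^sub>m n m) (Y * mp_inverse Y) =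
          four_block_mat (X * mp_inverse X) (0\<^sub>m m n) (0\<^sub>m n m) (Y * mp_inverse Y)"
        by (subst mult_four_block_mat[of _ m m _ n _ n _ _ m _ n])
          (use P Q in \<open>auto simp del: assoc_mult_mat\<close>)
    qed (rule four_block_carrier_mat[OF P(1) Q(1)])
    show "F * four_block_mat X (0\<^sub>m m l) (0\<^sub>m n k) Y = four_block_mat X (0\<^sub>m m l) (0\<^sub>m n k) Y"
      unfolding F_def
      by (subst mult_four_block_mat[of _ m m _ n _ n _ _ k _ l])
        (use X Y P Q G K in \<open>auto simp: mat_alg\<close>)
    show "F = four_block_mat X (0\<^sub>m m l) (0\<^sub>m n k) Y *
        four_block_mat (mp_inverse X) (0\<^sub>m k n) (0\<^sub>m l m) (mp_inverse Y)"
      unfolding F_def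
      by (subst mult_four_block_mat[of _ m k _ l _ n _ _ m _ n])
        (use X Y P Q G K in \<open>auto simp: mat_alg\<close>)
  qed (rule four_block_carrier_mat[OF G(1) K(1)])
  also have "mat_trace F = mat_trace (X * mp_inverse X) + mat_trace (Y * mp_inverse Y)"
  proof -
    have "mat_trace F = (\<Sum>i<m + n. if i < m then (X * mp_inverse X) $$ (i, i)
        else (Y * mp_inverse Y) $$ (i - m, i - m))"
      unfolding mat_trace_def F_def using X Y G(2,3) K(2,3)
      by (auto intro!: sum.cong simp del: index_mult_mat(1))
    also have "\<dots> = (\<Sum>i<m. (X * mp_inverse X) $$ (i, i)) + (\<Sum>i<n. (Y * mp_inverse Y) $$ (i, i))"
      using sum.shift_bounds_nat_ivl[of "\<lambda>i. (Y * mp_inverse Y) $$ (i - m, i - m)" 0 m n]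
        sum.atLeastLessThan_concat[of 0 m "m + n" "\<lambda>i. if i < m then (X * mp_inverse X) $$ (i, i)
          else (Y * mp_inverse Y) $$ (i - m, i - m)", symmetric]
      by (simp add: lessThan_atLeast0 add.commute del: index_mult_mat(1))
    finally show ?thesis using X Y by (simp add: mat_trace_def)
  qed
  also have "\<dots> = of_nat (rk X + rk Y)"
    using rk_eq_trace_mp[OF X] rk_eq_trace_mp[OF Y] by simp
  finally show ?thesis by (simp only: of_nat_eq_iff)
qed


subsection \<open>Inertia of the bordered matrix\<close>

text \<open>\<open>S\<close> is the block column of the identity over \<open>W\<close>; blocks of
  width 0 make it an instance of \<open>four_block_mat\<close>.\<close>

lemma sandwich_block:
  fixes X W :: "complex mat"
  assumes X: "X \<in> carrier_mat m m" and W: "W \<in> carrier_mat n m"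
  defines "S \<equiv> four_block_mat (1\<^sub>m m) (0\<^sub>m m 0) W (0\<^sub>m n 0)"
  shows "S * X * S\<^sup>H = four_block_mat X (X * W\<^sup>H) (W * X) (W * X * W\<^sup>H)"
proof -
  have "S * four_block_mat X (0\<^sub>m m 0) (0\<^sub>m 0 m) (0\<^sub>m 0 0) = four_block_mat X (0\<^sub>m m 0) (W * X) (0\<^sub>m n 0)"
    unfolding S_def by (subst mult_four_block_mat[of _ m m _ 0 _ n _ _ m _ 0]) (use X W in auto)
  then have SX: "S * X = four_block_mat X (0\<^sub>m m 0) (W * X) (0\<^sub>m n 0)"
    by (simp add: four_block_empty[OF X])
  have SH: "S\<^sup>H = four_block_mat (1\<^sub>m m) (W\<^sup>H) (0\<^sub>m 0 m) (0\<^sub>m 0 n)"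
    unfolding S_def using W by (subst adjoint_four_block[of _ m m _ 0 _ n]) auto
  show ?thesis
    unfolding SX SH by (subst mult_four_block_mat[of _ m m _ 0 _ n _ _ m _ n]) (use X W in auto)
qed

text \<open>The blocks \<open>A\<close> contribute one positive and one negative eigenvalue per unit of rank, through the
  identity \<open>[0, A; A\<^sup>H, 0] = K K\<^sup>H - L L\<^sup>H\<close> with \<open>K = [A; A\<^sup>\<dagger> A / 2]\<close> and \<open>L = [A; - A\<^sup>\<dagger> A / 2]\<close>.\<close>

lemma block_decomposition:
  assumes A: "A \<in> carrier_mat m n" and C: "C \<in> hermitian_mats m"
  obtains M\<^sub>1 M\<^sub>2 where "M\<^sub>1 \<in> carrier_mat (m + n) (m + n)" "M\<^sub>2 \<in> carrier_mat (m + n) (m + n)"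
    "pos_semidef M\<^sub>1" "pos_semidef M\<^sub>2" "four_block_mat C A (A\<^sup>H) (0\<^sub>m n n) = M\<^sub>1 - M\<^sub>2"
    "rk M\<^sub>1 \<le> rk A + pos_inertia C" "rk M\<^sub>2 \<le> rk A + neg_inertia C"
proof -
  obtain P N where PN: "P \<in> carrier_mat m m" "N \<in> carrier_mat m m" "pos_semidef P" "pos_semidef N"
    "C = P - N" "rk P = pos_inertia C" "rk N = neg_inertia C"
    using hermitian_jordan_decomposition[OF C] .
  note G = mp_inverse_simps[OF A]
  \<comment> \<open>With this choice \<open>AA * W\<^sup>H\<close> is half of \<open>A\<close>. In
    \<open>M P W - M N (- W)\<close> the two halves off the diagonal add up to \<open>A\<close>,
    while the contributions of \<open>AA\<close> on the diagonal cancel.\<close>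
  define W where "W = (1 / 2) \<cdot>\<^sub>m mp_inverse A"
  define AA where "AA = A * A\<^sup>H"
  define S where "S V = four_block_mat (1\<^sub>m m) (0\<^sub>m m 0) V (0\<^sub>m n 0)" for V :: "complex mat"
  define M where "M Q V = S (0\<^sub>m n m) * Q * (S (0\<^sub>m n m))\<^sup>H + S V * AA * (S V)\<^sup>H" for Q V
  have dims: "dim_row A = m" "dim_col A = n" using A by auto
  have W: "W \<in> carrier_mat n m" using G by (simp add: W_def)
  have AA: "AA \<in> carrier_mat m m" "pos_semidef AA" "rk AA = rk A"
    using A pos_semidef_gram[OF A] rk_gram[OF A] by (auto simp: AA_def)
  have S: "S V \<in> carrier_mat (m + n) m" if "V \<in> carrier_mat n m" for V
    using four_block_carrier_mat[of "1\<^sub>m m" m m "0\<^sub>m n 0" n 0] by (simp add: S_def)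
  have props: "M Q V \<in> carrier_mat (m + n) (m + n)" "pos_semidef (M Q V)" "rk (M Q V) \<le> rk A + rk Q"
    "M Q V = four_block_mat (Q + AA) (AA * V\<^sup>H) (V * AA) (V * AA * V\<^sup>H)"
    if Q: "Q \<in> carrier_mat m m" "pos_semidef Q" and V: "V \<in> carrier_mat n m" for Q V
  proof -
    have sandwich: "S V' * X * (S V')\<^sup>H \<in> carrier_mat (m + n) (m + n)" "pos_semidef (S V' * X * (S V')\<^sup>H)"
      "rk (S V' * X * (S V')\<^sup>H) \<le> rk X"
      if X: "X \<in> carrier_mat m m" "pos_semidef X" and V': "V' \<in> carrier_mat n m" for X V'
    proof -
      note S' = S[OF V'] mult_carrier_mat[OF S[OF V'] X(1)]
      show "S V' * X * (S V')\<^sup>H \<in> carrier_mat (m + n) (m + n)"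
        by (rule mult_carrier_mat[OF S'(2) adjoint_carrier[OF S'(1)]])
      show "pos_semidef (S V' * X * (S V')\<^sup>H)"
        by (rule pos_semidef_sandwich[OF X(2,1) S'(1)])
      show "rk (S V' * X * (S V')\<^sup>H) \<le> rk X"
        using rk_mult_le_left[OF S'(2) adjoint_carrier[OF S'(1)]] rk_mult_le_right[OF S'(1) X(1)]
        by (rule order_trans)
    qed
    note s1 = sandwich[OF Q zero_carrier_mat] and s2 = sandwich[OF AA(1,2) V]
    show "M Q V \<in> carrier_mat (m + n) (m + n)" using s1 s2 by (simp add: M_def)
    show "pos_semidef (M Q V)" unfolding M_def by (rule pos_semidef_add[OF s1(2,1) s2(2,1)])
    show "rk (M Q V) \<le> rk A + rk Q"
      using vec_space.rank_subadditive[OF s1(1) s2(1)] s1(3) s2(3) AA(3)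
        carrier_matD(1)[OF S[OF V]] carrier_matD(1)[OF S[OF zero_carrier_mat]] by (simp add: M_def)
    have sb1: "S (0\<^sub>m n m) * Q * (S (0\<^sub>m n m))\<^sup>H = four_block_mat Q (0\<^sub>m m n) (0\<^sub>m n m) (0\<^sub>m n n)"
      unfolding S_def by (subst sandwich_block[OF Q(1) zero_carrier_mat]) (use Q in auto)
    have sb2: "S V * AA * (S V)\<^sup>H = four_block_mat AA (AA * V\<^sup>H) (V * AA) (V * AA * V\<^sup>H)"
      unfolding S_def by (rule sandwich_block[OF AA(1) V])
    show "M Q V = four_block_mat (Q + AA) (AA * V\<^sup>H) (V * AA) (V * AA * V\<^sup>H)"
      unfolding M_def sb1 sb2
      by (subst add_four_block_mat[of _ m m _ n _ n])
        (use Q V AA in \<open>auto simp: add_zero_dim mult_assoc_dim\<close>)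
  qed
  have half: "X = (1 / 2) \<cdot>\<^sub>m X + (1 / 2) \<cdot>\<^sub>m X" for X :: "complex mat"
    by (rule eq_matI) auto
  have smult: "X * ((1 / 2) \<cdot>\<^sub>m Y) = (1 / 2) \<cdot>\<^sub>m (X * Y)" if "dim_col X = dim_row Y"
    for X Y :: "complex mat"
    by (rule mult_smult_distrib[of _ "dim_row X" "dim_col X" _ "dim_col Y"]) (use that in auto)
  have "AA * W\<^sup>H = (1 / 2) \<cdot>\<^sub>m (A * (A\<^sup>H * (mp_inverse A)\<^sup>H))"
    using G dims by (simp add: AA_def W_def adjoint_smult smult mult_assoc_dim)
  then have AW: "AA * W\<^sup>H = (1 / 2) \<cdot>\<^sub>m A" by (simp add: G(4,7))
  have "W * AA = (AA * W\<^sup>H)\<^sup>H"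
    using W AA dims by (simp add: adjoint_mult AA_def)
  then have WA: "W * AA = (1 / 2) \<cdot>\<^sub>m A\<^sup>H" by (simp add: AW adjoint_smult)
  show ?thesis
  proof (rule that)
    have W': "- W \<in> carrier_mat n m" using W by simp
    show "M P W \<in> carrier_mat (m + n) (m + n)" "M N (- W) \<in> carrier_mat (m + n) (m + n)"
      "pos_semidef (M P W)" "pos_semidef (M N (- W))"
      using props PN W W' by auto
    show "rk (M P W) \<le> rk A + pos_inertia C" "rk (M N (- W)) \<le> rk A + neg_inertia C"
      using props(3)[OF PN(1,3) W] props(3)[OF PN(2,4) W'] PN(6,7) by simp_all
    have "M P W - M N (- W) = four_block_mat (P + AA - (N + AA)) (AA * W\<^sup>H - AA * (- W)\<^sup>H)
        (W * AA - (- W) * AA) (W * AA * W\<^sup>H - (- W) * AA * (- W)\<^sup>H)"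
      unfolding props(4)[OF PN(1,3) W] props(4)[OF PN(2,4) W']
      by (rule minus_four_block[of _ m m _ n _ n]) (use PN AA W in auto)
    also have "P + AA - (N + AA) = C" unfolding PN(5) by (rule eq_matI) (use PN AA in auto)
    also have "AA * W\<^sup>H - AA * (- W)\<^sup>H = (1 / 2) \<cdot>\<^sub>m A + (1 / 2) \<cdot>\<^sub>m A"
      using W AA by (simp add: mat_alg AW) (auto intro!: eq_matI)
    also have "(1 / 2) \<cdot>\<^sub>m A + (1 / 2) \<cdot>\<^sub>m A = A" by (rule half[symmetric])
    also have "W * AA - (- W) * AA = (1 / 2) \<cdot>\<^sub>m A\<^sup>H + (1 / 2) \<cdot>\<^sub>m A\<^sup>H"
      using W AA by (simp add: mat_alg WA) (auto intro!: eq_matI)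
    also have "(1 / 2) \<cdot>\<^sub>m A\<^sup>H + (1 / 2) \<cdot>\<^sub>m A\<^sup>H = A\<^sup>H" by (rule half[symmetric])
    also have "W * AA * W\<^sup>H - (- W) * AA * (- W)\<^sup>H = 0\<^sub>m n n"
      using W AA by (simp add: mat_alg)
    finally show "four_block_mat C A (A\<^sup>H) (0\<^sub>m n n) = M P W - M N (- W)" by simp
  qed
qed

text \<open>The ranges of \<open>A\<close> and \<open>C\<close> are orthogonal, so the cross terms
  in \<open>N * N\<close> vanish and the square is block diagonal. Since \<open>N\<close> is
  Hermitian, \<open>N * N\<close> is its Gram matrix and has the same rank.\<close>

lemma rk_block:
  assumes A: "A \<in> carrier_mat m n" and C: "C \<in> hermitian_mats m" "C * A = 0\<^sub>m m n" "E_proj A * C = C"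
  shows "rk (four_block_mat C A (A\<^sup>H) (0\<^sub>m n n)) = 2 * rk A + rk C"
proof -
  define N where "N = four_block_mat C A (A\<^sup>H) (0\<^sub>m n n)"
  note CD = hermitian_matsD[OF C(1)]
  have "(C * A)\<^sup>H = 0\<^sub>m n m" by (simp add: C(2))
  then have AC: "A\<^sup>H * C = 0\<^sub>m n m" using A CD by (simp add: adjoint_mult)
  have N: "N \<in> carrier_mat (m + n) (m + n)" using CD by (simp add: N_def)
  have NH: "N\<^sup>H = N"
    unfolding N_def using A CD by (subst adjoint_four_block[of _ m m _ n _ n]) auto
  have "N * N = four_block_mat (A * A\<^sup>H + C * C\<^sup>H) (0\<^sub>m m n) (0\<^sub>m n m) (A\<^sup>H * A)"
    unfolding N_def
    by (subst mult_four_block_mat[of _ m m _ n _ n _ _ m _ n])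
      (use A CD C AC comm_add_mat[of "A * A\<^sup>H" m m "C * C"] in auto)
  then have "rk N = rk (A * A\<^sup>H + C * C\<^sup>H) + rk (A\<^sup>H * A)"
    using rk_gram[OF N] NH rk_block_diag[of "A * A\<^sup>H + C * C\<^sup>H" m m "A\<^sup>H * A" n n] A CD
      mult_carrier_mat[OF adjoint_carrier[OF A] A] by simp
  also have "rk (A\<^sup>H * A) = rk A"
    using rk_gram[OF adjoint_carrier[OF A]] rk_adjoint[OF A] by simp
  also have "A * A\<^sup>H + C * C\<^sup>H = row_block A C * (row_block A C)\<^sup>H"
    by (rule row_block_gram[OF A CD(1), symmetric])
  also have "rk \<dots> = rk A + rk C"
    using rk_gram[OF row_block_carrier[OF A CD(1)]] rk_row_block[OF A CD(1)] C(3) by simp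
  finally show ?thesis by (simp add: N_def)
qed

text \<open>Block elimination with the unipotent \<open>T = [1, 0; Z, 1]\<close> changes only the
  upper left block, to \<open>B + A * Z + Z\<^sup>H * A\<^sup>H\<close>.\<close>

lemma block_congruence:
  assumes A: "A \<in> carrier_mat m n" and B: "B \<in> hermitian_mats m"
  obtains T Ti where "T \<in> carrier_mat (m + n) (m + n)" "Ti \<in> carrier_mat (m + n) (m + n)"
    "T * Ti = 1\<^sub>m (m + n)"
    "four_block_mat (E_proj A * B * E_proj A) A (A\<^sup>H) (0\<^sub>m n n) =
      T\<^sup>H * four_block_mat B A (A\<^sup>H) (0\<^sub>m n n) * T"
proof -
  note G = mp_inverse_simps[OF A] and BD = hermitian_matsD[OF B]
  define P where "P = A * mp_inverse A"
  define H where "H = (1 / 2) \<cdot>\<^sub>m B"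
  have BH: "B = H + H" unfolding H_def by (rule eq_matI) auto
  have Hd: "H \<in> carrier_mat m m" "dim_row H = m" "dim_col H = m" "H\<^sup>H = H"
    using BD by (auto simp: H_def adjoint_smult)
  note P = is_projD[OF is_proj_mp(1)[OF A], folded P_def]
  \<comment> \<open>With \<open>E = 1 - P\<close> the target is
    \<open>B - P B - B P + P B P\<close>. The term \<open>P B P\<close> has to be shared equally
    between \<open>A * Z\<close> and its adjoint, which is why \<open>H\<close> is half of
    \<open>B\<close>.\<close>
  define Z where "Z = - (mp_inverse A * (B - H * P))"
  have dims: "dim_row A = m" "dim_col A = n" using A by auto
  have Z: "Z \<in> carrier_mat n m" using G BD Hd P by (auto simp: Z_def intro!: carrier_matI)
  have AZ: "A * Z = - (P * (B - H * P))"
    using G BD Hd P dims by (simp add: Z_def P_def mult_uminus_dim mult_assoc_dim)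
  have "Z\<^sup>H * A\<^sup>H = (A * Z)\<^sup>H" using Z dims by (simp add: adjoint_mult)
  also have "\<dots> = - ((B - P * H) * P)"
    unfolding AZ using BD Hd P by (simp add: adjoint_mult adjoint_add)
  finally have ZA: "Z\<^sup>H * A\<^sup>H = - ((B - P * H) * P)" .
  have E: "E_proj A = 1\<^sub>m m - P" using dims by (simp add: E_proj_def P_def)
  have sum: "B + A * Z + Z\<^sup>H * A\<^sup>H = E_proj A * B * E_proj A"
  proof -
    define X Y Q where "X = P * B" and "Y = B * P" and "Q = P * (H * P)"
    have XYQ: "X \<in> carrier_mat m m" "Y \<in> carrier_mat m m" "Q \<in> carrier_mat m m"
      using P BD Hd by (auto simp: X_def Y_def Q_def)
    have "A * Z = - (X - Q)" "Z\<^sup>H * A\<^sup>H = - (Y - Q)"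
      unfolding AZ ZA using P BD Hd by (simp_all add: mat_alg X_def Y_def Q_def)
    moreover have "E_proj A * B * E_proj A = B - X - (Y - (Q + Q))"
    proof -
      have "Q + Q = P * B * P" unfolding BH Q_def using P Hd by (simp add: mat_alg)
      then show ?thesis unfolding E X_def Y_def using P BD by (simp add: mat_alg)
    qed
    ultimately show ?thesis
      by (simp only:) (rule eq_matI, use XYQ BD in auto)
  qed
  define T where "T = four_block_mat (1\<^sub>m m) (0\<^sub>m m n) Z (1\<^sub>m n)"
  define Ti where "Ti = four_block_mat (1\<^sub>m m) (0\<^sub>m m n) (- Z) (1\<^sub>m n)"
  have TH: "T\<^sup>H = four_block_mat (1\<^sub>m m) (Z\<^sup>H) (0\<^sub>m n m) (1\<^sub>m n)"
    unfolding T_def using Z by (subst adjoint_four_block[of _ m m _ n _ n]) auto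
  have BT: "four_block_mat B A (A\<^sup>H) (0\<^sub>m n n) * T = four_block_mat (B + A * Z) A (A\<^sup>H) (0\<^sub>m n n)"
    unfolding T_def by (subst mult_four_block_mat[of _ m m _ n _ n _ _ m _ n]) (use A BD Z in auto)
  have "T\<^sup>H * (four_block_mat B A (A\<^sup>H) (0\<^sub>m n n) * T) =
      four_block_mat (B + A * Z + Z\<^sup>H * A\<^sup>H) A (A\<^sup>H) (0\<^sub>m n n)"
    unfolding TH BT by (subst mult_four_block_mat[of _ m m _ n _ n _ _ m _ n]) (use A BD Z in auto)
  moreover have T: "T \<in> carrier_mat (m + n) (m + n)" "Ti \<in> carrier_mat (m + n) (m + n)"
    by (simp_all add: T_def Ti_def)
  moreover have "four_block_mat B A (A\<^sup>H) (0\<^sub>m n n) \<in> carrier_mat (m + n) (m + n)"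
    using BD by simp
  moreover have ZZ: "Z + - Z = 0\<^sub>m n m" using Z by (intro eq_matI) auto
  have "T * Ti = 1\<^sub>m (m + n)"
    unfolding T_def Ti_def by (subst mult_four_block_mat[of _ m m _ n _ n _ _ m _ n])
      (use Z ZZ in \<open>auto simp: mat_alg\<close>)
  ultimately show ?thesis
    using that[of T Ti] sum assoc_mult_mat[of "T\<^sup>H" "m + n" "m + n"] by simp
qed

text \<open>Invariance of inertia under congruence is not invoked. The decomposition of the
  congruent matrix \<open>N'\<close> is carried back to \<open>N\<close> by \<open>Ti\<close>, which
  bounds both indices of \<open>N\<close> from above. The bounds sum to
  \<open>2 * rk A + rk C\<close>, at most \<open>rk N\<close>, and the indices sum to
  \<open>rk N\<close>; hence both bounds are equalities.\<close>

lemma inertia_block: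
  assumes A: "A \<in> carrier_mat m n" and B: "B \<in> hermitian_mats m"
  defines "C \<equiv> E_proj A * B * E_proj A" and "N \<equiv> four_block_mat B A (A\<^sup>H) (0\<^sub>m n n)"
  shows "pos_inertia N = rk A + pos_inertia C" "neg_inertia N = rk A + neg_inertia C"
proof -
  note E = E_proj_simps[OF A] and BD = hermitian_matsD[OF B]
  have dims: "dim_row A = m" "dim_col A = n" using A by auto
  have C: "C \<in> hermitian_mats m"
    using E BD by (auto simp: C_def hermitian_mats_def mat_alg intro!: carrier_matI)
  have CA: "C * A = 0\<^sub>m m n" "E_proj A * C = C"
    using E BD dims mult_left_cong_dim[OF E(5)] by (simp_all add: C_def mat_alg)
  have N: "N \<in> hermitian_mats (m + n)"
    unfolding hermitian_mats_def N_def
    by (intro CollectI conjI four_block_carrier_mat, use BD in simp, simp,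
      subst adjoint_four_block[of _ m m _ n _ n]) (use A BD in auto)
  note ND = hermitian_matsD[OF N]
  define N' where "N' = four_block_mat C A (A\<^sup>H) (0\<^sub>m n n)"
  obtain T Ti where T: "T \<in> carrier_mat (m + n) (m + n)" "Ti \<in> carrier_mat (m + n) (m + n)"
    "T * Ti = 1\<^sub>m (m + n)" "N' = T\<^sup>H * N * T"
    using block_congruence[OF A B, folded C_def N_def N'_def] .
  have Td: "dim_row T = m + n" "dim_col T = m + n" "dim_row Ti = m + n" "dim_col Ti = m + n"
    using T by auto
  have "(T * Ti)\<^sup>H = 1\<^sub>m (m + n)" by (simp add: T(3))
  then have TT: "Ti\<^sup>H * T\<^sup>H = 1\<^sub>m (m + n)" using Td by (simp add: adjoint_mult)
  have NN': "N = Ti\<^sup>H * N' * Ti"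
    unfolding T(4) using Td ND mult_left_cong_dim[OF TT] T(3) by (simp add: mat_alg)
  have N'c: "N' \<in> carrier_mat (m + n) (m + n)"
    using hermitian_matsD[OF C] by (simp add: N'_def)
  have "rk N' \<le> rk N"
  proof -
    have "rk N' \<le> rk (T\<^sup>H * N)" unfolding T(4) using T ND by (intro rk_mult_le_left) auto
    also have "\<dots> \<le> rk N" using T ND by (intro rk_mult_le_right) auto
    finally show ?thesis .
  qed
  then have rk: "2 * rk A + rk C \<le> rk N"
    using rk_block[OF A C CA] by (simp add: N'_def)
  obtain M\<^sub>1 M\<^sub>2 where M: "M\<^sub>1 \<in> carrier_mat (m + n) (m + n)" "M\<^sub>2 \<in> carrier_mat (m + n) (m + n)"
    "pos_semidef M\<^sub>1" "pos_semidef M\<^sub>2" "N' = M\<^sub>1 - M\<^sub>2"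
    "rk M\<^sub>1 \<le> rk A + pos_inertia C" "rk M\<^sub>2 \<le> rk A + neg_inertia C"
    using block_decomposition[OF A C, folded N'_def] .
  define S where "S M = Ti\<^sup>H * M * Ti" for M
  have S: "S M \<in> carrier_mat (m + n) (m + n)" "pos_semidef (S M)" "rk (S M) \<le> rk M"
    if "M \<in> carrier_mat (m + n) (m + n)" "pos_semidef M" for M
  proof -
    show "S M \<in> carrier_mat (m + n) (m + n)" unfolding S_def
      by (rule mult_carrier_mat[OF mult_carrier_mat[OF adjoint_carrier[OF T(2)] that(1)] T(2)])
    show "pos_semidef (S M)"
      using pos_semidef_sandwich[OF that(2,1), of "Ti\<^sup>H" "m + n"] T by (simp add: S_def)
    have "rk (S M) \<le> rk (Ti\<^sup>H * M)" unfolding S_def using T that by (intro rk_mult_le_left) auto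
    also have "\<dots> \<le> rk M" using T that by (intro rk_mult_le_right) auto
    finally show "rk (S M) \<le> rk M" .
  qed
  have "N = S M\<^sub>1 - S M\<^sub>2"
    unfolding NN' M(5) S_def using Td M(1,2) by (simp add: mat_alg)
  note le = pos_inertia_le[OF N this S(1)[OF M(1,3)] S(2,1)[OF M(2,4)]]
    neg_inertia_le[OF N this S(2,1)[OF M(1,3)] S(1)[OF M(2,4)]]
  have "pos_inertia N \<le> rk A + pos_inertia C" "neg_inertia N \<le> rk A + neg_inertia C"
    using le S(3)[OF M(1,3)] S(3)[OF M(2,4)] M(6,7) by linarith+
  then show "pos_inertia N = rk A + pos_inertia C" "neg_inertia N = rk A + neg_inertia C"
    using rk pos_plus_neg_inertia[OF N] pos_plus_neg_inertia[OF C] by linarith+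
qed

subsection \<open>The inequality \<open>A X A\<^sup>H \<succeq> B\<close>\<close>

text \<open>The projections onto the ranges of \<open>X\<close> and \<open>X * Y\<close> are nested;
  equal ranks make the trace of their difference 0, so they coincide.\<close>

lemma rk_mult_eq_iff:
  assumes X: "X \<in> carrier_mat m n" and Y: "Y \<in> carrier_mat n k"
  shows "rk (X * Y) = rk X \<longleftrightarrow> X * Y * mp_inverse (X * Y) * X = X"
proof
  have XY: "X * Y \<in> carrier_mat m k" using X Y by simp
  note G = mp_inverse_simps[OF X] and K = mp_inverse_simps[OF XY]
  {
    assume eq: "rk (X * Y) = rk X"
    define F where "F = (X * Y) * mp_inverse (X * Y)"
    define P where "P = X * mp_inverse X"
    have pP: "is_proj m P" and pF: "is_proj m F"
      unfolding P_def F_def by (rule is_proj_mp[OF X] is_proj_mp[OF XY])+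
    have "P * F = F"
      using G K X Y mult_left_cong_dim[OF G(4), of "Y * mp_inverse (X * Y)"]
      by (simp add: P_def F_def mat_alg)
    then have pd: "is_proj m (P - F)" by (rule is_proj_diff[OF pF pP])
    have "mat_trace (P - F) = mat_trace P - mat_trace F"
      by (rule mat_trace_add(2)[OF is_projD(1)[OF pP] is_projD(1)[OF pF]])
    also have "\<dots> = of_nat (rk X) - of_nat (rk (X * Y))"
      unfolding P_def F_def rk_eq_trace_mp[OF X] rk_eq_trace_mp[OF XY] ..
    finally have "mat_trace (P - F) = 0" unfolding eq by simp
    then have "P - F = 0\<^sub>m m m" by (rule mat_trace_proj_nonneg(2)[OF pd])
    then have "P = F" by (rule minus_zero_eq[OF is_projD(1)[OF pP] is_projD(1)[OF pF]])
    then have "F * X = P * X" by simp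
    also have "\<dots> = X" unfolding P_def using G X by (simp add: mult_assoc_dim)
    finally show "X * Y * mp_inverse (X * Y) * X = X" unfolding F_def .
  next
    assume "X * Y * mp_inverse (X * Y) * X = X"
    then have "column_space (X * Y) = column_space X"
      using column_space_mult_eq_iff[OF X Y] by simp
    then show "rk (X * Y) = rk X" using X by (intro rk_cong_column_space) auto
  }
qed

lemma rk_uminus: "rk (- M) = rk M"
proof -
  have le: "rk (- K) \<le> rk K" for K
  proof -
    have "K * (- 1\<^sub>m (dim_col K)) = - K" by (simp add: mult_uminus_dim)
    then show ?thesis
      using rk_mult_le_left[of K "dim_row K" "dim_col K" "- 1\<^sub>m (dim_col K)" "dim_col K"] by simp
  qed
  show ?thesis using le[of M] le[of "- M"] by (simp add: add_zero_dim)
qed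

locale loewner_problem =
  fixes A B :: "complex mat" and m n :: nat
  assumes A: "A \<in> carrier_mat m n" and B: "B \<in> hermitian_mats m"
begin

definition "Ap = mp_inverse A"
definition "E = E_proj A"
definition "C = E * B * E"
definition "G = mp_inverse C"
definition "X0 = Ap * B * Ap\<^sup>H - Ap * B * E * G * E * B * Ap\<^sup>H"
definition "Y0 = B - B * E * G * E * B"
definition "Xp U W = X0 + U * U\<^sup>H + W - Ap * A * W * Ap * A"

lemmas BD = hermitian_matsD[OF B]
lemmas Ap = mp_inverse_simps[OF A, folded Ap_def]
lemmas E = E_proj_simps[OF A, folded E_def Ap_def]

lemma dimA: "dim_row A = m" "dim_col A = n"
  using A by auto

lemma C: "C \<in> hermitian_mats m"
  using E BD by (auto simp: C_def hermitian_mats_def mat_alg intro!: carrier_matI)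

lemmas CD = hermitian_matsD[OF C]
lemmas Gm = mp_inverse_simps[OF CD(1), folded G_def]

lemma GH: "G\<^sup>H = G"
  unfolding G_def by (rule mp_inverse_hermitian[OF C])

lemma EC: "E * C = C" "C * E = C"
  using E BD mult_left_cong_dim[OF E(5)] by (simp_all add: C_def mat_alg)

text \<open>For Hermitian \<open>C\<close> the projections \<open>C * G\<close> and
  \<open>G * C\<close> coincide. This form exhibits \<open>C\<close> as a left factor of
  \<open>G\<close>, so that \<open>E\<close> fixes \<open>G\<close> as it fixes
  \<open>C\<close>.\<close>

lemma CGG: "C * G * G = G"
proof -
  have "G * C = C * G" using Gm(6) GH CD by simp
  moreover have "G * C * G = G" using Gm CD by (simp add: mult_assoc_dim)
  ultimately show ?thesis by simp
qed

lemma EG: "E * G = G" "G * E = G"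
proof -
  have "G = C * G * G"
    by (simp only: CGG)
  then have "E * G = E * (C * G * G)" by simp
  also have "\<dots> = C * G * G"
    using E CD Gm mult_left_cong_dim[OF EC(1)] by (simp add: mult_assoc_dim)
  finally show "E * G = G" using \<open>G = C * G * G\<close> by simp
  then have "(E * G)\<^sup>H = G\<^sup>H" by simp
  then show "G * E = G" using E Gm GH by (simp add: adjoint_mult)
qed

lemma E_eq: "E = 1\<^sub>m m - A * Ap"
  using dimA by (simp add: E_def E_proj_def Ap_def)

text \<open>The second conjunct is the range condition in algebraic form: the projection
  \<open>C * G\<close> onto the range of \<open>C\<close> fixes \<open>E * B\<close>.\<close>

definition consistent where
  "consistent \<longleftrightarrow> pos_semidef (- C) \<and> C * G * (E * B) = E * B"

lemma uminus_C: "- C \<in> carrier_mat m m"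
  using CD by simp

section \<open>Solvability of the nonstrict inequality and its solutions\<close>

lemma consistent_if_solvable:
  assumes X: "X \<in> hermitian_mats n" and psd: "pos_semidef (A * X * A\<^sup>H - B)"
  shows "consistent"
proof -
  define M where "M = A * X * A\<^sup>H - B"
  note XD = hermitian_matsD[OF X]
  have M: "M \<in> carrier_mat m m" "dim_row M = m" "dim_col M = m"
    using A BD XD by (auto simp: M_def)
  have EM: "E * M = - (E * B)" and ME: "M * E = - (B * E)"
    using E BD XD dimA mult_left_cong_dim[OF E(6)] by (simp_all add: M_def mat_alg)
  have EME: "E * M * E\<^sup>H = - C"
    using EM E BD M by (simp add: mult_uminus_dim C_def)
  have psdC: "pos_semidef (- C)"
    using pos_semidef_sandwich[OF psd[folded M_def] M(1) E(1)] EME by simp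
  \<comment> \<open>\<open>Y\<close> projects onto the kernel of \<open>C\<close>. The form of
    \<open>M\<close> vanishes on the range of \<open>E * Y\<close> because
    \<open>E M E = - C\<close>, so semidefiniteness gives \<open>M * (E * Y) = 0\<close>, that is
    \<open>B * E * Y = 0\<close>.\<close>
  define Y where "Y = 1\<^sub>m m - G * C"
  have Y: "Y \<in> carrier_mat m m" "dim_row Y = m" "dim_col Y = m" using Gm CD by (auto simp: Y_def)
  have CY: "C * Y = 0\<^sub>m m m" using Gm CD by (simp add: Y_def mat_alg)
  have "(E * Y)\<^sup>H * M * (E * Y) = Y\<^sup>H * (E * M * E\<^sup>H) * Y"
    using E M Y by (simp add: mat_alg)
  also have "\<dots> = 0\<^sub>m m m"
    unfolding EME using CY CD Y by (simp add: mat_alg)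
  finally have "M * (E * Y) = 0\<^sub>m m m"
    using E Y by (intro pos_semidef_kernel_mat[OF psd[folded M_def] M(1)]) auto
  moreover have "M * (E * Y) = - (B * E * Y)"
    using ME E M Y BD mult_left_cong_dim[OF ME, of Y] by (simp add: mat_alg)
  ultimately have "- (- (B * E * Y)) = 0\<^sub>m m m" by (simp add: add_zero_dim)
  then have "B * E - B * E * (G * C) = 0\<^sub>m m m"
    using E BD Gm CD by (simp add: Y_def mat_alg)
  then have "B * E = B * E * (G * C)"
    by (rule minus_zero_eq[rotated 2]) (use E BD Gm CD in \<open>auto intro!: carrier_matI\<close>)
  then have "(B * E * (G * C))\<^sup>H = (B * E)\<^sup>H" by simp
  then have "C * G * (E * B) = E * B"
    using E BD Gm CD GH by (simp add: adjoint_mult mult_assoc_dim)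
  then show ?thesis using psdC by (simp add: consistent_def)
qed

lemma X0_eq: "X0 = Ap * Y0 * Ap\<^sup>H"
  using Ap E BD Gm by (simp add: X0_def Y0_def mat_alg)

lemma Y0: "Y0 \<in> hermitian_mats m"
  using BD E Gm GH by (auto simp: Y0_def hermitian_mats_def mat_alg intro!: carrier_matI)

lemmas Y0D = hermitian_matsD[OF Y0]

lemma X0: "X0 \<in> hermitian_mats n"
  using Ap Y0D by (auto simp: X0_eq hermitian_mats_def mat_alg intro!: carrier_matI)

lemmas X0D = hermitian_matsD[OF X0]

text \<open>Consistency says exactly that \<open>E * Y0 = 0\<close>, so the projection
  \<open>A * Ap = 1 - E\<close> fixes \<open>Y0\<close> from both sides.\<close>

lemma A_X0_A:
  assumes consistent
  shows "A * X0 * A\<^sup>H = Y0"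
proof -
  have CGEB: "C * (G * (E * B)) = E * B"
    using assms E BD Gm CD by (simp add: consistent_def mult_assoc_dim)
  have "E * Y0 = E * B - C * (G * (E * B))"
    using E BD Gm by (simp add: Y0_def C_def mat_alg)
  then have EY: "E * Y0 = 0\<^sub>m m m" using E BD by (simp add: CGEB add_zero_dim)
  then have "(E * Y0)\<^sup>H = 0\<^sub>m m m" by simp
  then have YE: "Y0 * E = 0\<^sub>m m m" using E Y0D by (simp add: adjoint_mult)
  have P: "A * Ap = 1\<^sub>m m - E"
    unfolding E_eq using dimA Ap by (intro eq_matI) auto
  have "A * X0 * A\<^sup>H = (A * Ap) * Y0 * (Ap\<^sup>H * A\<^sup>H)"
    unfolding X0_eq using dimA Ap(1-5) Y0D by (simp add: mult_assoc_dim)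
  also have "\<dots> = (1\<^sub>m m - E) * Y0 * (1\<^sub>m m - E)"
    by (simp add: Ap(6) P)
  also have "\<dots> = Y0" using E Y0D EY YE by (simp add: mat_alg)
  finally show ?thesis .
qed

text \<open>\<open>Y0 - B\<close> is the sandwich of \<open>- G\<close> by \<open>B * E\<close>, and
  \<open>- G\<close> is the sandwich of \<open>- C\<close> by \<open>G\<close>.\<close>

lemma pos_semidef_Y0_diff:
  assumes consistent
  shows "pos_semidef (Y0 - B)"
proof -
  have "G * (- C) * G\<^sup>H = - (G * C * G)" using Gm CD GH by (simp add: mult_uminus_dim)
  also have "G * C * G = G" using Gm(2,3,5) CD by (simp add: mult_assoc_dim)
  finally have "G * (- C) * G\<^sup>H = - G" .
  then have "pos_semidef (- G)"
    using pos_semidef_sandwich[of "- C" m G m] assms uminus_C Gm by (simp add: consistent_def)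
  then have "pos_semidef (B * E * (- G) * (B * E)\<^sup>H)"
    using pos_semidef_sandwich[of "- G" m "B * E" m] Gm E BD by simp
  moreover have "B * E * (- G) * (B * E)\<^sup>H = Y0 - B"
    using Gm E BD by (simp add: mat_alg Y0_def) (intro eq_matI; simp)
  ultimately show ?thesis by simp
qed

text \<open>\<open>Ap * A\<close> fixes \<open>A\<^sup>H\<close> from the left and is absorbed by
  \<open>A\<close> from the right. The two terms in \<open>W\<close> therefore cancel and nothing
  happens to the \<open>U\<close> term.\<close>

lemma A_Xp_A:
  assumes consistent and U: "U \<in> carrier_mat n n" and W: "W \<in> hermitian_mats n"
  shows "A * Xp U W * A\<^sup>H = Y0 + A * U * U\<^sup>H * A\<^sup>H"
proof -
  note WD = hermitian_matsD[OF W]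
  define V where "V = A * (U * (U\<^sup>H * A\<^sup>H))"
  define Z where "Z = A * (W * A\<^sup>H)"
  have AA: "Ap * (A * A\<^sup>H) = A\<^sup>H"
  proof -
    have "(A * (Ap * A))\<^sup>H = A\<^sup>H" by (simp add: Ap(4))
    then have "A\<^sup>H * Ap\<^sup>H * A\<^sup>H = A\<^sup>H" using dimA Ap(2,3) by (simp add: adjoint_mult)
    then show ?thesis unfolding Ap(7) using dimA Ap(2,3) by (simp add: mult_assoc_dim)
  qed
  have "A * Xp U W * A\<^sup>H = A * (X0 * A\<^sup>H) + (V + Z) - Z"
    using dimA Ap WD U X0D mult_left_cong_dim[OF Ap(4)]
    by (simp add: Xp_def mat_alg V_def Z_def AA)
  also have "A * (X0 * A\<^sup>H) = Y0"
    using A_X0_A[OF assms(1)] dimA X0D by (simp add: mult_assoc_dim)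
  also have "Y0 + (V + Z) - Z = Y0 + V"
    using dimA WD U Y0D by (intro eq_matI) (auto simp: V_def Z_def simp del: index_mult_mat(1))
  finally show ?thesis using dimA U by (simp add: V_def mult_assoc_dim)
qed

lemma Xp_hermitian:
  assumes U: "U \<in> carrier_mat n n" and W: "W \<in> hermitian_mats n"
  shows "Xp U W \<in> hermitian_mats n"
proof -
  note WD = hermitian_matsD[OF W]
  have "(Ap * A * W * Ap * A)\<^sup>H = (A\<^sup>H * Ap\<^sup>H) * W * (A\<^sup>H * Ap\<^sup>H)"
    using dimA Ap(1-5) WD by (simp add: adjoint_mult mult_assoc_dim)
  also have "\<dots> = Ap * A * W * Ap * A"
    unfolding Ap(7) using dimA Ap WD by (simp add: mult_assoc_dim)
  finally show ?thesis
    using dimA Ap(1-5) WD U X0D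
    by (auto simp: hermitian_mats_def Xp_def adjoint_add adjoint_mult mult_assoc_dim intro!: carrier_matI)
qed

lemma residual:
  assumes consistent and U: "U \<in> carrier_mat n n" and W: "W \<in> hermitian_mats n"
  shows "A * Xp U W * A\<^sup>H - B = (Y0 - B) + (A * U) * (A * U)\<^sup>H"
  unfolding A_Xp_A[OF assms] using dimA U Y0D BD
  by (simp add: adjoint_mult mult_assoc_dim) (intro eq_matI; simp del: index_mult_mat(1))

lemma pos_semidef_residual:
  assumes consistent and U: "U \<in> carrier_mat n n" and W: "W \<in> hermitian_mats n"
  shows "pos_semidef (A * Xp U W * A\<^sup>H - B)"
proof -
  have AU: "A * U \<in> carrier_mat m n" using A U by simp
  show ?thesis
    unfolding residual[OF assms]
    by (rule pos_semidef_add[OF pos_semidef_Y0_diff[OF assms(1)] _ pos_semidef_gram[OF AU]])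
      (use AU Y0D BD in auto)
qed

text \<open>The difference to \<open>Y0\<close> is the Schur complement of the residual with respect to the range of \<open>E\<close>, and
  \<open>L\<close> is the congruence computing it.\<close>

lemma solution_eq_Xp:
  assumes X: "X \<in> hermitian_mats n" and psd: "pos_semidef (A * X * A\<^sup>H - B)"
  obtains U where "U \<in> carrier_mat n n" "X = Xp U X"
proof -
  note XD = hermitian_matsD[OF X]
  define M where "M = A * X * A\<^sup>H - B"
  have M: "M \<in> carrier_mat m m" "dim_row M = m" "dim_col M = m"
    using A BD XD by (auto simp: M_def)
  have EM: "E * M = - (E * B)" and ME: "M * E = - (B * E)"
    using E BD XD dimA mult_left_cong_dim[OF E(6)] by (simp_all add: M_def mat_alg)
  \<comment> \<open>\<open>D\<close> is the inverse of \<open>E M E = - C\<close> applied to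
    \<open>E M = - E B\<close>, the two signs cancelling. Thus \<open>1 - D\<close> is the
    elimination factor of the Schur complement.\<close>
  define D where "D = G * (E * B)"
  define DH where "DH = B * (E * G)"
  have D: "dim_row D = m" "dim_col D = m" "dim_row DH = m" "dim_col DH = m" "D\<^sup>H = DH"
    using Gm E BD GH by (auto simp: D_def DH_def adjoint_mult mult_assoc_dim)
  define Q where "Q = B * (E * (G * (E * B)))"
  have Q: "Q \<in> carrier_mat m m" using Gm E BD by (auto simp: Q_def)
  have MD: "M * D = - Q"
  proof -
    have "M * D = M * E * D"
      using EG M E Gm BD mult_left_cong_dim[OF EG(1)] by (simp add: D_def mult_assoc_dim)
    then show ?thesis unfolding ME using E Gm BD mult_left_cong_dim[OF E(5)]
      by (simp add: D_def Q_def mat_alg)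
  qed
  have MH: "M\<^sup>H = M" using pos_semidefD(1)[OF psd[folded M_def] M(1)] by (simp add: hermitian_mats_def)
  have QH: "Q\<^sup>H = Q" using Gm E BD GH by (simp add: Q_def adjoint_mult mult_assoc_dim)
  have "(M * D)\<^sup>H = - Q" unfolding MD by (simp add: adjoint_add QH)
  then have DM: "DH * M = - Q" using D M MH by (simp add: adjoint_mult)
  have DMD: "DH * (M * D) = - Q"
  proof -
    have "DH * Q = B * (E * (G * E)) * Q" by (simp add: DH_def EG)
    also have "B * (E * (G * E)) * Q = B * (E * (G * C * G)) * (E * B)"
      using Gm(2,3) E BD mult_left_cong_dim[OF E(5)] by (simp add: Q_def C_def mult_assoc_dim)
    also have "G * C * G = G" using Gm CD by (simp add: mult_assoc_dim)
    also have "B * (E * G) * (E * B) = Q" using Gm E BD by (simp add: Q_def mult_assoc_dim)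
    finally show ?thesis unfolding MD using D Q by (simp add: mult_uminus_dim)
  qed
  define L where "L = 1\<^sub>m m - D"
  have L: "L \<in> carrier_mat m m" unfolding L_def by (rule carrier_matI) (simp_all add: D)
  have "pos_semidef (L\<^sup>H * M * (L\<^sup>H)\<^sup>H)"
    by (rule pos_semidef_sandwich[OF psd[folded M_def] M(1) adjoint_carrier[OF L]])
  also have "L\<^sup>H * M * (L\<^sup>H)\<^sup>H = M - DH * M - (M * D - DH * (M * D))"
    using D M adjoint_adjoint[of D] by (simp add: L_def mat_alg)
  \<comment> \<open>Each of \<open>DH * M\<close>, \<open>M * D\<close> and
    \<open>DH * (M * D)\<close> equals \<open>- Q\<close>, so exactly one \<open>Q\<close> remains
    beside \<open>M\<close>; and \<open>Y0 = B - Q\<close>.\<close>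
  also have "\<dots> = A * X * A\<^sup>H - Y0"
    unfolding DM DMD unfolding MD unfolding Y0_def M_def
    using Q dimA XD BD E Gm by (intro eq_matI) (auto simp: Q_def mult_assoc_dim simp del: index_mult_mat(1))
  finally have psd': "pos_semidef (A * X * A\<^sup>H - Y0)" .
  have "pos_semidef (Ap * (A * X * A\<^sup>H - Y0) * Ap\<^sup>H)"
    by (rule pos_semidef_sandwich[OF psd' _ Ap(1)]) (use dimA XD Y0D in auto)
  moreover have "Ap * (A * X * A\<^sup>H - Y0) * Ap\<^sup>H \<in> carrier_mat n n"
    by (rule carrier_matI) (simp_all add: Ap)
  ultimately obtain U where U: "U \<in> carrier_mat n n" "Ap * (A * X * A\<^sup>H - Y0) * Ap\<^sup>H = U * U\<^sup>H"
    by (rule pos_semidef_ex_sqrt)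
  have "Ap * (A * X * A\<^sup>H - Y0) * Ap\<^sup>H = Ap * A * X * (A\<^sup>H * Ap\<^sup>H) - Ap * Y0 * Ap\<^sup>H"
    using Ap(1-5) dimA XD Y0D by (simp add: mat_alg)
  then have UU: "U * U\<^sup>H = Ap * A * X * Ap * A - X0"
    unfolding U(2) X0_eq Ap(7) using Ap dimA XD by (simp add: mult_assoc_dim)
  \<comment> \<open>Taking \<open>W = X\<close> makes the term \<open>- Ap * A * X * Ap * A\<close>
    cancel against \<open>U * U\<^sup>H\<close>, and the two copies of \<open>X0\<close>
    cancel.\<close>
  have "X = Xp U X"
    unfolding Xp_def UU using Ap dimA XD X0D by (intro eq_matI) (auto simp del: index_mult_mat(1))
  then show ?thesis using that U(1) by blast
qed

lemma consistent_iff_solvable: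
  "(\<exists>X \<in> hermitian_mats n. pos_semidef (A * X * A\<^sup>H - B)) \<longleftrightarrow> consistent"
proof
  assume consistent
  moreover have "0\<^sub>m n n \<in> hermitian_mats n" by (simp add: hermitian_mats_def)
  ultimately show "\<exists>X \<in> hermitian_mats n. pos_semidef (A * X * A\<^sup>H - B)"
    using pos_semidef_residual Xp_hermitian zero_carrier_mat by blast
qed (use consistent_if_solvable in blast)

lemma solution_set:
  assumes consistent
  shows "{X \<in> hermitian_mats n. pos_semidef (A * X * A\<^sup>H - B)} =
    {Xp U W | U W. U \<in> carrier_mat n n \<and> W \<in> hermitian_mats n}"
proof (intro equalityI subsetI)
  fix X assume "X \<in> {X \<in> hermitian_mats n. pos_semidef (A * X * A\<^sup>H - B)}"
  then have X: "X \<in> hermitian_mats n" "pos_semidef (A * X * A\<^sup>H - B)" by auto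
  then obtain U where "U \<in> carrier_mat n n" "X = Xp U X" by (rule solution_eq_Xp)
  then show "X \<in> {Xp U W | U W. U \<in> carrier_mat n n \<and> W \<in> hermitian_mats n}"
    using X(1) by blast
next
  fix X assume "X \<in> {Xp U W | U W. U \<in> carrier_mat n n \<and> W \<in> hermitian_mats n}"
  then show "X \<in> {X \<in> hermitian_mats n. pos_semidef (A * X * A\<^sup>H - B)}"
    using pos_semidef_residual[OF assms] Xp_hermitian by auto
qed

text \<open>\<open>C\<close> is \<open>E * B\<close> multiplied by \<open>E\<close> on the right, so
  the criterion for comparing the column spaces of a product and its left factor applies.\<close>

lemma consistent_iff_column_space:
  "consistent \<longleftrightarrow> pos_semidef (- C) \<and> column_space C = column_space (E * B)"
  using column_space_mult_eq_iff[of "E * B" m m E m] E BD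
  by (simp add: consistent_def C_def G_def mult_assoc_dim)

lemma consistent_iff_inertia:
  "consistent \<longleftrightarrow> pos_inertia C = 0 \<and> neg_inertia C = rk (E * B)"
proof -
  have "consistent \<longleftrightarrow> pos_inertia C = 0 \<and> rk C = rk (E * B)"
    using rk_mult_eq_iff[of "E * B" m m E m] E BD pos_inertia_eq_0_iff[OF C]
    by (simp add: consistent_def C_def G_def mult_assoc_dim)
  then show ?thesis using pos_plus_neg_inertia[OF C] by auto
qed

section \<open>The strict inequality\<close>

text \<open>The residual is the sum of the positive semidefinite matrices \<open>Y0 - B\<close> and
  \<open>(A * U) * (A * U)\<^sup>H\<close>. The kernel of the first is that of
  \<open>E * B = (B * E)\<^sup>H\<close>, so the residual has the kernel of the adjoint row
  block.\<close>

lemma pos_def_residual_iff: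
  assumes consistent and U: "U \<in> carrier_mat n n" and W: "W \<in> hermitian_mats n"
  shows "pos_def (A * Xp U W * A\<^sup>H - B) \<longleftrightarrow> rk (row_block (B * E) (A * U)) = m"
proof -
  define R where "R = A * Xp U W * A\<^sup>H - B"
  have AU: "A * U \<in> carrier_mat m n" using A U by simp
  have BE: "B * E \<in> carrier_mat m m" using E BD by simp
  have R: "R \<in> carrier_mat m m" unfolding R_def by (rule minus_carrier_mat[OF BD(1)])
  have CGEB: "C * (G * (E * B)) = E * B"
    using assms E BD Gm CD by (simp add: consistent_def mult_assoc_dim)
  have Y0B: "Y0 - B \<in> carrier_mat m m" using Y0D BD by auto
  have ker: "R *\<^sub>v x = 0\<^sub>v m \<longleftrightarrow> (row_block (B * E) (A * U))\<^sup>H *\<^sub>v x = 0\<^sub>v (m + n)"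
    if x: "x \<in> carrier_vec m" for x
  proof -
    have diff: "(Y0 - B) *\<^sub>v x = - (B * E * (G * (E * B)) *\<^sub>v x)"
    proof -
      have "Y0 - B = - (B * E * (G * (E * B)))"
        using Gm E BD by (simp add: mat_alg Y0_def) (intro eq_matI; simp del: index_mult_mat(1))
      then show ?thesis using x Gm E BD by (simp del: assoc_mult_mat_vec assoc_mult_mat)
    qed
    have "(Y0 - B) *\<^sub>v x = 0\<^sub>v m \<longleftrightarrow> E * B *\<^sub>v x = 0\<^sub>v m"
    proof
      assume "(Y0 - B) *\<^sub>v x = 0\<^sub>v m"
      then have "E *\<^sub>v ((Y0 - B) *\<^sub>v x) = 0\<^sub>v m" using E by (simp add: mult_zero_vec)
      \<comment> \<open>Here consistency enters: it makes \<open>E * Y0\<close> vanish, so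
        \<open>E * B\<close> can be recovered from \<open>Y0 - B\<close>.\<close>
      moreover have "E * (Y0 - B) = - (E * B)"
      proof -
        have "E * (Y0 - B) = E * B - C * (G * (E * B)) - E * B"
          using E BD Gm by (simp add: Y0_def C_def mat_alg)
        then show ?thesis using E BD by (simp add: CGEB add_zero_dim)
      qed
      ultimately have "- (E * B) *\<^sub>v x = 0\<^sub>v m"
        using E(2,3) Y0D BD x by (metis Y0B E(1) assoc_mult_mat_vec)
      moreover have "- (E * B) *\<^sub>v x = - (E * B *\<^sub>v x)"
        using E BD x by (intro eq_vecI) auto
      ultimately show "E * B *\<^sub>v x = 0\<^sub>v m"
        using E BD by (metis uminus_uminus_vec uminus_zero_vec)
    next
      assume "E * B *\<^sub>v x = 0\<^sub>v m"
      then have "B * E * (G * (E * B)) *\<^sub>v x = 0\<^sub>v m"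
        using E BD Gm x by (simp add: mult_vec_dim mult_zero_vec)
      then show "(Y0 - B) *\<^sub>v x = 0\<^sub>v m" using diff by simp
    qed
    then show ?thesis
      unfolding R_def residual[OF assms]
      using psd_sum_kernel[OF pos_semidef_Y0_diff[OF assms(1)] Y0B pos_semidef_gram[OF AU] _ x]
        gram_kernel[OF AU x] row_block_kernel[OF BE AU x] AU E BD
      by (simp add: adjoint_mult)
  qed
  show ?thesis
    using ker pos_def_iff[OF R] pos_semidef_residual[OF assms] rk_full_iff[OF row_block_carrier[OF BE AU]]
    unfolding R_def by blast
qed

lemma strict_solution_set:
  assumes consistent
  shows "{X \<in> hermitian_mats n. pos_def (A * X * A\<^sup>H - B)} =
    {Xp U W | U W. U \<in> carrier_mat n n \<and> rk (row_block (B * E) (A * U)) = m \<and> W \<in> hermitian_mats n}"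
proof (intro equalityI subsetI)
  fix X assume "X \<in> {X \<in> hermitian_mats n. pos_def (A * X * A\<^sup>H - B)}"
  then have X: "X \<in> hermitian_mats n" "pos_def (A * X * A\<^sup>H - B)" by auto
  have "A * X * A\<^sup>H - B \<in> carrier_mat m m" by (rule minus_carrier_mat[OF BD(1)])
  then have "pos_semidef (A * X * A\<^sup>H - B)" using X(2) pos_def_iff by blast
  then obtain U where U: "U \<in> carrier_mat n n" "X = Xp U X" by (rule solution_eq_Xp[OF X(1)])
  have "rk (row_block (B * E) (A * U)) = m"
    using pos_def_residual_iff[OF assms U(1) X(1)] X(2) unfolding U(2)[symmetric] by blast
  then show "X \<in> {Xp U W | U W. U \<in> carrier_mat n n \<and> rk (row_block (B * E) (A * U)) = m \<and> W \<in> hermitian_mats n}"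
    using U X(1) by blast
next
  fix X assume "X \<in> {Xp U W | U W. U \<in> carrier_mat n n \<and> rk (row_block (B * E) (A * U)) = m \<and> W \<in> hermitian_mats n}"
  then show "X \<in> {X \<in> hermitian_mats n. pos_def (A * X * A\<^sup>H - B)}"
    using pos_def_residual_iff[OF assms] Xp_hermitian by auto
qed

text \<open>\<open>C\<close> is a right multiple of \<open>E\<close>, so equal ranks give
  \<open>C * G = E\<close>, and \<open>E * B\<close> is fixed a fortiori. For \<open>U = 1\<close>,
  a vector killed by the adjoint row block satisfies \<open>E x = x\<close> and
  \<open>E B x = 0\<close>, hence \<open>C x = 0\<close>, and \<open>G * C = E\<close> gives
  \<open>x = 0\<close>.\<close>

lemma strictly_consistentD:
  assumes "pos_semidef (- C)" "rk C = rk E"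
  shows consistent "rk (row_block (B * E) (A * 1\<^sub>m n)) = m"
proof -
  have "E * (B * E) = C" using E BD by (simp add: C_def mult_assoc_dim)
  then have CGE: "C * G * E = E"
    using rk_mult_eq_iff[of E m m "B * E" m] assms(2) E BD by (simp add: G_def)
  then have CG: "C * G = E" using CD Gm E EG by (simp add: mult_assoc_dim)
  then show consistent
    using assms(1) E BD mult_left_cong_dim[OF E(5)] by (simp add: consistent_def)
  have BE: "B * E \<in> carrier_mat m m" and A1: "A * 1\<^sub>m n \<in> carrier_mat m n" using E BD A by auto
  have "(C * G)\<^sup>H = E" using CG E by simp
  then have GC: "G * C = E" using CD Gm GH by (simp add: adjoint_mult)
  have "x = 0\<^sub>v m" if x: "x \<in> carrier_vec m" "(row_block (B * E) (A * 1\<^sub>m n))\<^sup>H *\<^sub>v x = 0\<^sub>v (m + n)" for x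
  proof -
    have "(B * E)\<^sup>H *\<^sub>v x = 0\<^sub>v m" "A\<^sup>H *\<^sub>v x = 0\<^sub>v n"
      using row_block_kernel[OF BE A1 x(1)] x(2) A by auto
    then have EBx: "E *\<^sub>v (B *\<^sub>v x) = 0\<^sub>v m" and Ex: "E *\<^sub>v x = x"
      using E BD x E_proj_fix[OF A x(1)] by (auto simp: adjoint_mult mult_vec_dim E_def)
    have "C *\<^sub>v x = 0\<^sub>v m"
      using E BD x EBx Ex by (simp add: C_def mult_vec_dim)
    then have "G * C *\<^sub>v x = 0\<^sub>v m" using Gm CD x by (simp add: mult_vec_dim mult_zero_vec)
    then show ?thesis using GC Ex by simp
  qed
  then show "rk (row_block (B * E) (A * 1\<^sub>m n)) = m"
    using rk_full_iff[OF row_block_carrier[OF BE A1]] by blast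
qed

text \<open>For positive definite \<open>M\<close>, \<open>C x = 0\<close> makes the form of
  \<open>M\<close> vanish at \<open>E x\<close>, so \<open>E x = 0\<close>; this compares the
  kernels of \<open>C\<close> and \<open>E\<close>. Conversely \<open>U = 1\<close> supplies a
  strict solution.\<close>

lemma strictly_solvable_iff:
  "(\<exists>X \<in> hermitian_mats n. pos_def (A * X * A\<^sup>H - B)) \<longleftrightarrow> pos_semidef (- C) \<and> rk C = rk E"
proof
  assume "\<exists>X \<in> hermitian_mats n. pos_def (A * X * A\<^sup>H - B)"
  then obtain X where X: "X \<in> hermitian_mats n" "pos_def (A * X * A\<^sup>H - B)" by blast
  note XD = hermitian_matsD[OF X(1)]
  define M where "M = A * X * A\<^sup>H - B"
  have M: "M \<in> carrier_mat m m" "dim_row M = m" "dim_col M = m"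
    using A BD XD by (auto simp: M_def)
  have psd: "pos_semidef M" and pd: "\<And>x. x \<in> carrier_vec m \<Longrightarrow> M *\<^sub>v x = 0\<^sub>v m \<Longrightarrow> x = 0\<^sub>v m"
    using X(2) pos_def_iff[OF M(1)] by (auto simp: M_def)
  have con: consistent using consistent_if_solvable[OF X(1)] psd by (simp add: M_def)
  have EM: "E * M = - (E * B)"
    using E BD XD dimA mult_left_cong_dim[OF E(6)] by (simp add: M_def mat_alg)
  have EME: "E * (M * E) = - C"
    using mult_left_cong_dim[OF EM, of E] E BD M by (simp add: mult_uminus_dim C_def)
  have "rk E \<le> rk C"
  proof (rule rk_le_kernel[OF CD(1) E(1)])
    fix x :: "complex vec" assume x: "x \<in> carrier_vec m" "C *\<^sub>v x = 0\<^sub>v m"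
    have Ex: "E *\<^sub>v x \<in> carrier_vec m" using E x by (metis mult_mat_vec_carrier)
    have MEx: "M *\<^sub>v (E *\<^sub>v x) \<in> carrier_vec m" using mult_mat_vec_carrier[OF M(1) Ex] .
    have "(- C) *\<^sub>v x = - (C *\<^sub>v x)" using CD x by (intro eq_vecI) auto
    then have "E * (M * E) *\<^sub>v x = 0\<^sub>v m" unfolding EME x(2) by simp
    then have "E *\<^sub>v (M *\<^sub>v (E *\<^sub>v x)) = 0\<^sub>v m" using E M x by (simp add: mult_vec_dim)
    then have "(M *\<^sub>v (E *\<^sub>v x)) \<bullet>c (E *\<^sub>v x) = 0"
      using adjoint_scalar_prod[of "M *\<^sub>v (E *\<^sub>v x)" E x] MEx E x by simp
    then have "M *\<^sub>v (E *\<^sub>v x) = 0\<^sub>v m" by (rule pos_semidef_kernel_vec[OF psd M(1) Ex])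
    then show "E *\<^sub>v x = 0\<^sub>v m" by (rule pd[OF Ex])
  qed
  moreover have "rk C \<le> rk E"
    using rk_mult_le_right[of "E * B" m m E m] E BD by (simp add: C_def)
  ultimately show "pos_semidef (- C) \<and> rk C = rk E" using con by (simp add: consistent_def)
next
  assume *: "pos_semidef (- C) \<and> rk C = rk E"
  moreover have "0\<^sub>m n n \<in> hermitian_mats n" by (simp add: hermitian_mats_def)
  ultimately show "\<exists>X \<in> hermitian_mats n. pos_def (A * X * A\<^sup>H - B)"
    using pos_def_residual_iff strictly_consistentD Xp_hermitian one_carrier_mat by blast
qed

end

subsection \<open>Both directions of the ordering\<close>

lemma column_space_uminus: "column_space (- M) = column_space M"
proof -
  have le: "column_space (- K) \<subseteq> column_space K" for K
  proof -
    have "K * (- 1\<^sub>m (dim_col K)) = - K" by (simp add: mult_uminus_dim)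
    then show ?thesis
      using column_space_mono[of K "dim_row K" "dim_col K" "- 1\<^sub>m (dim_col K)" "dim_col K"] by simp
  qed
  show ?thesis using le[of M] le[of "- M"] by (simp add: add_zero_dim)
qed

text \<open>The sign disappears in the Gram matrix.\<close>

lemma rk_row_block_uminus:
  assumes P: "P \<in> carrier_mat m k" and Q: "Q \<in> carrier_mat m l"
  shows "rk (row_block (- P) Q) = rk (row_block P Q)"
proof -
  have P': "- P \<in> carrier_mat m k" using P by simp
  have "row_block (- P) Q * (row_block (- P) Q)\<^sup>H = row_block P Q * (row_block P Q)\<^sup>H"
    unfolding row_block_gram[OF P' Q] row_block_gram[OF P Q]
    using P by (simp add: mat_alg)
  then show ?thesis
    using rk_gram[OF row_block_carrier[OF P' Q]] rk_gram[OF row_block_carrier[OF P Q]]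
      row_block_carrier[OF P' Q] row_block_carrier[OF P Q] by simp
qed

lemma loewner_ge_iff:
  assumes "P \<in> hermitian_mats k" "Q \<in> hermitian_mats k"
  shows "P \<succeq>\<^sub>L Q \<longleftrightarrow> pos_semidef (P - Q)" and "P \<succ>\<^sub>L Q \<longleftrightarrow> pos_def (P - Q)"
  using assms unfolding loewner_ge_def loewner_gt_def by blast+

lemma hermitian_sandwich:
  assumes "A \<in> carrier_mat m n" "X \<in> hermitian_mats n"
  shows "A * X * A\<^sup>H \<in> hermitian_mats m"
  using assms(1) hermitian_matsD[OF assms(2)]
  by (auto simp: hermitian_mats_def mat_alg intro!: carrier_matI)

lemma hermitian_uminus_iff: "- X \<in> hermitian_mats n \<longleftrightarrow> X \<in> hermitian_mats n"
  using hermitian_uminus[of X n] hermitian_uminus[of "- X" n] by (auto simp: add_zero_dim)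

lemma Collect_uminus:
  fixes Q :: "complex mat \<Rightarrow> bool"
  assumes "{X \<in> hermitian_mats n. Q X} = R"
  shows "{X \<in> hermitian_mats n. Q (- X)} = uminus ` R"
proof -
  have "X \<in> uminus ` R \<longleftrightarrow> - X \<in> R" for X
    by (metis add_zero_dim(6) imageE image_eqI)
  then show ?thesis using assms hermitian_uminus_iff by blast
qed

section \<open>Reduction of the reversed inequalities to the problem for \<open>- B\<close>\<close>

context loewner_problem
begin

definition "Xm U W = X0 - U * U\<^sup>H + W - Ap * A * W * Ap * A"

interpretation neg: loewner_problem A "- B" m n
  by unfold_locales (rule A, rule hermitian_uminus[OF B])

lemma neg_simps: "neg.C = - C" "neg.G = - G"
proof -
  show C: "neg.C = - C" using E BD by (simp add: neg.C_def C_def mat_alg)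
  show "neg.G = - G" by (simp add: neg.G_def G_def C mp_inverse_uminus)
qed

lemma neg_Y0: "neg.Y0 = - Y0"
  unfolding neg.Y0_def Y0_def neg_simps using E BD Gm
  by (simp add: mat_alg) (intro eq_matI; simp del: index_mult_mat(1))

lemma neg_X0: "neg.X0 = - X0"
  unfolding neg.X0_eq X0_eq neg_simps neg_Y0 using Ap Y0D by (simp add: mult_uminus_dim)

text \<open>\<open>E\<close> and \<open>Ap\<close> depend on \<open>A\<close> alone, while
  \<open>X0\<close> changes sign with \<open>B\<close>. Negating the whole solution also flips the
  free Hermitian term, hence \<open>- W\<close>; the Gram term keeps \<open>U\<close> and acquires
  its minus sign in \<open>Xm\<close>.\<close>

lemma neg_Xp:
  assumes "U \<in> carrier_mat n n" "W \<in> hermitian_mats n"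
  shows "neg.Xp U (- W) = - Xm U W"
proof -
  note WD = hermitian_matsD[OF assms(2)]
  have "Ap * A * (- W) * Ap * A = - (Ap * A * W * Ap * A)"
    using Ap dimA WD by (simp add: mult_uminus_dim mult_assoc_dim)
  then show ?thesis
    unfolding neg.Xp_def Xm_def neg_simps neg_X0 using assms(1) WD X0D dimA Ap
    by (simp only:) (intro eq_matI; simp del: index_mult_mat(1))
qed

lemma neg_Xp_image:
  "uminus ` {neg.Xp U W | U W. U \<in> carrier_mat n n \<and> Q U \<and> W \<in> hermitian_mats n} =
    {Xm U W | U W. U \<in> carrier_mat n n \<and> Q U \<and> W \<in> hermitian_mats n}" (is "?L = ?R")
proof (intro equalityI subsetI)
  fix X assume "X \<in> ?L"
  then obtain U W where UW: "U \<in> carrier_mat n n" "Q U" "W \<in> hermitian_mats n" "X = - neg.Xp U W"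
    by blast
  have "X = Xm U (- W)"
    using neg_Xp[of U "- W"] UW hermitian_uminus[of W n] by (simp add: add_zero_dim)
  then show "X \<in> ?R" using UW hermitian_uminus by blast
next
  fix X assume "X \<in> ?R"
  then obtain U W where UW: "U \<in> carrier_mat n n" "Q U" "W \<in> hermitian_mats n" "X = Xm U W"
    by blast
  then have "X = - neg.Xp U (- W)" by (simp add: neg_Xp add_zero_dim)
  then show "X \<in> ?L" using UW hermitian_uminus by blast
qed

lemma loewner_upper:
  assumes "X \<in> hermitian_mats n"
  shows "A * X * A\<^sup>H \<succeq>\<^sub>L B \<longleftrightarrow> pos_semidef (A * X * A\<^sup>H - B)"
    and "A * X * A\<^sup>H \<succ>\<^sub>L B \<longleftrightarrow> pos_def (A * X * A\<^sup>H - B)"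
  by (rule loewner_ge_iff[OF hermitian_sandwich[OF A assms] B])+

lemma loewner_lower:
  assumes "X \<in> hermitian_mats n"
  shows "A * X * A\<^sup>H \<preceq>\<^sub>L B \<longleftrightarrow> pos_semidef (A * (- X) * A\<^sup>H - (- B))"
    and "A * X * A\<^sup>H \<prec>\<^sub>L B \<longleftrightarrow> pos_def (A * (- X) * A\<^sup>H - (- B))"
proof -
  note XD = hermitian_matsD[OF assms]
  have "B - A * X * A\<^sup>H = A * (- X) * A\<^sup>H - (- B)"
    using XD dimA BD by (simp add: mult_uminus_dim) (intro eq_matI; simp del: index_mult_mat(1))
  then show "A * X * A\<^sup>H \<preceq>\<^sub>L B \<longleftrightarrow> pos_semidef (A * (- X) * A\<^sup>H - (- B))"
    and "A * X * A\<^sup>H \<prec>\<^sub>L B \<longleftrightarrow> pos_def (A * (- X) * A\<^sup>H - (- B))"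
    using loewner_ge_iff[OF B hermitian_sandwich[OF A assms]] by simp_all
qed

lemma C_loewner_zero:
  "C \<preceq>\<^sub>L 0\<^sub>m m m \<longleftrightarrow> pos_semidef (- C)" "C \<succeq>\<^sub>L 0\<^sub>m m m \<longleftrightarrow> pos_semidef C"
proof -
  have Z: "0\<^sub>m m m \<in> hermitian_mats m" by (simp add: hermitian_mats_def)
  show "C \<preceq>\<^sub>L 0\<^sub>m m m \<longleftrightarrow> pos_semidef (- C)" "C \<succeq>\<^sub>L 0\<^sub>m m m \<longleftrightarrow> pos_semidef C"
    using loewner_ge_iff(1)[OF Z C] loewner_ge_iff(1)[OF C Z] CD by (simp_all add: add_zero_dim)
qed

lemma Bex_uminus: "(\<exists>X \<in> hermitian_mats n. Q (- X)) \<longleftrightarrow> (\<exists>X \<in> hermitian_mats n. Q X)"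
  using hermitian_uminus add_zero_dim(6) by metis

lemma solvable_upper:
  "(\<exists>X \<in> hermitian_mats n. A * X * A\<^sup>H \<succeq>\<^sub>L B) \<longleftrightarrow> consistent"
  "(\<exists>X \<in> hermitian_mats n. A * X * A\<^sup>H \<succ>\<^sub>L B) \<longleftrightarrow> pos_semidef (- C) \<and> rk C = rk E"
  using consistent_iff_solvable strictly_solvable_iff loewner_upper by auto

lemma solvable_lower:
  "(\<exists>X \<in> hermitian_mats n. A * X * A\<^sup>H \<preceq>\<^sub>L B) \<longleftrightarrow> neg.consistent"
  "(\<exists>X \<in> hermitian_mats n. A * X * A\<^sup>H \<prec>\<^sub>L B) \<longleftrightarrow> pos_semidef C \<and> rk C = rk E"
proof -
  have "(\<exists>X \<in> hermitian_mats n. A * X * A\<^sup>H \<preceq>\<^sub>L B) \<longleftrightarrow>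
      (\<exists>X \<in> hermitian_mats n. pos_semidef (A * (- X) * A\<^sup>H - (- B)))"
    using loewner_lower(1) by blast
  also have "\<dots> \<longleftrightarrow> (\<exists>X \<in> hermitian_mats n. pos_semidef (A * X * A\<^sup>H - (- B)))"
    by (rule Bex_uminus)
  also have "\<dots> \<longleftrightarrow> neg.consistent" by (rule neg.consistent_iff_solvable)
  finally show "(\<exists>X \<in> hermitian_mats n. A * X * A\<^sup>H \<preceq>\<^sub>L B) \<longleftrightarrow> neg.consistent" .
  have "(\<exists>X \<in> hermitian_mats n. A * X * A\<^sup>H \<prec>\<^sub>L B) \<longleftrightarrow>
      (\<exists>X \<in> hermitian_mats n. pos_def (A * (- X) * A\<^sup>H - (- B)))"
    using loewner_lower(2) by blast
  also have "\<dots> \<longleftrightarrow> (\<exists>X \<in> hermitian_mats n. pos_def (A * X * A\<^sup>H - (- B)))"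
    by (rule Bex_uminus)
  also have "\<dots> \<longleftrightarrow> pos_semidef (- neg.C) \<and> rk neg.C = rk E"
    by (rule neg.strictly_solvable_iff)
  also have "\<dots> \<longleftrightarrow> pos_semidef C \<and> rk C = rk E"
    unfolding neg_simps rk_uminus by (simp add: add_zero_dim)
  finally show "(\<exists>X \<in> hermitian_mats n. A * X * A\<^sup>H \<prec>\<^sub>L B) \<longleftrightarrow> pos_semidef C \<and> rk C = rk E" .
qed

lemma neg_consistent_iff_column_space:
  "neg.consistent \<longleftrightarrow> pos_semidef C \<and> column_space C = column_space (E * B)"
proof -
  have "E * (- B) = - (E * B)" using E BD by (simp add: mult_uminus_dim)
  then show ?thesis
    unfolding neg.consistent_iff_column_space neg_simps
    by (simp only: column_space_uminus add_zero_dim)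
qed

lemma consistent_iff_block_inertia:
  fixes N
  defines "N \<equiv> four_block_mat B A (A\<^sup>H) (0\<^sub>m n n)"
  shows "consistent \<longleftrightarrow> pos_inertia N = rk A \<and> neg_inertia N = rk (row_block A B)"
    and "neg.consistent \<longleftrightarrow> pos_inertia N = rk (row_block A B) \<and> neg_inertia N = rk A"
proof -
  have N: "pos_inertia N = rk A + pos_inertia C" "neg_inertia N = rk A + neg_inertia C"
    unfolding N_def C_def E_def by (rule inertia_block[OF A B])+
  have rb: "rk (row_block A B) = rk A + rk (E * B)"
    unfolding E_def by (rule rk_row_block[OF A BD(1)])
  show "consistent \<longleftrightarrow> pos_inertia N = rk A \<and> neg_inertia N = rk (row_block A B)"
    unfolding consistent_iff_inertia N rb by auto
  have "E * (- B) = - (E * B)" using E BD by (simp add: mult_uminus_dim)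
  then have "neg.consistent \<longleftrightarrow> neg_inertia C = 0 \<and> pos_inertia C = rk (E * B)"
    unfolding neg.consistent_iff_inertia neg_simps inertia_uminus[OF C] by (simp only: rk_uminus)
  then show "neg.consistent \<longleftrightarrow> pos_inertia N = rk (row_block A B) \<and> neg_inertia N = rk A"
    unfolding N rb by auto
qed

lemma solution_set_upper:
  assumes consistent
  shows "{X \<in> hermitian_mats n. A * X * A\<^sup>H \<succeq>\<^sub>L B} =
      {Xp U W | U W. U \<in> carrier_mat n n \<and> W \<in> hermitian_mats n}"
    and "{X \<in> hermitian_mats n. A * X * A\<^sup>H \<succ>\<^sub>L B} =
      {Xp U W | U W. U \<in> carrier_mat n n \<and> rk (row_block (B * E) (A * U)) = m \<and> W \<in> hermitian_mats n}"
  unfolding solution_set[OF assms, symmetric] strict_solution_set[OF assms, symmetric]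
  using loewner_upper by blast+

lemma solution_set_lower:
  assumes neg.consistent
  shows "{X \<in> hermitian_mats n. A * X * A\<^sup>H \<preceq>\<^sub>L B} =
      {Xm U W | U W. U \<in> carrier_mat n n \<and> W \<in> hermitian_mats n}"
    and "{X \<in> hermitian_mats n. A * X * A\<^sup>H \<prec>\<^sub>L B} =
      {Xm U W | U W. U \<in> carrier_mat n n \<and> rk (row_block (B * E) (A * U)) = m \<and> W \<in> hermitian_mats n}"
proof -
  have rk: "rk (row_block (- B * E) (A * U)) = rk (row_block (B * E) (A * U))"
    if "U \<in> carrier_mat n n" for U
    using rk_row_block_uminus[of "B * E" m m "A * U" n] E BD A that
    by (simp add: neg_simps mult_uminus_dim)
  have "{X \<in> hermitian_mats n. A * X * A\<^sup>H \<preceq>\<^sub>L B} =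
      {X \<in> hermitian_mats n. pos_semidef (A * (- X) * A\<^sup>H - (- B))}"
    using loewner_lower(1) by blast
  then show "{X \<in> hermitian_mats n. A * X * A\<^sup>H \<preceq>\<^sub>L B} =
      {Xm U W | U W. U \<in> carrier_mat n n \<and> W \<in> hermitian_mats n}"
    using Collect_uminus[OF neg.solution_set[OF assms]] neg_Xp_image[of "\<lambda>_. True"] by simp
  have "{X \<in> hermitian_mats n. A * X * A\<^sup>H \<prec>\<^sub>L B} =
      {X \<in> hermitian_mats n. pos_def (A * (- X) * A\<^sup>H - (- B))}"
    using loewner_lower(2) by blast
  also have "\<dots> = {Xm U W | U W. U \<in> carrier_mat n n \<and>
      rk (row_block (- B * E) (A * U)) = m \<and> W \<in> hermitian_mats n}"
    using Collect_uminus[OF neg.strict_solution_set[OF assms]]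
      neg_Xp_image[of "\<lambda>U. rk (row_block (- B * E) (A * U)) = m"] by simp
  also have "\<dots> = {Xm U W | U W. U \<in> carrier_mat n n \<and>
      rk (row_block (B * E) (A * U)) = m \<and> W \<in> hermitian_mats n}"
    using rk by (metis (no_types, lifting))
  finally show "{X \<in> hermitian_mats n. A * X * A\<^sup>H \<prec>\<^sub>L B} = \<dots>" .
qed

lemma A_Xm_A:
  assumes neg.consistent and U: "U \<in> carrier_mat n n" and W: "W \<in> hermitian_mats n"
  shows "A * Xm U W * A\<^sup>H = Y0 - A * U * U\<^sup>H * A\<^sup>H"
proof -
  have "Xm U W = - neg.Xp U (- W)" using neg_Xp[OF U W] by (simp add: add_zero_dim)
  moreover have "neg.Xp U (- W) \<in> hermitian_mats n"
    by (rule neg.Xp_hermitian[OF U hermitian_uminus[OF W]])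
  ultimately have "A * Xm U W * A\<^sup>H = - (A * neg.Xp U (- W) * A\<^sup>H)"
    using dimA hermitian_matsD[of "neg.Xp U (- W)" n] by (simp add: mult_uminus_dim)
  also have "\<dots> = - (- Y0 + A * U * U\<^sup>H * A\<^sup>H)"
    unfolding neg.A_Xp_A[OF assms(1) U hermitian_uminus[OF W]] neg_Y0 ..
  also have "\<dots> = Y0 - A * U * U\<^sup>H * A\<^sup>H"
    using dimA U Y0D by (intro eq_matI) (simp_all del: index_mult_mat(1))
  finally show ?thesis .
qed

lemma strictly_consistent_neg:
  assumes "pos_semidef C" "rk C = rk E"
  shows neg.consistent "rk (row_block (B * E) (A * 1\<^sub>m n)) = m"
proof -
  have "pos_semidef (- neg.C)" "rk neg.C = rk E"
    unfolding neg_simps rk_uminus using assms by (simp_all add: add_zero_dim)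
  note neg = neg.strictly_consistentD[OF this]
  show neg.consistent by (rule neg(1))
  show "rk (row_block (B * E) (A * 1\<^sub>m n)) = m"
    using neg(2) rk_row_block_uminus[of "B * E" m m "A * 1\<^sub>m n" n] E BD A
    by (simp add: neg_simps mult_uminus_dim)
qed

end

text \<open>The formal (c) has \<open>neg_inertia N = rk A\<close> and the formal (d) has
  \<open>E * B * E \<succeq>\<^sub>L 0\<close>, where the English text has r(B) and the reversed
  order. For \<open>m = n = 1\<close>, \<open>A = 0\<close>, \<open>B = 1\<close> every
  \<open>X\<close> solves both inequalities, yet the negative inertia of \<open>N\<close> is 0 while
  r(B) is 1, and \<open>E * B * E = 1\<close> is not negative semidefinite. The remark "say, U = I"
  becomes the last conjunct of (b) and of (d).\<close>

theorem theorem4p1: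
  fixes A B :: "complex mat" and m n :: nat
  assumes A: "A \<in> carrier_mat m n"
    and B: "B \<in> hermitian_mats m"
  shows
    "let As = mat_adjoint A;
         Ap = mp_inverse A;
         Aps = mat_adjoint (mp_inverse A);
         E = E_proj A;
         N = four_block_mat B A As (0\<^sub>m n n);
         X\<^sub>0 = Ap * B * Aps - Ap * B * E * mp_inverse (E * B * E) * E * B * Aps;
         Y\<^sub>0 = B - B * E * mp_inverse (E * B * E) * E * B;
         Xp = (\<lambda>U W. X\<^sub>0 + U * mat_adjoint U + W - Ap * A * W * Ap * A);
         Xm = (\<lambda>U W. X\<^sub>0 - U * mat_adjoint U + W - Ap * A * W * Ap * A)
     in
       \<comment> \<open>(a)\<close>
       ((\<exists>X \<in> hermitian_mats n. A * X * As \<succeq>\<^sub>L B) \<longleftrightarrow>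
          (E * B * E \<preceq>\<^sub>L 0\<^sub>m m m \<and> column_space (E * B * E) = column_space (E * B))) \<and>
       ((\<exists>X \<in> hermitian_mats n. A * X * As \<succeq>\<^sub>L B) \<longleftrightarrow>
          (pos_inertia N = rk A \<and> neg_inertia N = rk (row_block A B))) \<and>
       ((\<exists>X \<in> hermitian_mats n. A * X * As \<succeq>\<^sub>L B) \<longrightarrow>
          {X \<in> hermitian_mats n. A * X * As \<succeq>\<^sub>L B} =
            {Xp U W | U W. U \<in> carrier_mat n n \<and> W \<in> hermitian_mats n} \<and>
          (\<forall>U \<in> carrier_mat n n. \<forall>W \<in> hermitian_mats n.
             A * Xp U W * As = Y\<^sub>0 + A * U * mat_adjoint U * As)) \<and>
       \<comment> \<open>(b)\<close>
       ((\<exists>X \<in> hermitian_mats n. A * X * As \<succ>\<^sub>L B) \<longleftrightarrow>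
          (E * B * E \<preceq>\<^sub>L 0\<^sub>m m m \<and> rk (E * B * E) = rk E)) \<and>
       ((\<exists>X \<in> hermitian_mats n. A * X * As \<succ>\<^sub>L B) \<longrightarrow>
          {X \<in> hermitian_mats n. A * X * As \<succ>\<^sub>L B} =
            {Xp U W | U W. U \<in> carrier_mat n n \<and> rk (row_block (B * E) (A * U)) = m
                         \<and> W \<in> hermitian_mats n} \<and>
          rk (row_block (B * E) (A * 1\<^sub>m n)) = m) \<and>
       \<comment> \<open>(c)\<close>
       ((\<exists>X \<in> hermitian_mats n. A * X * As \<preceq>\<^sub>L B) \<longleftrightarrow>
          (E * B * E \<succeq>\<^sub>L 0\<^sub>m m m \<and> column_space (E * B * E) = column_space (E * B))) \<and>
       ((\<exists>X \<in> hermitian_mats n. A * X * As \<preceq>\<^sub>L B) \<longleftrightarrow>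
          (pos_inertia N = rk (row_block A B) \<and> neg_inertia N = rk A)) \<and>
       ((\<exists>X \<in> hermitian_mats n. A * X * As \<preceq>\<^sub>L B) \<longrightarrow>
          {X \<in> hermitian_mats n. A * X * As \<preceq>\<^sub>L B} =
            {Xm U W | U W. U \<in> carrier_mat n n \<and> W \<in> hermitian_mats n} \<and>
          (\<forall>U \<in> carrier_mat n n. \<forall>W \<in> hermitian_mats n.
             A * Xm U W * As = Y\<^sub>0 - A * U * mat_adjoint U * As)) \<and>
       \<comment> \<open>(d)\<close>
       ((\<exists>X \<in> hermitian_mats n. A * X * As \<prec>\<^sub>L B) \<longleftrightarrow>
          (E * B * E \<succeq>\<^sub>L 0\<^sub>m m m \<and> rk (E * B * E) = rk E)) \<and>
       ((\<exists>X \<in> hermitian_mats n. A * X * As \<prec>\<^sub>L B) \<longrightarrow>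
          {X \<in> hermitian_mats n. A * X * As \<prec>\<^sub>L B} =
            {Xm U W | U W. U \<in> carrier_mat n n \<and> rk (row_block (B * E) (A * U)) = m
                         \<and> W \<in> hermitian_mats n} \<and>
          rk (row_block (B * E) (A * 1\<^sub>m n)) = m)"
proof -
  interpret loewner_problem A B m n by unfold_locales (rule A B)+
  note defs = Xp_def Xm_def X0_def Y0_def G_def C_def E_def Ap_def
  note a1 = solvable_upper(1)[unfolded consistent_iff_column_space C_loewner_zero(1)[symmetric]]
  note a2 = solvable_upper(1)[unfolded consistent_iff_block_inertia(1)]
  have a3: "(\<exists>X \<in> hermitian_mats n. A * X * A\<^sup>H \<succeq>\<^sub>L B) \<longrightarrow>
      {X \<in> hermitian_mats n. A * X * A\<^sup>H \<succeq>\<^sub>L B} =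
        {Xp U W | U W. U \<in> carrier_mat n n \<and> W \<in> hermitian_mats n} \<and>
      (\<forall>U \<in> carrier_mat n n. \<forall>W \<in> hermitian_mats n.
        A * Xp U W * A\<^sup>H = Y0 + A * U * U\<^sup>H * A\<^sup>H)"
    unfolding solvable_upper(1) using solution_set_upper(1) A_Xp_A by blast
  note b1 = solvable_upper(2)[unfolded C_loewner_zero(1)[symmetric]]
  have b2: "(\<exists>X \<in> hermitian_mats n. A * X * A\<^sup>H \<succ>\<^sub>L B) \<longrightarrow>
      {X \<in> hermitian_mats n. A * X * A\<^sup>H \<succ>\<^sub>L B} =
        {Xp U W | U W. U \<in> carrier_mat n n \<and> rk (row_block (B * E) (A * U)) = m \<and> W \<in> hermitian_mats n} \<and>
      rk (row_block (B * E) (A * 1\<^sub>m n)) = m"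
    unfolding solvable_upper(2) using solution_set_upper(2) strictly_consistentD by blast
  note c1 = solvable_lower(1)[unfolded neg_consistent_iff_column_space C_loewner_zero(2)[symmetric]]
  note c2 = solvable_lower(1)[unfolded consistent_iff_block_inertia(2)]
  have c3: "(\<exists>X \<in> hermitian_mats n. A * X * A\<^sup>H \<preceq>\<^sub>L B) \<longrightarrow>
      {X \<in> hermitian_mats n. A * X * A\<^sup>H \<preceq>\<^sub>L B} =
        {Xm U W | U W. U \<in> carrier_mat n n \<and> W \<in> hermitian_mats n} \<and>
      (\<forall>U \<in> carrier_mat n n. \<forall>W \<in> hermitian_mats n.
        A * Xm U W * A\<^sup>H = Y0 - A * U * U\<^sup>H * A\<^sup>H)"
    unfolding solvable_lower(1) using solution_set_lower(1) A_Xm_A by blast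
  note d1 = solvable_lower(2)[unfolded C_loewner_zero(2)[symmetric]]
  have d2: "(\<exists>X \<in> hermitian_mats n. A * X * A\<^sup>H \<prec>\<^sub>L B) \<longrightarrow>
      {X \<in> hermitian_mats n. A * X * A\<^sup>H \<prec>\<^sub>L B} =
        {Xm U W | U W. U \<in> carrier_mat n n \<and> rk (row_block (B * E) (A * U)) = m \<and> W \<in> hermitian_mats n} \<and>
      rk (row_block (B * E) (A * 1\<^sub>m n)) = m"
    unfolding solvable_lower(2) using solution_set_lower(2) strictly_consistent_neg by blast
  show ?thesis
    unfolding Let_def
    using a1[unfolded defs] a2 a3[unfolded defs] b1[unfolded defs] b2[unfolded defs]
      c1[unfolded defs] c2 c3[unfolded defs] d1[unfolded defs] d2[unfolded defs]
    by (intro conjI)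
qed

end
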